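(* For the cubic Arnoux--Yoccoz map, with natural symbolic coding given by the substitution $\sigma$ on $\{1,\dots,9\}$ (with associated $\beta$, $\Gamma$ as described in the context), for each good eigenvector $\gamma$ associated with $\beta$ there are exactly two orbits (under the shift on $\Omega_\sigma$) of minimal sequences for $\gamma$; that is, exactly two shift orbits in $\Omega_\sigma$ contain a minimal sequence for $\gamma$.
   Context: **The map and its coding.** Let $\alpha$ be the unique real number with $\alpha+\alpha^2+\alpha^3=1$. For an interval $[t_0,t_1)$ let $G_{t_0,t_1}$ be the map exchanging the two halves of $[t_0,t_1)$ by translations and equal to the identity outside $[t_0,t_1)$. The cubic Arnoux--Yoccoz map is $T=G_{0,1}\circ G_{0,\alpha}\circ G_{\alpha,\alpha+\alpha^2}\circ G_{\alpha+\alpha^2,1}$ on $[0,1)$. For a suitable refinement of its continuity intervals into nine intervals, its symbolic coding is the subshift $\Omega_\sigma$ of the primitive substitution $\sigma$ on $\mathcal A=\{1,\dots,9\}$: $\sigma(1)=35$, $\sigma(2)=45$, $\sigma(3)=46$, $\sigma(4)=17$, $\sigma(5)=18$, $\sigma(6)=19$, $\sigma(7)=29$, $\sigma(8)=2$, $\sigma(9)=3$. Here $\Omega_\sigma\subseteq\mathcal A^{\mathbb Z}$ is the set of two-sided sequences all of whose finite subwords are subwords of $\sigma^n(a)$ for some $n\ge0$, $a\in\mathcal A$, with the left shift $S$. $M$ is the matrix with $M_{a,b}$ = number of occurrences of $b$ in $\sigma(a)$. Let $\beta$ be the root of $t^3+t^2+t-1$ with positive imaginary part ($\beta\approx-0.7718+1.1151i$),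 an eigenvalue of $M$ with $|\beta|>1$; $\beta_0=\beta/|\beta|$. Its eigenspace is one-dimensional, generated by $\Gamma=(\beta^2+\beta+1,-\beta,-\beta,-\beta^2-\beta-1,\beta+1,\beta+1,-\beta^2-\beta-2,-1,-1)$. **Minimal sequences.** For $\gamma\in\mathbb C^{\mathcal A}$ and a word $w=w_0\dots w_{n-1}$ put $\gamma(w)=\gamma_{w_0}+\dots+\gamma_{w_{n-1}}$; for $\omega\in\Omega_\sigma$ put $\gamma_0(\omega)=0$, $\gamma_n(\omega)=\gamma(\omega_0\dots\omega_{n-1})$, $\gamma_{-n}(\omega)=-\gamma(\omega_{-n}\dots\omega_{-1})$ for $n\ge1$. $\omega$ is a minimal sequence for $\gamma$ if $\mathrm{Re}(\gamma_n(\omega))\ge0$ for all $n\in\mathbb Z$. **Fractals.** Let $\bar{\mathcal A}_a=\{(p,c,s)\in\mathcal A^*\times\mathcal A\times\mathcal A^*:\sigma(a)=pcs\}$ ($\mathcal A^*$: finite words, including the empty word) and $\bar{\mathcal A}=\bigcup_a\bar{\mathcal A}_a$ (labels). Let $\mathcal S_a$ be the set of sequences $x=(p^x_m,c^x_m,s^x_m)_{m\ge1}\in\bar{\mathcal A}^{\mathbb N}$ with $(p^x_1,c^x_1,s^x_1)\in\bar{\mathcal A}_a$ and $(p^x_{m+1},c^x_{m+1},s^x_{m+1})\in\bar{\mathcal A}_{c^x_m}$ for $m\ge1$; let $\mathcal S_{a,(p,c,s)}$ be those with first coordinate $(p,c,s)$. Put $z_a(x)=\sum_{m\ge1}\beta^{-m}\Gamma(p^x_m)$,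 $F_a=z_a(\mathcal S_a)$, $F_{a,(p,c,s)}=z_a(\mathcal S_{a,(p,c,s)})$ (compact subsets of $\mathbb C$). For $\tau\in\mathbb S^1$ (unit circle in $\mathbb C$) let $v_a(\tau)=\min_{z\in F_a}\mathrm{Re}(\tau z)$ and $v_{a,(p,c,s)}(\tau)=\min_{z\in F_{a,(p,c,s)}}\mathrm{Re}(\tau z)$. **Good eigenvectors.** $\Psi_a$ is the set of $\tau\in\mathbb S^1$ such that $v_a(\tau)=v_{a,(p,c,s)}(\tau)=v_{a,(\bar p,\bar c,\bar s)}(\tau)$ for some different labels $(p,c,s),(\bar p,\bar c,\bar s)\in\bar{\mathcal A}_a$; $\Psi=\bigcup_a\Psi_a$. $\llbracket\tau-\tau'\rrbracket$ is the natural (arc-length) distance on $\mathbb S^1$. A direction $\tau\in\mathbb S^1$ is good if for some constant $1<A<|\beta|$ and every $\xi\in\Psi$, $\liminf_{n\to\infty}A^n\llbracket\xi-\beta_0^n\tau\rrbracket=\infty$. An eigenvector $\gamma$ of $M$ for $\beta$ is good if $\gamma=z\Gamma$ with $z\in\mathbb C\setminus\{0\}$ and $z/|z|$ a good direction. *)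

theory Defs
  imports "HOL-Analysis.Analysis" "HOL-Library.Sublist"
begin

datatype letter = L1 | L2 | L3 | L4 | L5 | L6 | L7 | L8 | L9

instance letter :: finite
proof
  have "(UNIV :: letter set) \<subseteq> {L1, L2, L3, L4, L5, L6, L7, L8, L9}"
    using letter.exhaust by blast
  then show "finite (UNIV :: letter set)"
    by (rule finite_subset) simp
qed

type_synonym word = "letter list"
type_synonym label = "word \<times> letter \<times> word"

fun \<sigma> :: "letter \<Rightarrow> word" where
  "\<sigma> L1 = [L3, L5]"
| "\<sigma> L2 = [L4, L5]"
| "\<sigma> L3 = [L4, L6]"
| "\<sigma> L4 = [L1, L7]"
| "\<sigma> L5 = [L1, L8]"
| "\<sigma> L6 = [L1, L9]"
| "\<sigma> L7 = [L2, L9]"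
| "\<sigma> L8 = [L2]"
| "\<sigma> L9 = [L3]"

definition \<sigma>_word :: "word \<Rightarrow> word" where
  "\<sigma>_word w = concat (map \<sigma> w)"

definition \<Omega> :: "(int \<Rightarrow> letter) set" where
  "\<Omega> = {\<omega>. \<forall>i j. \<exists>n a. sublist (map \<omega> [i..j]) ((\<sigma>_word ^^ n) [a])}"

definition shift_orbit :: "(int \<Rightarrow> letter) \<Rightarrow> (int \<Rightarrow> letter) set" where
  "shift_orbit \<omega> = {(\<lambda>i. \<omega> (i + k)) | k. True}"

definition subst_matrix :: "complex ^ letter ^ letter" where
  "subst_matrix = (\<chi> a b. of_nat (count_list (\<sigma> a) b))"

definition \<beta> :: complex where
  "\<beta> = (THE t. t ^ 3 + t ^ 2 + t - 1 = 0 \<and> Im t > 0)"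

definition \<beta>\<^sub>0 :: complex where
  "\<beta>\<^sub>0 = \<beta> / of_real (cmod \<beta>)"

definition \<Gamma> :: "complex ^ letter" where
  "\<Gamma> = (\<chi> a. case a of
      L1 \<Rightarrow> \<beta> ^ 2 + \<beta> + 1
    | L2 \<Rightarrow> - \<beta>
    | L3 \<Rightarrow> - \<beta>
    | L4 \<Rightarrow> - (\<beta> ^ 2) - \<beta> - 1
    | L5 \<Rightarrow> \<beta> + 1
    | L6 \<Rightarrow> \<beta> + 1
    | L7 \<Rightarrow> - (\<beta> ^ 2) - \<beta> - 2
    | L8 \<Rightarrow> - 1
    | L9 \<Rightarrow> - 1)"

definition word_sum :: "complex ^ letter \<Rightarrow> word \<Rightarrow> complex" where
  "word_sum \<gamma> w = (\<Sum>a\<leftarrow>w. \<gamma> $ a)"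

definition seq_sum :: "complex ^ letter \<Rightarrow> (int \<Rightarrow> letter) \<Rightarrow> int \<Rightarrow> complex" where
  "seq_sum \<gamma> \<omega> n =
    (if n \<ge> 0 then word_sum \<gamma> (map \<omega> [0..n - 1]) else - word_sum \<gamma> (map \<omega> [n..-1]))"

definition minimal_sequence :: "complex ^ letter \<Rightarrow> (int \<Rightarrow> letter) \<Rightarrow> bool" where
  "minimal_sequence \<gamma> \<omega> \<longleftrightarrow> \<omega> \<in> \<Omega> \<and> (\<forall>n. Re (seq_sum \<gamma> \<omega> n) \<ge> 0)"

definition labels :: "letter \<Rightarrow> label set" where
  "labels a = {(p, c, s). \<sigma> a = p @ [c] @ s}"

text \<open>Label sequences are indexed from 0 here and from 1 in the mathematical text,
  so \<open>x m\<close> is the label with index \<open>m + 1\<close>.\<close>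

definition label_seqs :: "letter \<Rightarrow> (nat \<Rightarrow> label) set" where
  "label_seqs a =
    {x. x 0 \<in> labels a \<and> (\<forall>m. x (Suc m) \<in> labels (fst (snd (x m))))}"

definition label_seqs_from :: "letter \<Rightarrow> label \<Rightarrow> (nat \<Rightarrow> label) set" where
  "label_seqs_from a l = {x \<in> label_seqs a. x 0 = l}"

definition label_point :: "(nat \<Rightarrow> label) \<Rightarrow> complex" where
  "label_point x = (\<Sum>m. word_sum \<Gamma> (fst (x m)) / \<beta> ^ Suc m)"

definition fractal :: "letter \<Rightarrow> complex set" where
  "fractal a = label_point ` label_seqs a"

definition fractal_from :: "letter \<Rightarrow> label \<Rightarrow> complex set" where
  "fractal_from a l = label_point ` label_seqs_from a l"

text \<open>The fractals are nonempty and compact, so the infima below are minima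
  (for \<open>fractal_from a l\<close> when \<open>l \<in> labels a\<close>).\<close>

definition v :: "letter \<Rightarrow> complex \<Rightarrow> real" where
  "v a \<tau> = (INF z\<in>fractal a. Re (\<tau> * z))"

definition v_from :: "letter \<Rightarrow> label \<Rightarrow> complex \<Rightarrow> real" where
  "v_from a l \<tau> = (INF z\<in>fractal_from a l. Re (\<tau> * z))"

definition \<Psi>_at :: "letter \<Rightarrow> complex set" where
  "\<Psi>_at a = {\<tau> \<in> sphere 0 1. \<exists>l\<in>labels a. \<exists>l'\<in>labels a.
      l \<noteq> l' \<and> v a \<tau> = v_from a l \<tau> \<and> v a \<tau> = v_from a l' \<tau>}"

definition \<Psi> :: "complex set" where
  "\<Psi> = (\<Union>a. \<Psi>_at a)"

text \<open>For points of the unit circle this is the length of the shorter arc between them,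
  since \<open>Arg\<close> takes values in \<open>(-pi, pi]\<close>.\<close>

definition arc_dist :: "complex \<Rightarrow> complex \<Rightarrow> real" where
  "arc_dist \<xi> \<tau> = \<bar>Arg (\<xi> / \<tau>)\<bar>"

definition good_direction :: "complex \<Rightarrow> bool" where
  "good_direction \<tau> \<longleftrightarrow> \<tau> \<in> sphere 0 1 \<and>
    (\<exists>A::real. 1 < A \<and> A < cmod \<beta> \<and>
      (\<forall>\<xi>\<in>\<Psi>. liminf (\<lambda>n. ereal (A ^ n * arc_dist \<xi> (\<beta>\<^sub>0 ^ n * \<tau>))) = \<infinity>))"

definition good_eigenvector :: "complex ^ letter \<Rightarrow> bool" where
  "good_eigenvector \<gamma> \<longleftrightarrow> \<gamma> \<noteq> 0 \<and> subst_matrix *v \<gamma> = \<beta> *s \<gamma> \<and>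
    (\<exists>z. z \<noteq> 0 \<and> \<gamma> = z *s \<Gamma> \<and> good_direction (z / of_real (cmod z)))"

end

theory Submission
  imports Defs
begin

text \<open>
  Put \<open>x k = Re (z * \<beta> powi k)\<close>. Desubstituting a minimal sequence \<open>n\<close> times shows that the letter at
  level \<open>n + 1\<close> over the origin is always split by a label that minimises the walk inside
  that iterated image, so everything reduces to these finite minima. They depend only on the classes
  \<open>1\<close>, \<open>{2,3}\<close>, \<open>4\<close>, \<open>{5,6}\<close>, \<open>7\<close>, \<open>{8,9}\<close>; the pieces for \<open>{2,3}\<close>, \<open>{5,6}\<close>, \<open>{8,9}\<close> are centrally
  symmetric, and passing to half-widths turns the recursion for the minima into
  \<open>s k = max (s (k - 3) + (\<bar>x (k - 2)\<bar> + \<bar>x (k - 4)\<bar>) / 2) (s (k - 2))\<close>. All decisions that matter are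
  then governed by the signs of consecutive terms of \<open>x\<close>, that is, by the sector containing
  \<open>z * \<beta> ^ n\<close>. In each of eight sectors two letters are distinguished; descending one level maps
  the pair of a sector bijectively onto the pair of the next one, and the slow rotation of \<open>\<beta>\<^sup>3\<close> forces every optimal chain
  of letters into one of the two resulting threads. Both threads are realised, and they determine
  the sequence up to a shift because the substitution is recognisable: blocks start exactly at the
  letters \<open>1,2,3,4\<close>.
\<close>

text \<open>Since \<Gamma> is an eigenvector, the sum of the n-fold image of a word p is \<beta>^n
  \<Gamma>(p); hence every label splits a walk at a cost that is 0 or a single term of
  \<open>x\<close> up to sign. The obstacle is the comparison of the two options in the recursion
  for \<open>s\<close>. They refer to levels of different parity, whereas monotonicity is available
  only in steps of two. Bounds for the gap \<open>s (k - 1) - s k\<close> fill this hole. They pass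
  from level \<open>k - 3\<close> to level \<open>k\<close> while the sign pattern repeats, and hold
  outright at a turning level, where a term of \<open>x\<close> has changed sign along a step of
  three. Turning levels exist, and \<open>x\<close> is eventually nonzero, because no positive power
  of \<beta> is real. The finite minima start from 0 at level 0, so the strict inequalities hold
  only from some level on, and minimising labels at low levels need not be unique. This does not
  affect the count: the letters above any fixed level already determine the orbit.\<close>

section \<open>Sign patterns of the real tribonacci sequence\<close>

text \<open>\<open>trib\<close> is the cubic equation of \<beta>. Dividing that cubic by t -
  \<open>al\<close> leaves al t^2 + (al + al^2) t + 1 = 0 for the two nonreal roots, up to the
  factor \<open>al\<close>; this is \<open>quad\<close>. It expresses a term by two consecutive
  ones, while \<open>trib\<close> has integer coefficients and suits linear arithmetic.\<close>

locale ay_signs =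
  fixes al :: real and x :: "int \<Rightarrow> real"
  assumes al_bounds: "5436/10000 < al" "al < 5437/10000"
    and trib: "\<And>k. x (k - 3) = x (k - 2) + x (k - 1) + x k"
    and quad: "\<And>k. x (k - 2) = - ((al + al\<^sup>2) * x (k - 1)) - al * x k"
begin

text \<open>Added to the bracket for \<open>al\<close>, this gives 0.8391 < al + al^2 < 0.8394, the
  source of the constants in \<open>quad_pp\<close> and its variants.\<close>

lemma al2_bounds: "2955/10000 < al\<^sup>2" "al\<^sup>2 < 2957/10000"
proof -
  have "(5436/10000)\<^sup>2 < al\<^sup>2" using al_bounds by (intro power_strict_mono) auto
  then show "2955/10000 < al\<^sup>2" by (simp add: power2_eq_square)
  have "al\<^sup>2 < (5437/10000)\<^sup>2" using al_bounds by (intro power_strict_mono) auto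
  then show "al\<^sup>2 < 2957/10000" by (simp add: power2_eq_square)
qed

text \<open>Turns the irrational relation \<open>quad\<close> into inequalities within reach of linear arithmetic
  once the signs of two consecutive terms are known.\<close>

lemma enclosure:
  assumes "0 \<le> u"
  shows "5436/10000 * u \<le> al * u" "al * u \<le> 5437/10000 * u"
    "8391/10000 * u \<le> (al + al\<^sup>2) * u" "(al + al\<^sup>2) * u \<le> 8394/10000 * u"
  using mult_right_mono[OF less_imp_le[OF al_bounds(1)] assms] mult_right_mono[OF less_imp_le[OF al_bounds(2)] assms]
    mult_right_mono[OF less_imp_le[OF al2_bounds(1)] assms] mult_right_mono[OF less_imp_le[OF al2_bounds(2)] assms]
  by (simp_all add: distrib_right)

lemma quad_pp: "0 \<le> x (k - 1) \<Longrightarrow> 0 \<le> x k \<Longrightarrow>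
    - 8394/10000 * x (k - 1) - 5437/10000 * x k \<le> x (k - 2)
    \<and> x (k - 2) \<le> - 8391/10000 * x (k - 1) - 5436/10000 * x k"
  using enclosure[of "x (k - 1)"] enclosure[of "x k"] quad[of k] by argo

lemma quad_pm: "0 \<le> x (k - 1) \<Longrightarrow> x k \<le> 0 \<Longrightarrow>
    - 8394/10000 * x (k - 1) - 5436/10000 * x k \<le> x (k - 2)
    \<and> x (k - 2) \<le> - 8391/10000 * x (k - 1) - 5437/10000 * x k"
  using enclosure[of "x (k - 1)"] enclosure[of "- x k"] quad[of k] by (auto simp: algebra_simps)

text \<open>Both relations are linear, so z may be replaced by -z; each sign lemma thereby yields
  its mirror image.\<close>

lemma neg: "ay_signs al (\<lambda>k. - x k)"
  using al_bounds by unfold_locales (auto simp: trib quad algebra_simps)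

lemma quad_mm: "x (k - 1) \<le> 0 \<Longrightarrow> x k \<le> 0 \<Longrightarrow>
    - 8391/10000 * x (k - 1) - 5436/10000 * x k \<le> x (k - 2)
    \<and> x (k - 2) \<le> - 8394/10000 * x (k - 1) - 5437/10000 * x k"
  using ay_signs.quad_pp[OF neg, of k] by auto

lemma quad_mp: "x (k - 1) \<le> 0 \<Longrightarrow> 0 \<le> x k \<Longrightarrow>
    - 8391/10000 * x (k - 1) - 5437/10000 * x k \<le> x (k - 2)
    \<and> x (k - 2) \<le> - 8394/10000 * x (k - 1) - 5436/10000 * x k"
  using ay_signs.quad_pm[OF neg, of k] by auto

lemma trib_list:
  "x (k - 3) = x (k - 2) + x (k - 1) + x k"
  "x (k - 4) = x (k - 3) + x (k - 2) + x (k - 1)"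
  "x (k - 5) = x (k - 4) + x (k - 3) + x (k - 2)"
  "x (k - 6) = x (k - 5) + x (k - 4) + x (k - 3)"
  "x (k - 7) = x (k - 6) + x (k - 5) + x (k - 4)"
  "x (k - 8) = x (k - 7) + x (k - 6) + x (k - 5)"
  "x (k - 9) = x (k - 8) + x (k - 7) + x (k - 6)"
  using trib[of k] trib[of "k-1"] trib[of "k-2"] trib[of "k-3"] trib[of "k-4"] trib[of "k-5"] trib[of "k-6"]
  by simp_all

text \<open>The prefixes of the sign lemmas anticipate the sectors: the hypotheses are sign patterns
  of the sector at level \<open>k\<close>, with \<open>AD_signs\<close> also covering
  \<open>DG\<close>. The conclusions fix the next sectors below and resolve absolute values in later
  estimates.\<close>

lemma AB_signs:
  assumes "x (k - 1) > 0" "x (k - 2) < 0" "x (k - 3) < 0"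
  shows "x k < 0" "x (k - 4) > 0" "x (k - 5) < 0"
  using assms trib_list[of k] quad_mp[of "k - 1"] quad_mm[of "k - 2"] by simp_all

lemma BD_signs:
  assumes "x (k - 1) < 0" "x (k - 2) < 0"
  shows "x k > 0" "x (k - 3) > 0" "x (k - 4) < 0" "x (k - 6) > 0"
proof -
  have 1: "x (k - 3) > 0" using assms quad_mm[of "k - 1"] by simp
  have 2: "x (k - 4) < 0" using assms 1 trib_list[of k] quad_mm[of "k - 1"] by simp
  show "x k > 0" using assms 1 trib_list[of k] by simp
  show "x (k - 6) > 0" using assms 1 2 trib_list[of k] quad_mm[of "k - 1"] quad_pm[of "k-2"] by simp
  show "x (k - 3) > 0" "x (k - 4) < 0" by fact+
qed

lemma AE_signs:
  assumes "x (k - 1) > 0" "x (k - 2) < 0" "x (k - 3) > 0"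
  shows "x (k - 5) < 0" "x (k - 6) > 0" "x (k - 3) + x (k - 4) > 0"
    "x (k - 4) < 0 \<Longrightarrow> x k > 0"
proof -
  have q: "- 8394/10000 * x (k - 3) - 5436/10000 * x (k - 2) \<le> x (k - 4)"
    "x (k - 4) \<le> - 8391/10000 * x (k - 3) - 5437/10000 * x (k - 2)"
    using quad_pm[of "k - 2"] assms by simp_all
  have q2: "- 8391/10000 * x (k - 2) - 5437/10000 * x (k - 1) \<le> x (k - 3)"
    "x (k - 3) \<le> - 8394/10000 * x (k - 2) - 5436/10000 * x (k - 1)"
    using quad_mp[of "k - 1"] assms by simp_all
  show "x (k - 3) + x (k - 4) > 0" using q assms by linarith
  show "x (k - 5) < 0" using q q2 assms trib_list[of k] by linarith
  show "x (k - 6) > 0" using q q2 assms trib_list[of k] by linarith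
  show "x k > 0" if "x (k - 4) < 0" using q q2 that assms trib_list[of k] by linarith
qed

lemma AD_signs:
  assumes "x k < 0" "x (k - 1) < 0"
  shows "x (k - 2) > 0" "x (k - 3) < 0" "x (k - 5) > 0"
  using assms trib_list[of k] quad_mm[of k] by linarith+

lemma EH_signs:
  assumes "x k > 0" "x (k - 1) < 0" "x (k - 2) > 0" "x (k - 3) < 0"
  shows "x (k - 4) < 0"
proof -
  have "x (k - 4) \<le> - 8391/10000 * x (k - 3) - 5436/10000 * x (k - 2)
     \<or> x (k - 4) \<le> - 8394/10000 * x (k - 3) - 5436/10000 * x (k - 2)"
    using quad_mp[of "k - 2"] assms by simp
  then show ?thesis using assms trib_list[of k] quad_mp[of k] quad_pm[of "k-1"] by linarith
qed

lemma BE_signs: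
  assumes "x (k - 1) > 0" "x (k - 2) > 0"
  shows "x k < 0" "x (k - 3) < 0" "x (k - 4) > 0" "x (k - 6) < 0"
  using ay_signs.BD_signs[OF neg, of k] assms by auto

text \<open>Used with \<open>k = m + 4\<close>: a change from positive to negative between
  \<open>x m\<close> and \<open>x (m + 3)\<close> makes \<open>x (m + 4)\<close> negative too, so
  that two consecutive negative terms appear.\<close>

lemma descent_signs:
  assumes "x (k - 4) > 0" "x (k - 1) < 0"
  shows "x k < 0"
  using assms trib_list[of k] quad_mp[of k] by linarith

end

section \<open>Half-widths\<close>

text \<open>\<open>s\<close> and \<open>t\<close> will be the distances from the centre to the
  minimum for the letters 5, 6 and 2, 3. Their recursions see \<open>x\<close> only through absolute
  values, so the same \<open>s\<close> and \<open>t\<close> serve for \<open>- x\<close>.\<close>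

locale ay_width = ay_signs +
  fixes s t :: "int \<Rightarrow> real" and K :: int
  assumes nonzero: "K \<le> k \<Longrightarrow> x k \<noteq> 0"
    and s_rec: "K \<le> k \<Longrightarrow> s k = max (t (k - 2) + \<bar>x (k - 2)\<bar> / 2) (s (k - 2))"
    and t_rec: "K \<le> k \<Longrightarrow> t k = max (s (k - 1) + \<bar>x (k - 2)\<bar> / 2) (t (k - 4))"
begin

lemma neg_width: "ay_width al (\<lambda>k. - x k) s t K"
proof -
  interpret n: ay_signs al "\<lambda>k. - x k" by (rule neg)
  show ?thesis using nonzero s_rec t_rec by unfold_locales auto
qed

lemma s_ge: "K \<le> k \<Longrightarrow> s (k - 2) \<le> s k" "K \<le> k \<Longrightarrow> t (k - 2) + \<bar>x (k - 2)\<bar> / 2 \<le> s k"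
  and t_ge: "K \<le> k \<Longrightarrow> s (k - 1) + \<bar>x (k - 2)\<bar> / 2 \<le> t k"
  using s_rec t_rec by simp_all

lemma s_ge3: "K + 2 \<le> k \<Longrightarrow> s (k - 3) + (\<bar>x (k - 2)\<bar> + \<bar>x (k - 4)\<bar>) / 2 \<le> s k"
  using s_ge(2)[of k] t_ge[of "k - 2"] by simp argo

text \<open>The symmetric piece behind \<open>t\<close> consists of two copies of a smaller one and of a central
  part; the central part never reaches the boundary, which eliminates \<open>t\<close> from the recursion for
  \<open>s\<close>.\<close>

lemma shorter_middle_pos:
  assumes k: "K + 20 \<le> k" and x3: "x (k - 3) < 0"
  shows "t (k - 4) < s (k - 1) + \<bar>x (k - 2)\<bar> / 2"
proof -
  have s1: "s (k-3) \<le> s (k-1)" "s (k-5) \<le> s (k-3)" "s (k-6) \<le> s (k-4)" "s (k-8) \<le> s (k-6)"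
    using k s_ge(1)[of "k-1"] s_ge(1)[of "k-3"] s_ge(1)[of "k-4"] s_ge(1)[of "k-6"] by simp_all
  have s13: "s (k-4) + (\<bar>x (k-3)\<bar> + \<bar>x (k-5)\<bar>) / 2 \<le> s (k-1)"
    using k s_ge3[of "k-1"] by simp
  have t8: "t (k-8) + \<bar>x (k-8)\<bar> / 2 \<le> s (k-6)" using k s_ge(2)[of "k-6"] by simp
  have x3': "\<bar>x (k-3)\<bar> > 0" using x3 by simp
  have t4: "t (k-4) = max (s (k-5) + \<bar>x (k-6)\<bar> / 2) (t (k-8))" using k t_rec[of "k-4"] by simp
  have a: "t (k-8) < s (k-1) + \<bar>x (k-2)\<bar> / 2"
    using t8 s1 s13 x3' abs_ge_zero[of "x (k-8)"] abs_ge_zero[of "x (k-5)"] abs_ge_zero[of "x (k-2)"] by argo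
  have b: "s (k-5) + \<bar>x (k-6)\<bar> / 2 < s (k-1) + \<bar>x (k-2)\<bar> / 2"
  proof (cases "\<bar>x (k-6)\<bar> < \<bar>x (k-2)\<bar>")
    case True
    then show ?thesis using s1 by linarith
  next
    case False
    have x3n: "x (k-3) \<le> 0" using x3 by simp
    have y4: "x (k-2) \<ge> 0 \<Longrightarrow> - 8391/10000 * x (k - 3) - 5437/10000 * x (k-2) \<le> x (k - 4)
         \<and> x (k - 4) \<le> - 8394/10000 * x (k - 3) - 5436/10000 * x (k-2)"
      "x (k-2) \<le> 0 \<Longrightarrow> - 8391/10000 * x (k - 3) - 5436/10000 * x (k-2) \<le> x (k - 4)
         \<and> x (k - 4) \<le> - 8394/10000 * x (k - 3) - 5437/10000 * x (k-2)"
      using quad_mp[of "k-2"] quad_mm[of "k-2"] x3n by simp_all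
    note T = trib_list[of k]
    \<comment> \<open>Only here can the middle compete: \<open>x (k - 2)\<close> is small compared
      with \<open>x (k - 3)\<close>. In this narrow range the signs of all terms down to
      \<open>x (k - 9)\<close> are forced.\<close>
    have r: "3/10 * x (k-3) \<le> x (k-2)" "x (k-2) \<le> - 36/100 * x (k-3)"
      using False y4 T x3 by linarith+
    have y5: "x (k-5) \<le> 0" using False y4 T x3 by linarith
    have y6: "x (k-6) \<le> 0" using y4 T r x3 by linarith
    have y4p: "x (k-4) \<ge> 0" using y4 T r x3 by linarith
    have m6: "\<bar>x (k-6)\<bar> = x (k-2) - 2 * x (k-5)" using T y6 by linarith
    have y8: "x (k-8) \<le> 0" using y4 T r x3 by linarith
    have y7: "x (k-7) \<ge> - 1/100 * x (k-3)" using y4 T r x3 by linarith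
    have y9: "x (k-9) \<le> 0"
      using y4 T r x3 by linarith
    have s47: "s (k-7) + (\<bar>x (k-6)\<bar> + \<bar>x (k-8)\<bar>) / 2 \<le> s (k-4)"
      using k s_ge3[of "k-4"] by simp
    have s69: "s (k-9) + (\<bar>x (k-8)\<bar> + \<bar>x (k-10)\<bar>) / 2 \<le> s (k-6)"
      using k s_ge3[of "k-6"] by simp
    have t11: "t (k-11) + \<bar>x (k-11)\<bar> / 2 \<le> s (k-9)" using k s_ge(2)[of "k-9"] by simp
    \<comment> \<open>Comparing \<open>s (k - 5)\<close> with \<open>s (k - 1)\<close> is too coarse
      in this range. One more unfolding leaves three candidates, which \<open>c1\<close>,
      \<open>c2\<close> and \<open>c3\<close> exclude.\<close>
    have s5: "s (k-5) = max (t (k-7) + \<bar>x (k-7)\<bar> / 2) (s (k-7))" using k s_rec[of "k-5"] by simp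
    have t7: "t (k-7) = max (s (k-8) + \<bar>x (k-9)\<bar> / 2) (t (k-11))" using k t_rec[of "k-7"] by simp
    have c1: "s (k-7) + \<bar>x (k-6)\<bar> / 2 < s (k-1) + \<bar>x (k-2)\<bar> / 2"
      using s47 s13 x3' abs_ge_zero[of "x (k-2)"] abs_ge_zero[of "x (k-5)"] abs_ge_zero[of "x (k-8)"] by argo
    have c2: "s (k-8) + \<bar>x (k-9)\<bar> / 2 + \<bar>x (k-7)\<bar> / 2 + \<bar>x (k-6)\<bar> / 2 < s (k-1) + \<bar>x (k-2)\<bar> / 2"
    proof -
      have "\<bar>x (k-9)\<bar> + \<bar>x (k-7)\<bar> + \<bar>x (k-6)\<bar> < \<bar>x (k-3)\<bar> + \<bar>x (k-5)\<bar> + x (k-2)"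
        using y4 T r x3 y5 y6 y7 y8 y9 m6 by linarith
      then show ?thesis using s13 s1 abs_ge_self[of "x (k-2)"] by argo
    qed
    have c3: "t (k-11) + \<bar>x (k-7)\<bar> / 2 + \<bar>x (k-6)\<bar> / 2 < s (k-1) + \<bar>x (k-2)\<bar> / 2"
    proof -
      have "\<bar>x (k-7)\<bar> + \<bar>x (k-6)\<bar> < \<bar>x (k-3)\<bar> + \<bar>x (k-5)\<bar> + x (k-2)"
        using y4 T r x3 y5 y6 y7 y8 y9 m6 by linarith
      then show ?thesis using s13 s1 s69 t11 abs_ge_self[of "x (k-2)"] abs_ge_zero[of "x (k-8)"] abs_ge_zero[of "x (k-10)"] abs_ge_zero[of "x (k-11)"] by argo
    qed
    show ?thesis using c1 c2 c3 s5 t7 by linarith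
  qed
  show ?thesis using a b t4 by linarith
qed

lemma shorter_middle:
  assumes k: "K + 20 \<le> k"
  shows "t (k - 4) < s (k - 1) + \<bar>x (k - 2)\<bar> / 2"
proof (cases "x (k - 3) < 0")
  case True
  then show ?thesis using shorter_middle_pos k by simp
next
  case False
  then have "- x (k - 3) < 0" using nonzero[of "k-3"] k by simp
  then show ?thesis using ay_width.shorter_middle_pos[OF neg_width k] by simp
qed

lemma s_eq:
  assumes "K + 22 \<le> k"
  shows "s k = max (s (k - 3) + (\<bar>x (k - 2)\<bar> + \<bar>x (k - 4)\<bar>) / 2) (s (k - 2))"
proof -
  have "t (k - 2) = s (k - 3) + \<bar>x (k - 4)\<bar> / 2"
    using t_rec[of "k-2"] shorter_middle[of "k-2"] assms by simp
  then show ?thesis using s_rec[of k] assms by (simp add: add_divide_distrib algebra_simps)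
qed

text \<open>Unfolding \<open>s (k - 2)\<close> twice leaves candidates at levels
  \<open>k - 5\<close>, \<open>k - 7\<close> and \<open>k - 6\<close>. The first two are bounded by
  \<open>s (k - 3)\<close> through steps of two, and \<open>m\<close> and \<open>n\<close> control
  the increments; the third is bounded by \<open>s_ge3\<close>. Thus the option coming from level
  \<open>k - 3\<close> wins in \<open>s_eq\<close>.\<close>

lemma three_step_AE_pos:
  assumes k: "K + 30 \<le> k" and y: "x (k - 1) > 0" "x (k - 2) < 0" "x (k - 3) > 0"
  shows "s (k - 2) < s (k - 3) + (\<bar>x (k - 2)\<bar> + \<bar>x (k - 4)\<bar>) / 2"
proof -
  note sg = AE_signs[OF y]
  note T = trib_list[of k]
  have m: "\<bar>x (k-6)\<bar> < \<bar>x (k-2)\<bar>" using T sg y by linarith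
  have n: "\<bar>x (k-6)\<bar> + \<bar>x (k-8)\<bar> < \<bar>x (k-2)\<bar> + \<bar>x (k-4)\<bar>"
  proof -
    have q: "- 8394/10000 * x (k - 3) - 5436/10000 * x (k - 2) \<le> x (k - 4)"
      "x (k - 4) \<le> - 8391/10000 * x (k - 3) - 5437/10000 * x (k - 2)"
      using quad_pm[of "k - 2"] y by simp_all
    have "\<bar>x (k-8)\<bar> < \<bar>x (k-2)\<bar> + \<bar>x (k-4)\<bar> - x (k-6)" using q T y by linarith
    then show ?thesis using sg by linarith
  qed
  have "s (k-2) = max (s (k-5) + (\<bar>x (k-4)\<bar> + \<bar>x (k-6)\<bar>) / 2) (s (k-4))"
    using s_eq[of "k-2"] k by simp
  moreover have "s (k-4) = max (s (k-7) + (\<bar>x (k-6)\<bar> + \<bar>x (k-8)\<bar>) / 2) (s (k-6))"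
    using s_eq[of "k-4"] k by simp
  moreover have "s (k-5) \<le> s (k-3)" "s (k-7) \<le> s (k-5)" using s_ge(1)[of "k-3"] s_ge(1)[of "k-5"] k by simp_all
  moreover have "s (k-6) + (\<bar>x (k-5)\<bar> + \<bar>x (k-7)\<bar>) / 2 \<le> s (k-3)" using s_ge3[of "k-3"] k by simp
  ultimately show ?thesis using m n abs_ge_zero[of "x (k-4)"] abs_ge_zero[of "x (k-5)"] abs_ge_zero[of "x (k-7)"]
    abs_ge_zero[of "x (k-6)"] by argo
qed

lemma three_step_BD_pos:
  assumes k: "K + 30 \<le> k" and y: "x (k - 1) < 0" "x (k - 2) < 0" "x (k - 5) < 0"
  shows "s (k - 2) < s (k - 3) + (\<bar>x (k - 2)\<bar> + \<bar>x (k - 4)\<bar>) / 2"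
proof -
  note sg = BD_signs[OF y(1,2)]
  note T = trib_list[of k]
  have m: "\<bar>x (k-6)\<bar> < \<bar>x (k-2)\<bar>" using T sg y by linarith
  have n: "\<bar>x (k-8)\<bar> \<le> \<bar>x (k-4)\<bar>"
  proof -
    have q: "- 8394/10000 * x (k - 3) - 5436/10000 * x (k - 2) \<le> x (k - 4)"
      "x (k - 4) \<le> - 8391/10000 * x (k - 3) - 5437/10000 * x (k - 2)"
      using quad_pm[of "k - 2"] y sg by simp_all
    show ?thesis using q T y sg by linarith
  qed
  have "s (k-2) = max (s (k-5) + (\<bar>x (k-4)\<bar> + \<bar>x (k-6)\<bar>) / 2) (s (k-4))"
    using s_eq[of "k-2"] k by simp
  moreover have "s (k-4) = max (s (k-7) + (\<bar>x (k-6)\<bar> + \<bar>x (k-8)\<bar>) / 2) (s (k-6))"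
    using s_eq[of "k-4"] k by simp
  moreover have "s (k-5) \<le> s (k-3)" "s (k-7) \<le> s (k-5)" using s_ge(1)[of "k-3"] s_ge(1)[of "k-5"] k by simp_all
  moreover have "s (k-6) + (\<bar>x (k-5)\<bar> + \<bar>x (k-7)\<bar>) / 2 \<le> s (k-3)" using s_ge3[of "k-3"] k by simp
  ultimately show ?thesis using m n abs_ge_zero[of "x (k-4)"] abs_ge_zero[of "x (k-5)"] abs_ge_zero[of "x (k-7)"]
    abs_ge_zero[of "x (k-6)"] by argo
qed

text \<open>At a turning level, \<open>x (k - 5) > 0\<close>, the estimate
  \<open>s (k - 4) \<le> s k\<close> from steps of two suffices. \<open>BD_gap_step\<close> treats
  \<open>x (k - 5) < 0\<close>, where the same pattern recurs at level \<open>k - 3\<close>.\<close>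

lemma BD_gap_base:
  assumes k: "K + 40 \<le> k" and y: "x (k - 1) < 0" "x (k - 2) < 0" "x (k - 5) > 0"
  shows "s (k - 1) - s k < \<bar>x (k - 1)\<bar> + (\<bar>x k\<bar> - \<bar>x (k - 2)\<bar>) / 2"
proof -
  note sg = BD_signs[OF y(1,2)]
  note T = trib_list[of k]
  have "ay_width al (\<lambda>k. - x k) s t K" by (rule neg_width)
  \<comment> \<open>With signs reversed, level \<open>k - 1\<close> has the alternating pattern of
    \<open>three_step_AE_pos\<close>, which turns the maximum for \<open>s (k - 1)\<close> into an
    equation.\<close>
  then have "s (k-3) < s (k-4) + (\<bar>- x (k-3)\<bar> + \<bar>- x (k-5)\<bar>) / 2"
    using ay_width.three_step_AE_pos[of al "\<lambda>k. - x k" s t K "k-1"] k y sg AD_signs[of "k-1"] by simp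
  then have "s (k-1) = s (k-4) + (\<bar>x (k-3)\<bar> + \<bar>x (k-5)\<bar>) / 2"
    using s_eq[of "k-1"] k by simp
  moreover have "s (k-4) \<le> s k" using s_ge(1)[of k] s_ge(1)[of "k-2"] k by simp
  ultimately show ?thesis using T y sg abs_of_neg[OF y(1)] abs_of_neg[OF y(2)] abs_of_pos[OF y(3)] abs_of_pos[OF sg(1)] abs_of_pos[OF sg(2)] by argo
qed

lemma BD_gap_step:
  assumes k: "K + 40 \<le> k" and y: "x (k - 1) < 0" "x (k - 2) < 0" "x (k - 5) < 0"
    and IH: "s (k - 4) - s (k - 3) < \<bar>x (k - 4)\<bar> + (\<bar>x (k - 3)\<bar> - \<bar>x (k - 5)\<bar>) / 2"
  shows "s (k - 1) - s k < \<bar>x (k - 1)\<bar> + (\<bar>x k\<bar> - \<bar>x (k - 2)\<bar>) / 2"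
proof -
  note sg = BD_signs[OF y(1,2)]
  note T = trib_list[of k]
  have "ay_width al (\<lambda>k. - x k) s t K" by (rule neg_width)
  then have "s (k-3) < s (k-4) + (\<bar>- x (k-3)\<bar> + \<bar>- x (k-5)\<bar>) / 2"
    using ay_width.three_step_AE_pos[of al "\<lambda>k. - x k" s t K "k-1"] k y sg by simp
  then have "s (k-1) = s (k-4) + (\<bar>x (k-3)\<bar> + \<bar>x (k-5)\<bar>) / 2"
    using s_eq[of "k-1"] k by simp
  moreover have "s (k-3) + (\<bar>x (k - 2)\<bar> + \<bar>x (k - 4)\<bar>) / 2 \<le> s k" using s_ge3[of k] k by simp
  ultimately show ?thesis using T y sg IH abs_of_neg[OF y(1)] abs_of_neg[OF y(2)] abs_of_neg[OF y(3)] abs_of_pos[OF sg(1)] abs_of_pos[OF sg(2)] abs_of_neg[OF sg(3)] by argo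
qed

text \<open>If \<open>x (k - 4)\<close> is negative, level \<open>k - 3\<close> has the pattern
  \<open>BD\<close>, and its gap bound starts the induction. If it is positive, the alternating
  pattern itself recurs there, as in \<open>AE_gap_step\<close>.\<close>

lemma AE_gap_base:
  assumes k: "K + 40 \<le> k" and y: "x (k - 1) > 0" "x (k - 2) < 0" "x (k - 3) > 0" "x (k - 4) < 0"
    and IH: "s (k - 4) - s (k - 3) < \<bar>x (k - 4)\<bar> + (\<bar>x (k - 3)\<bar> - \<bar>x (k - 5)\<bar>) / 2"
  shows "s (k - 1) - s k < (\<bar>x (k - 3)\<bar> - \<bar>x (k - 1)\<bar>) / 2"
proof -
  note sg = AE_signs[OF y(1,2,3)]
  note T = trib_list[of k]
  have "ay_width al (\<lambda>k. - x k) s t K" by (rule neg_width)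
  then have "s (k-3) < s (k-4) + (\<bar>- x (k-3)\<bar> + \<bar>- x (k-5)\<bar>) / 2"
    using ay_width.three_step_AE_pos[of al "\<lambda>k. - x k" s t K "k-1"] k y by simp
  then have "s (k-1) = s (k-4) + (\<bar>x (k-3)\<bar> + \<bar>x (k-5)\<bar>) / 2"
    using s_eq[of "k-1"] k by simp
  moreover have "s (k-3) + (\<bar>x (k - 2)\<bar> + \<bar>x (k - 4)\<bar>) / 2 \<le> s k" using s_ge3[of k] k by simp
  ultimately show ?thesis using T y sg IH abs_of_pos[OF y(1)] abs_of_neg[OF y(2)] abs_of_pos[OF y(3)] abs_of_neg[OF y(4)] abs_of_neg[OF sg(1)] by argo
qed

lemma AE_gap_step:
  assumes k: "K + 40 \<le> k" and y: "x (k - 1) > 0" "x (k - 2) < 0" "x (k - 3) > 0" "x (k - 4) > 0"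
    and IH: "s (k - 4) - s (k - 3) < (\<bar>x (k - 6)\<bar> - \<bar>x (k - 4)\<bar>) / 2"
  shows "s (k - 1) - s k < (\<bar>x (k - 3)\<bar> - \<bar>x (k - 1)\<bar>) / 2"
proof -
  note sg = AE_signs[OF y(1,2,3)]
  note T = trib_list[of k]
  have "s (k-1) = max (s (k-4) + (\<bar>x (k-3)\<bar> + \<bar>x (k-5)\<bar>) / 2) (s (k - 3))"
    using s_eq[of "k-1"] k by simp
  moreover have "s (k-3) + (\<bar>x (k - 2)\<bar> + \<bar>x (k - 4)\<bar>) / 2 \<le> s k" using s_ge3[of k] k by simp
  ultimately show ?thesis using T y sg IH abs_of_pos[OF y(1)] abs_of_neg[OF y(2)] abs_of_pos[OF y(3)] abs_of_pos[OF y(4)] abs_of_neg[OF sg(1)] abs_of_pos[OF sg(2)] by argo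
qed

text \<open>\<open>s (k - 3)\<close> unfolds to levels \<open>k - 6\<close> and
  \<open>k - 5\<close>, while \<open>s (k - 2)\<close> dominates a three-step increment of
  \<open>s (k - 5)\<close>. The only comparison left is between levels \<open>k - 5\<close> and
  \<open>k - 6\<close>, which is what \<open>gap\<close> supplies.\<close>

lemma two_step_BD_pos:
  assumes k: "K + 50 \<le> k" and y: "x (k - 1) < 0" "x (k - 2) < 0" "x (k - 5) > 0"
    and gap: "s (k - 6) - s (k - 5) < (\<bar>x (k - 8)\<bar> - \<bar>x (k - 6)\<bar>) / 2"
  shows "s (k - 3) + (\<bar>x (k - 2)\<bar> + \<bar>x (k - 4)\<bar>) / 2 < s (k - 2)"
proof -
  note sg = BD_signs[OF y(1,2)]
  note T = trib_list[of k]
  have "s (k-3) = max (s (k-6) + (\<bar>x (k-5)\<bar> + \<bar>x (k-7)\<bar>) / 2) (s (k - 5))"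
    using s_eq[of "k-3"] k by simp
  moreover have "s (k-5) + (\<bar>x (k - 4)\<bar> + \<bar>x (k - 6)\<bar>) / 2 \<le> s (k-2)" using s_ge3[of "k-2"] k by simp
  moreover have y7: "x (k-7) < 0" using AE_signs[of "k-2"] y sg by simp
  moreover have y8: "x (k-8) > 0" using AE_signs[of "k-2"] y sg by simp
  ultimately show ?thesis using T y sg gap abs_of_neg[OF y(2)] abs_of_pos[OF y(3)] abs_of_neg[OF sg(3)] abs_of_pos[OF sg(4)]
    abs_of_neg[OF y7] abs_of_pos[OF y8] by argo
qed

end

text \<open>The step is three because \<beta>^3 turns by only about 14 degrees modulo a full turn:
  along it signs persist for long runs, but change infinitely often in both directions.\<close>

locale ay_rotation = ay_width +
  assumes turn_down: "\<exists>m\<ge>k. x m > 0 \<and> x (m + 3) < 0"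
    and turn_up: "\<exists>m\<ge>k. x m < 0 \<and> x (m + 3) > 0"
begin

lemma neg_rotation: "ay_rotation al (\<lambda>k. - x k) s t K"
proof -
  interpret n: ay_width al "\<lambda>k. - x k" by (rule neg_width)
  show ?thesis using turn_down turn_up by unfold_locales auto
qed

text \<open>The pattern is the hypothesis of \<open>BD_gap_base\<close>, with \<open>N - 5\<close>
  as the last term before the sign change.\<close>

lemma turning_level: "\<exists>N\<ge>k. x (N - 1) < 0 \<and> x (N - 2) < 0 \<and> x (N - 5) > 0"
proof -
  obtain m where m: "m \<ge> k" "x m > 0" "x (m + 3) < 0" using turn_down by blast
  then have "x (m + 4) < 0" using descent_signs[of "m + 4"] by (simp add: add.commute)
  with m show ?thesis by (intro exI[of _ "m + 5"]) (simp add: add.commute)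
qed

text \<open>Each gap bound is transported from three levels below along a run of non-turning levels. The
  level \<open>N\<close>, where the bound holds outright, stops every run that starts above it before the levels are
  exhausted.\<close>

lemma BD_gap:
  assumes N: "K + 40 \<le> N" "x (N - 1) * x (N - 2) > 0" "x (N - 1) * x (N - 5) < 0"
  shows "N \<le> k \<Longrightarrow> x (k - 1) < 0 \<Longrightarrow> x (k - 2) < 0 \<Longrightarrow>
    s (k - 1) - s k < \<bar>x (k - 1)\<bar> + (\<bar>x k\<bar> - \<bar>x (k - 2)\<bar>) / 2"
proof (induction "nat (k - N)" arbitrary: k rule: less_induct)
  case less
  show ?case
  proof (cases "x (k - 5) > 0")
    case True
    then show ?thesis using BD_gap_base less N by simp
  next
    case False
    then have x5: "x (k - 5) < 0" using nonzero[of "k-5"] less N(1) by simp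
    note sg = BD_signs[OF less.prems(2,3)]
    \<comment> \<open>The descent goes by three and must not jump over \<open>N\<close>: the signs
      of the run at \<open>k\<close>, \<open>k - 1\<close> and \<open>k - 2\<close> contradict those
      at a turning level.\<close>
    have "N \<noteq> k" using N(3) x5 less.prems by (auto simp: mult_less_0_iff)
    moreover have "N \<noteq> k - 1" using N(2) sg less.prems by (auto simp: zero_less_mult_iff)
    moreover have "N \<noteq> k - 2" using N(2) sg less.prems by (auto simp: zero_less_mult_iff)
    ultimately have "N \<le> k - 3" using less.prems by simp
    then have "s (k - 4) - s (k - 3) < \<bar>x (k - 4)\<bar> + (\<bar>x (k - 3)\<bar> - \<bar>x (k - 5)\<bar>) / 2"
      using less.hyps[of "k - 3"] sg x5 by simp
    then show ?thesis using BD_gap_step[of k] less.prems x5 N(1) by simp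
  qed
qed

lemma AE_gap:
  assumes N: "K + 40 \<le> N" "x (N - 1) * x (N - 2) > 0" "x (N - 1) * x (N - 5) < 0"
    and N': "N + 6 \<le> N'" "x (N' - 1) * x (N' - 2) > 0" "x (N' - 1) * x (N' - 5) < 0"
  shows "N' - 1 \<le> k \<Longrightarrow> x (k - 1) > 0 \<Longrightarrow> x (k - 2) < 0 \<Longrightarrow> x (k - 3) > 0 \<Longrightarrow>
    s (k - 1) - s k < (\<bar>x (k - 3)\<bar> - \<bar>x (k - 1)\<bar>) / 2"
proof (induction "nat (k - N' + 1)" arbitrary: k rule: less_induct)
  case less
  note sg = AE_signs[OF less.prems(2,3,4)]
  show ?case
  proof (cases "x (k - 4) < 0")
    case True
    \<comment> \<open>The distance 6 between \<open>N\<close> and \<open>N'\<close> keeps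
      \<open>k - 3\<close> above \<open>N\<close>, so the first gap bound is available here.\<close>
    have "s (k - 4) - s (k - 3) < \<bar>x (k - 4)\<bar> + (\<bar>x (k - 3)\<bar> - \<bar>x (k - 5)\<bar>) / 2"
      using BD_gap[OF N, of "k - 3"] True sg less.prems N' by simp
    then show ?thesis using AE_gap_base[of k] True less.prems N(1) N' by simp
  next
    case False
    then have x4: "x (k - 4) > 0" using nonzero[of "k-4"] less.prems N(1) N' by simp
    have "N' \<noteq> k + 1" using N' x4 less.prems by (auto simp: zero_less_mult_iff mult_less_0_iff)
    moreover have "N' \<noteq> k" using N'(2) less.prems by (auto simp: zero_less_mult_iff)
    moreover have "N' \<noteq> k - 1" using N'(2) less.prems by (auto simp: zero_less_mult_iff)
    ultimately have "N' - 1 \<le> k - 3" using less.prems by simp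
    then have "s (k - 4) - s (k - 3) < (\<bar>x (k - 6)\<bar> - \<bar>x (k - 4)\<bar>) / 2"
      using less.hyps[of "k - 3"] sg x4 by simp
    then show ?thesis using AE_gap_step[of k] less.prems x4 N(1) N' by simp
  qed
qed

lemma eventually_choices_pos:
  "\<exists>M. \<forall>k\<ge>M.
     (x (k - 1) > 0 \<and> x (k - 2) < 0 \<and> x (k - 3) > 0
        \<longrightarrow> s (k - 2) < s (k - 3) + (\<bar>x (k - 2)\<bar> + \<bar>x (k - 4)\<bar>) / 2)
   \<and> (x (k - 1) < 0 \<and> x (k - 2) < 0 \<and> x (k - 5) < 0
        \<longrightarrow> s (k - 2) < s (k - 3) + (\<bar>x (k - 2)\<bar> + \<bar>x (k - 4)\<bar>) / 2)
   \<and> (x (k - 1) < 0 \<and> x (k - 2) < 0 \<and> x (k - 5) > 0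
        \<longrightarrow> s (k - 3) + (\<bar>x (k - 2)\<bar> + \<bar>x (k - 4)\<bar>) / 2 < s (k - 2))
   \<and> (x (k - 1) < 0 \<and> x (k - 2) < 0
        \<longrightarrow> s (k - 1) - s k < \<bar>x (k - 1)\<bar> + (\<bar>x k\<bar> - \<bar>x (k - 2)\<bar>) / 2)"
proof -
  obtain N where N: "K + 40 \<le> N" "x (N - 1) * x (N - 2) > 0" "x (N - 1) * x (N - 5) < 0"
    using turning_level[of "K + 40"] by (auto simp: zero_less_mult_iff mult_less_0_iff)
  obtain N' where N': "N + 6 \<le> N'" "x (N' - 1) * x (N' - 2) > 0" "x (N' - 1) * x (N' - 5) < 0"
    using turning_level[of "N + 6"] by (auto simp: zero_less_mult_iff mult_less_0_iff)
  have two: "s (k - 3) + (\<bar>x (k - 2)\<bar> + \<bar>x (k - 4)\<bar>) / 2 < s (k - 2)"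
    if k: "N' + 10 \<le> k" and y: "x (k - 1) < 0" "x (k - 2) < 0" "x (k - 5) > 0" for k
  proof -
    note sg = BD_signs[OF y(1,2)]
    have "x (k - 7) < 0" "x (k - 8) > 0" using AE_signs[of "k - 2"] y sg by simp_all
    then have "s (k - 6) - s (k - 5) < (\<bar>x (k - 8)\<bar> - \<bar>x (k - 6)\<bar>) / 2"
      using AE_gap[OF N N', of "k - 5"] k sg by simp
    then show ?thesis using two_step_BD_pos[of k] k y N N' by simp
  qed
  show ?thesis
    using three_step_AE_pos three_step_BD_pos two BD_gap[OF N] N(1) N'(1)
    by (intro exI[of _ "N' + 10"]) auto
qed

text \<open>Conditions on products of terms merge each statement with its mirror image under z
  \<mapsto> -z.\<close>

lemma eventually_choices:
  obtains M where
    "\<And>k. M \<le> k \<Longrightarrow> x (k - 1) * x (k - 2) < 0 \<Longrightarrow> x (k - 2) * x (k - 3) < 0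
        \<Longrightarrow> s (k - 2) < s (k - 3) + (\<bar>x (k - 2)\<bar> + \<bar>x (k - 4)\<bar>) / 2"
    "\<And>k. M \<le> k \<Longrightarrow> x (k - 1) * x (k - 2) > 0 \<Longrightarrow> x (k - 1) * x (k - 5) > 0
        \<Longrightarrow> s (k - 2) < s (k - 3) + (\<bar>x (k - 2)\<bar> + \<bar>x (k - 4)\<bar>) / 2"
    "\<And>k. M \<le> k \<Longrightarrow> x (k - 1) * x (k - 2) > 0 \<Longrightarrow> x (k - 1) * x (k - 5) < 0
        \<Longrightarrow> s (k - 3) + (\<bar>x (k - 2)\<bar> + \<bar>x (k - 4)\<bar>) / 2 < s (k - 2)"
    "\<And>k. M \<le> k \<Longrightarrow> x (k - 1) * x (k - 2) > 0
        \<Longrightarrow> s (k - 1) - s k < \<bar>x (k - 1)\<bar> + (\<bar>x k\<bar> - \<bar>x (k - 2)\<bar>) / 2"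
proof -
  obtain M1 where M1: "\<forall>k\<ge>M1.
     (x (k - 1) > 0 \<and> x (k - 2) < 0 \<and> x (k - 3) > 0
        \<longrightarrow> s (k - 2) < s (k - 3) + (\<bar>x (k - 2)\<bar> + \<bar>x (k - 4)\<bar>) / 2)
   \<and> (x (k - 1) < 0 \<and> x (k - 2) < 0 \<and> x (k - 5) < 0
        \<longrightarrow> s (k - 2) < s (k - 3) + (\<bar>x (k - 2)\<bar> + \<bar>x (k - 4)\<bar>) / 2)
   \<and> (x (k - 1) < 0 \<and> x (k - 2) < 0 \<and> x (k - 5) > 0
        \<longrightarrow> s (k - 3) + (\<bar>x (k - 2)\<bar> + \<bar>x (k - 4)\<bar>) / 2 < s (k - 2))
   \<and> (x (k - 1) < 0 \<and> x (k - 2) < 0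
        \<longrightarrow> s (k - 1) - s k < \<bar>x (k - 1)\<bar> + (\<bar>x k\<bar> - \<bar>x (k - 2)\<bar>) / 2)"
    using eventually_choices_pos by blast
  obtain M2 where M2: "\<forall>k\<ge>M2.
     (x (k - 1) < 0 \<and> x (k - 2) > 0 \<and> x (k - 3) < 0
        \<longrightarrow> s (k - 2) < s (k - 3) + (\<bar>x (k - 2)\<bar> + \<bar>x (k - 4)\<bar>) / 2)
   \<and> (x (k - 1) > 0 \<and> x (k - 2) > 0 \<and> x (k - 5) > 0
        \<longrightarrow> s (k - 2) < s (k - 3) + (\<bar>x (k - 2)\<bar> + \<bar>x (k - 4)\<bar>) / 2)
   \<and> (x (k - 1) > 0 \<and> x (k - 2) > 0 \<and> x (k - 5) < 0
        \<longrightarrow> s (k - 3) + (\<bar>x (k - 2)\<bar> + \<bar>x (k - 4)\<bar>) / 2 < s (k - 2))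
   \<and> (x (k - 1) > 0 \<and> x (k - 2) > 0
        \<longrightarrow> s (k - 1) - s k < \<bar>x (k - 1)\<bar> + (\<bar>x k\<bar> - \<bar>x (k - 2)\<bar>) / 2)"
    using ay_rotation.eventually_choices_pos[OF neg_rotation]
    by (simp only: neg_less_0_iff_less neg_0_less_iff_less abs_minus_cancel) blast
  show thesis
    by (rule that[of "max M1 M2"]; use M1 M2 in \<open>auto simp: zero_less_mult_iff mult_less_0_iff\<close>)
qed

end

section \<open>Minima over the letter classes\<close>

text \<open>The sequences \<open>a, b, d, e, g, h\<close> stand for the minima of the walks of the letters \<open>1\<close>, \<open>2, 3\<close>, \<open>4\<close>,
  \<open>5, 6\<close>, \<open>7\<close> and \<open>8, 9\<close>.\<close>

locale ay_min = ay_signs +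
  fixes a b d e g h :: "int \<Rightarrow> real" and K :: int
  assumes K: "0 \<le> K"
    and nz: "K \<le> k \<Longrightarrow> x k \<noteq> 0"
    and a_rec: "1 \<le> k \<Longrightarrow> a k = min (b (k - 1)) (e (k - 1) - x k)"
    and b_rec: "1 \<le> k \<Longrightarrow> b k = min (d (k - 1)) (e (k - 1) - x (k - 2))"
    and d_rec: "1 \<le> k \<Longrightarrow> d k = min (a (k - 1)) (g (k - 1) + x (k - 2))"
    and e_rec: "1 \<le> k \<Longrightarrow> e k = min (a (k - 1)) (h (k - 1) + x (k - 2))"
    and g_rec: "1 \<le> k \<Longrightarrow> g k = min (b (k - 1)) (h (k - 1) - x k)"
    and h_rec: "1 \<le> k \<Longrightarrow> h k = b (k - 1)"
    and down: "\<exists>m\<ge>k. x m > 0 \<and> x (m + 3) < 0"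
    and up: "\<exists>m\<ge>k. x m < 0 \<and> x (m + 3) > 0"
begin

text \<open>The pieces behind \<open>e\<close> and \<open>b\<close> are invariant under \<open>w \<mapsto> \<beta> + 1 - w\<close> and \<open>w \<mapsto> - \<beta> - w\<close>;
  measured from these centres, only absolute values of \<open>x\<close> survive in the recursions.\<close>

definition s where "s k = (x (k + 1) + x k) / 2 - e k"
definition t where "t k = - x (k + 1) / 2 - b k"

text \<open>Eliminating the other letters leaves a closed system for \<open>e\<close> and
  \<open>b\<close>. By \<open>d_eq\<close>, letter 4 offers the same options as 5 and 6, plus the
  one through the second letter of the block of 7; that option becomes the central part behind
  \<open>t\<close>.\<close>

lemma e_eq: "3 \<le> k \<Longrightarrow> e k = min (b (k - 2) + min 0 (x (k - 2))) (e (k - 2) - x (k - 1))"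
  using e_rec[of k] a_rec[of "k - 1"] h_rec[of "k - 1"] by simp

lemma d_eq: "4 \<le> k \<Longrightarrow> d k = min (e k) (b (k - 3) + x (k - 2) - x (k - 1))"
  using d_rec[of k] e_rec[of k] g_rec[of "k - 1"] h_rec[of "k - 1"] h_rec[of "k - 2"] by simp

lemma b_eq: "5 \<le> k \<Longrightarrow> b k = min (e (k - 1) - max 0 (x (k - 2))) (b (k - 4) + x (k - 3) - x (k - 2))"
  using b_rec[of k] d_eq[of "k - 1"] by simp

sublocale w: ay_rotation al x s t "K + 10"
proof
  fix k assume k: "K + 10 \<le> k"
  show "x k \<noteq> 0" using nz k by simp
  \<comment> \<open>The identity aligns the centres of the pieces at different levels. What remains
    of \<open>min 0 y\<close> or \<open>max 0 y\<close> is half of the absolute value.\<close>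
  have T: "x (k - 2) = x (k - 1) + x k + x (k + 1)" using trib[of "k + 1"] by simp
  show "s k = max (t (k - 2) + \<bar>x (k - 2)\<bar> / 2) (s (k - 2))"
    using e_eq[of k] K k T unfolding s_def t_def by simp argo
  show "t k = max (s (k - 1) + \<bar>x (k - 2)\<bar> / 2) (t (k - 4))"
    using b_eq[of k] K k T trib[of k] unfolding s_def t_def by simp argo
next
  fix k show "\<exists>m\<ge>k. x m > 0 \<and> x (m + 3) < 0" "\<exists>m\<ge>k. x m < 0 \<and> x (m + 3) > 0"
    using down up by blast+
qed

lemma b_reduced: "K + 40 \<le> k \<Longrightarrow> b k = e (k - 1) - max 0 (x (k - 2))"
  using w.t_rec[of k] w.shorter_middle[of k] trib[of "k + 1"] s_def[of "k - 1"] t_def[of k] K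
  by simp argo

text \<open>The sign of \<open>x (k - 2)\<close> alone decides the block of 2 or 3, since
  \<open>d\<close> differs from \<open>e\<close> only by one further option. For negative sign
  \<open>d \<le> e\<close> is enough; for positive sign \<open>shorter_middle\<close> rules that
  option out.\<close>

lemma b_choice:
  assumes "K + 40 \<le> k"
  shows "x (k - 2) < 0 \<Longrightarrow> d (k - 1) < e (k - 1) - x (k - 2)"
    "x (k - 2) > 0 \<Longrightarrow> e (k - 1) - x (k - 2) < d (k - 1)"
proof -
  have d: "d (k - 1) = min (e (k - 1)) (b (k - 4) + x (k - 3) - x (k - 2))"
    using d_eq[of "k-1"] assms K by simp
  show "x (k - 2) < 0 \<Longrightarrow> d (k - 1) < e (k - 1) - x (k - 2)" using d by simp
  have m: "t (k - 4) < s (k - 1) + \<bar>x (k - 2)\<bar> / 2" using w.shorter_middle[of k] assms by simp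
  have "t (k - 4) = - x (k - 3) / 2 - b (k - 4)" using t_def[of "k-4"] by simp
  moreover have "s (k - 1) = (x k + x (k - 1)) / 2 - e (k - 1)" using s_def[of "k-1"] by simp
  ultimately show "x (k - 2) > 0 \<Longrightarrow> e (k - 1) - x (k - 2) < d (k - 1)"
    using m d trib[of k] abs_of_pos[of "x (k-2)"] by argo
qed

lemma e_choice: "5 \<le> k \<Longrightarrow> x (k - 2) > 0 \<Longrightarrow> a (k - 1) < h (k - 1) + x (k - 2)"
  using a_rec[of "k-1"] h_rec[of "k-1"] by simp

text \<open>These are the comparisons behind the table of choices, still in terms of signs.
  Strictness is essential: it forces every minimising label to be the one named.\<close>

lemma eventual_choices:
  obtains M where "K + 60 \<le> M"
    and "\<And>k. M \<le> k \<Longrightarrow> x (k-1) > 0 \<Longrightarrow> x (k-2) < 0 \<Longrightarrow> x (k-3) < 0 \<Longrightarrow> b (k-1) < e (k-1) - x k"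
    and "\<And>k. M \<le> k \<Longrightarrow> x (k-1) > 0 \<Longrightarrow> x (k-2) < 0 \<Longrightarrow> x (k-3) > 0 \<Longrightarrow> x (k-4) > 0 \<Longrightarrow> b (k-1) < e (k-1) - x k"
    and "\<And>k. M \<le> k \<Longrightarrow> x (k-1) > 0 \<Longrightarrow> x (k-2) < 0 \<Longrightarrow> x (k-3) > 0 \<Longrightarrow> x (k-4) < 0 \<Longrightarrow> e (k-1) - x k < b (k-1)"
    and "\<And>k. M \<le> k \<Longrightarrow> x (k-1) > 0 \<Longrightarrow> x (k-2) < 0 \<Longrightarrow> x (k-3) > 0 \<Longrightarrow> h (k-1) + x (k-2) < a (k-1)"
    and "\<And>k. M \<le> k \<Longrightarrow> x k < 0 \<Longrightarrow> x (k-1) < 0 \<Longrightarrow> x (k-4) > 0 \<Longrightarrow> e (k-1) - x k < b (k-1)"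
    and "\<And>k. M \<le> k \<Longrightarrow> x k < 0 \<Longrightarrow> x (k-1) < 0 \<Longrightarrow> a (k-1) < g (k-1) + x (k-2)"
    and "\<And>k. M \<le> k \<Longrightarrow> x k < 0 \<Longrightarrow> x (k-1) < 0 \<Longrightarrow> x (k-4) < 0 \<Longrightarrow> b (k-1) < h (k-1) - x k"
    and "\<And>k. M \<le> k \<Longrightarrow> x (k-1) < 0 \<Longrightarrow> x (k-2) < 0 \<Longrightarrow> x (k-5) > 0 \<Longrightarrow> a (k-1) < g (k-1) + x (k-2)"
    and "\<And>k. M \<le> k \<Longrightarrow> x (k-1) < 0 \<Longrightarrow> x (k-2) < 0 \<Longrightarrow> x (k-5) < 0 \<Longrightarrow> g (k-1) + x (k-2) < a (k-1)"
proof -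
  obtain M where three: "\<And>k. M \<le> k \<Longrightarrow> x (k - 1) * x (k - 2) < 0 \<Longrightarrow> x (k - 2) * x (k - 3) < 0
        \<Longrightarrow> s (k - 2) < s (k - 3) + (\<bar>x (k - 2)\<bar> + \<bar>x (k - 4)\<bar>) / 2"
    and three': "\<And>k. M \<le> k \<Longrightarrow> x (k - 1) * x (k - 2) > 0 \<Longrightarrow> x (k - 1) * x (k - 5) > 0
        \<Longrightarrow> s (k - 2) < s (k - 3) + (\<bar>x (k - 2)\<bar> + \<bar>x (k - 4)\<bar>) / 2"
    and two: "\<And>k. M \<le> k \<Longrightarrow> x (k - 1) * x (k - 2) > 0 \<Longrightarrow> x (k - 1) * x (k - 5) < 0
        \<Longrightarrow> s (k - 3) + (\<bar>x (k - 2)\<bar> + \<bar>x (k - 4)\<bar>) / 2 < s (k - 2)"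
    and gap: "\<And>k. M \<le> k \<Longrightarrow> x (k - 1) * x (k - 2) > 0
        \<Longrightarrow> s (k - 1) - s k < \<bar>x (k - 1)\<bar> + (\<bar>x k\<bar> - \<bar>x (k - 2)\<bar>) / 2"
    by (rule w.eventually_choices) blast
  have S: "s (k-1) = (x k + x (k-1)) / 2 - e (k-1)" "s (k-2) = (x (k-1) + x (k-2)) / 2 - e (k-2)"
    "s (k-3) = (x (k-2) + x (k-3)) / 2 - e (k-3)" "s (k-4) = (x (k-3) + x (k-4)) / 2 - e (k-4)" for k
    using s_def[of "k-1"] s_def[of "k-2"] s_def[of "k-3"] s_def[of "k-4"] by simp_all
  define M' where "M' = max (M + 10) (K + 60)"
  have B: "b (k-1) = e (k-2) - max 0 (x (k-3))" "b (k-2) = e (k-3) - max 0 (x (k-4))"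
    "b (k-3) = e (k-4) - max 0 (x (k-5))" if "M' \<le> k" for k
    using b_reduced[of "k-1"] b_reduced[of "k-2"] b_reduced[of "k-3"] that unfolding M'_def by simp_all
  have A: "a (k-1) = min (b (k-2)) (e (k-2) - x (k-1))" "g (k-1) = min (b (k-2)) (b (k-3) - x (k-1))"
    "h (k-1) = b (k-2)" if "M' \<le> k" for k
    using a_rec[of "k-1"] g_rec[of "k-1"] h_rec[of "k-1"] h_rec[of "k-2"] K that unfolding M'_def by simp_all
  have E: "e (k-2) \<le> e (k-4) - x (k-3)" if "M' \<le> k" for k
    using e_eq[of "k-2"] K that unfolding M'_def by simp
  have MM: "M \<le> k + 1" "M \<le> k" "M \<le> k - 2" "M \<le> k - 3" if "M' \<le> k" for k
    using that unfolding M'_def by simp_all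
  note T = trib_list
  \<comment> \<open>Letter 1 starts the blocks of 5 and 6. Its comparison at level \<open>k\<close>
    is therefore the maximum in the recursion for \<open>s\<close> at level \<open>k + 1\<close>;
    \<open>up\<close> is the opposite case.\<close>
  have down: "b (k-1) < e (k-1) - x k" if k: "M' \<le> k" and y: "x (k-1) > 0"
    and "s (k-1) < s (k-2) + (\<bar>x (k-1)\<bar> + \<bar>x (k-3)\<bar>) / 2" for k
    using that B(1)[OF k] S[of k] T(1)[of k] by argo
  have up: "e (k-1) - x k < b (k-1)" if k: "M' \<le> k"
    and "s (k-2) + (\<bar>x (k-1)\<bar> + \<bar>x (k-3)\<bar>) / 2 < s (k-1)" for k
    using that B(1)[OF k] S[of k] T(1)[of k] by argo
  show thesis
  proof (rule that)
    show "K + 60 \<le> M'" unfolding M'_def by simp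
  next
    fix k assume k: "M' \<le> k" and y: "x (k-1) > 0" "x (k-2) < 0" "x (k-3) < 0"
    then show "b (k-1) < e (k-1) - x k"
      using down[of k] three[of "k+1"] MM[of k] AB_signs[of k] by (simp add: mult_less_0_iff)
  next
    fix k assume k: "M' \<le> k" and y: "x (k-1) > 0" "x (k-2) < 0" "x (k-3) > 0" "x (k-4) > 0"
    have "x k \<noteq> 0" using nz[of k] k unfolding M'_def by simp
    then have "x k < 0 \<or> x k > 0" by linarith
    then show "b (k-1) < e (k-1) - x k"
      using down[of k] three[of "k+1"] three'[of "k+1"] MM[of k] k y
      by (auto simp: mult_less_0_iff zero_less_mult_iff)
  next
    fix k assume k: "M' \<le> k" and y: "x (k-1) > 0" "x (k-2) < 0" "x (k-3) > 0" "x (k-4) < 0"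
    then show "e (k-1) - x k < b (k-1)"
      using up[of k] two[of "k+1"] MM[of k] AE_signs(4)[of k] by (simp add: mult_less_0_iff zero_less_mult_iff)
  next
    fix k assume k: "M' \<le> k" and y: "x (k-1) > 0" "x (k-2) < 0" "x (k-3) > 0"
    have "s (k - 2) < s (k - 3) + (\<bar>x (k - 2)\<bar> + \<bar>x (k - 4)\<bar>) / 2"
      using three[of k] MM[OF k] y by (simp add: mult_less_0_iff)
    then show "h (k-1) + x (k-2) < a (k-1)"
      using A[OF k] B[OF k] S[of k] T[of k] y by argo
  next
    fix k assume k: "M' \<le> k" and y: "x k < 0" "x (k-1) < 0" "x (k-4) > 0"
    then show "e (k-1) - x k < b (k-1)"
      using up[of k] two[of "k+1"] MM[of k] by (simp add: mult_less_0_iff zero_less_mult_iff)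
  next
    fix k assume k: "M' \<le> k" and y: "x k < 0" "x (k-1) < 0"
    note sg = AD_signs[OF y]
    have "x (k-4) \<noteq> 0" using nz[of "k-4"] k unfolding M'_def by simp
    \<comment> \<open>For \<open>x (k - 4) < 0\<close> the monotonicity \<open>E\<close> suffices.
      Otherwise level \<open>k - 3\<close> has two consecutive positive terms, and the mirrored gap
      bound applies.\<close>
    then consider "x (k-4) < 0" | "x (k-4) > 0" by linarith
    then show "a (k-1) < g (k-1) + x (k-2)"
    proof cases
      case 1
      then show ?thesis using A[OF k] B[OF k] E[OF k] T[of k] y sg by argo
    next
      case 2
      have "s (k - 4) - s (k - 3) < \<bar>x (k - 4)\<bar> + (\<bar>x (k-3)\<bar> - \<bar>x (k - 5)\<bar>) / 2"
        using gap[of "k-3"] MM[OF k] sg 2 by (simp add: zero_less_mult_iff)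
      then show ?thesis using A[OF k] B[OF k] S[of k] T[of k] y sg 2 by argo
    qed
  next
    fix k assume k: "M' \<le> k" and y: "x k < 0" "x (k-1) < 0" "x (k-4) < 0"
    note sg = AD_signs[OF y(1,2)]
    have "s (k - 3) - s (k - 2) < \<bar>x (k - 3)\<bar> + (\<bar>x (k-2)\<bar> - \<bar>x (k - 4)\<bar>) / 2"
      using gap[of "k-2"] MM[OF k] sg y by (simp add: zero_less_mult_iff)
    then show "b (k-1) < h (k-1) - x k" using A[OF k] B[OF k] S[of k] T[of k] y sg by argo
  next
    fix k assume k: "M' \<le> k" and y: "x (k-1) < 0" "x (k-2) < 0" "x (k-5) > 0"
    note sg = BD_signs[OF y(1,2)]
    have "s (k - 3) + (\<bar>x (k - 2)\<bar> + \<bar>x (k - 4)\<bar>) / 2 < s (k - 2)"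
      using two[of k] MM[OF k] y by (simp add: mult_less_0_iff zero_less_mult_iff)
    then show "a (k-1) < g (k-1) + x (k-2)"
      using A[OF k] B[OF k] E[OF k] S[of k] T[of k] y sg by argo
  next
    fix k assume k: "M' \<le> k" and y: "x (k-1) < 0" "x (k-2) < 0" "x (k-5) < 0"
    note sg = BD_signs[OF y(1,2)]
    have "s (k - 2) < s (k - 3) + (\<bar>x (k - 2)\<bar> + \<bar>x (k - 4)\<bar>) / 2"
      using three'[of k] MM[OF k] y by (simp add: zero_less_mult_iff)
    then show "g (k-1) + x (k-2) < a (k-1)"
      using A[OF k] B[OF k] S[of k] T[of k] y sg by argo
  qed
qed

end

section \<open>Sectors and threads\<close>

text \<open>A sector is named after the classes of its two threads, with \<open>A = 1\<close>, \<open>B = 2, 3\<close>, \<open>D = 4\<close>,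
  \<open>E = 5, 6\<close>, \<open>G = 7\<close>, \<open>H = 8, 9\<close> (\<open>EA\<close> because \<open>AE\<close> is a keyword of the measure theory syntax).\<close>

datatype sector = AB | BD | AD | DG | EA | EH | BH | BE

fun sector_step :: "sector \<Rightarrow> sector set" where
  "sector_step AB = {BD}"
| "sector_step BD = {AD, DG}"
| "sector_step AD = {EA}"
| "sector_step DG = {AB}"
| "sector_step EA = {EH, BH}"
| "sector_step EH = {AB}"
| "sector_step BH = {BE}"
| "sector_step BE = {EA}"

text \<open>Only the choices needed below are pinned down; for the remaining pairs of a sector and a letter
  every letter of the block is admitted.\<close>

fun choices :: "sector \<Rightarrow> sector \<Rightarrow> letter \<Rightarrow> letter set" where
  "choices S S' L1 = (case S of AB \<Rightarrow> {L3} | AD \<Rightarrow> {L5} | EA \<Rightarrow> (if S' = BH then {L3} else {L5}) | _ \<Rightarrow> {L3, L5})"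
| "choices S S' L2 = (if S \<in> {AB, BD, EA} then {L4} else {L5})"
| "choices S S' L3 = (if S \<in> {AB, BD, EA} then {L4} else {L6})"
| "choices S S' L4 = (case S of BD \<Rightarrow> (if S' = AD then {L1} else {L7}) | AD \<Rightarrow> {L1} | DG \<Rightarrow> {L1} | _ \<Rightarrow> {L1, L7})"
| "choices S S' L5 = (case S of EA \<Rightarrow> {L8} | EH \<Rightarrow> {L1} | BE \<Rightarrow> {L1} | _ \<Rightarrow> {L1, L8})"
| "choices S S' L6 = (case S of EA \<Rightarrow> {L9} | EH \<Rightarrow> {L1} | BE \<Rightarrow> {L1} | _ \<Rightarrow> {L1, L9})"
| "choices S S' L7 = (case S of DG \<Rightarrow> {L2} | _ \<Rightarrow> {L2, L9})"
| "choices S S' L8 = {L2}"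
| "choices S S' L9 = {L3}"

fun thread1 :: "sector \<Rightarrow> letter" where
  "thread1 AB = L1" | "thread1 BD = L3" | "thread1 AD = L4" | "thread1 DG = L4"
| "thread1 EA = L1" | "thread1 EH = L5" | "thread1 BH = L3" | "thread1 BE = L6"

fun thread2 :: "sector \<Rightarrow> letter" where
  "thread2 AB = L2" | "thread2 BD = L4" | "thread2 AD = L1" | "thread2 DG = L7"
| "thread2 EA = L5" | "thread2 EH = L8" | "thread2 BH = L8" | "thread2 BE = L2"

lemma thread_distinct: "thread1 S \<noteq> thread2 S"
  by (cases S) auto

lemma thread_step:
  assumes "S' \<in> sector_step S"
  shows "choices S S' (thread1 S) = {thread1 S'}" "choices S S' (thread2 S) = {thread2 S'}"
  using assms by (cases S; auto)+

text \<open>Letters an arbitrary optimal chain can reach below sector \<open>EH\<close>, respectively after the next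
  occurrence of \<open>AD\<close>; the following \<open>EH\<close> leaves only the two threads.\<close>

fun phase1 :: "sector \<Rightarrow> letter set" where
  "phase1 AB = {L1, L2, L3, L5, L6, L7, L8, L9}" | "phase1 BD = {L1, L2, L3, L4, L8, L9}"
| "phase1 DG = {L2, L3, L4, L5, L7}" | "phase1 AD = {L1, L2, L3, L4, L5}" | "phase1 _ = {}"

fun phase2 :: "sector \<Rightarrow> letter set" where
  "phase2 EA = {L1, L5, L6}" | "phase2 BH = {L3, L8, L9}" | "phase2 BE = {L2, L3, L6}"
| "phase2 EH = {L5, L8, L9}" | "phase2 _ = {}"

lemma phase1_step:
  assumes "S' \<in> sector_step S" "S \<noteq> AD" "c \<in> phase1 S" "c' \<in> choices S S' c"
  shows "c' \<in> phase1 S'"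
  using assms by (cases S; cases c; cases c'; auto split: if_splits)

lemma phase2_step:
  assumes "S' \<in> sector_step S" "S \<noteq> EH" "c \<in> phase2 S" "c' \<in> choices S S' c"
  shows "c' \<in> phase2 S'"
  using assms by (cases S; cases c; cases c'; auto split: if_splits)

lemma phase1_start: "c' \<in> choices EH AB c \<Longrightarrow> c' \<in> phase1 AB"
  by (cases c; cases c'; auto)

text \<open>Four levels are taken together because letter 8 can survive the first arrival in
  \<open>EA\<close>; it is excluded only at the second arrival, after \<open>BH\<close> and
  \<open>BE\<close>.\<close>

lemma phase1_to_phase2:
  assumes "c0 \<in> phase1 AD" "c1 \<in> choices AD EA c0" "c2 \<in> choices EA BH c1" "c3 \<in> choices BH BE c2"
    "c4 \<in> choices BE EA c3"
  shows "c4 \<in> phase2 EA"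
  using assms by (cases c0; cases c1; simp; cases c2; simp; cases c3; simp; cases c4; simp)

text \<open>Below \<open>EH\<close>, letters 8 and 9 lead to 2 and 3, which merge into 4 in
  \<open>BD\<close>; letter 5 leads through 1 to 3.\<close>

lemma phase2_to_threads:
  assumes "c0 \<in> phase2 EH" "c1 \<in> choices EH AB c0" "c2 \<in> choices AB BD c1"
  shows "c2 \<in> {thread1 BD, thread2 BD}"
  using assms by (cases c0; cases c1; simp; cases c2; simp)

lemma descend_until:
  fixes m :: nat
  assumes "Q m" "X n" "n \<le> m" and step: "\<And>j. n \<le> j \<Longrightarrow> Q (Suc j) \<Longrightarrow> \<not> X (Suc j) \<Longrightarrow> Q j"
  shows "\<exists>i. n \<le> i \<and> i \<le> m \<and> X i \<and> Q i"
  using assms(3,1)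
proof (induction rule: dec_induct)
  case base
  then show ?case using \<open>X n\<close> by auto
next
  case (step j)
  then show ?case using assms(4)[of j] by (cases "X (Suc j)") (auto intro: le_SucI)
qed

text \<open>A chain descends from level \<open>Suc n\<close> to level \<open>n\<close> and has no
  top, so every level has occurrences of \<open>AD\<close> and \<open>EH\<close> above it.\<close>

locale sector_chain =
  fixes S :: "nat \<Rightarrow> sector" and M :: nat
  assumes S_step: "M \<le> n \<Longrightarrow> S n \<in> sector_step (S (Suc n))"
    and S_AD: "M \<le> n \<Longrightarrow> S (n + 2) = AD \<Longrightarrow> S n = BH"
    and AD_often: "\<exists>n\<ge>k. S n = AD"
    and EH_often: "\<exists>n\<ge>k. S n = EH"
begin

lemma thread_persists:
  assumes c: "\<And>n. M \<le> n \<Longrightarrow> c n \<in> choices (S (Suc n)) (S n) (c (Suc n))"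
    and n: "M \<le> n" "n \<le> m"
  shows "c m = thread1 (S m) \<Longrightarrow> c n = thread1 (S n)" "c m = thread2 (S m) \<Longrightarrow> c n = thread2 (S n)"
proof -
  show "c n = thread1 (S n)" if "c m = thread1 (S m)"
    using n(2) that
  proof (induction rule: dec_induct)
    case base then show ?case .
  next
    case (step j)
    then show ?case using c[of j] thread_step(1)[OF S_step[of j]] n(1) by simp
  qed
  show "c n = thread2 (S n)" if "c m = thread2 (S m)"
    using n(2) that
  proof (induction rule: dec_induct)
    case base then show ?case .
  next
    case (step j)
    then show ?case using c[of j] thread_step(2)[OF S_step[of j]] n(1) by simp
  qed
qed

text \<open>Whatever letter is taken far above, one passage from \<open>EH\<close> through
  \<open>AD\<close> to another \<open>EH\<close> filters it down to a thread. Infinitely many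
  occurrences leave room for such a passage above any level.\<close>

lemma chain_in_threads:
  assumes c: "\<And>n. M \<le> n \<Longrightarrow> c n \<in> choices (S (Suc n)) (S n) (c (Suc n))"
    and n: "M \<le> n"
  shows "c n \<in> {thread1 (S n), thread2 (S n)}"
proof -
  obtain m3 where m3: "m3 \<ge> n + 2" "S m3 = EH" using EH_often by blast
  \<comment> \<open>The four extra levels hold the forced passage \<open>EA\<close>,
    \<open>BH\<close>, \<open>BE\<close>, \<open>EA\<close> before \<open>m3\<close> is
    reached.\<close>
  obtain m2 where m2: "m2 \<ge> m3 + 4" "S m2 = AD" using AD_often by blast
  obtain m1 where m1: "m1 \<ge> m2 + 1" "S m1 = EH" using EH_often by blast
  obtain m where m: "m1 = Suc m" using m1 by (cases m1) auto
  have "S m = AB" using S_step[of m] m m1 m2 m3 n by simp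
  then have "c m \<in> phase1 (S m)" using phase1_start c[of m] m m1 m2 m3 n by simp
  then obtain i where i: "m2 \<le> i" "S i = AD" "c i \<in> phase1 (S i)"
    using descend_until[of "\<lambda>j. c j \<in> phase1 (S j)" m "\<lambda>j. S j = AD" m2]
      phase1_step[OF S_step _ _ c] m m1 m2 m3 n by auto
  define l where "l = i - 4"
  have l: "i = Suc (Suc (Suc (Suc l)))" "m3 \<le> l" using i m2 unfolding l_def by simp_all
  have s1: "S (Suc (Suc (Suc l))) = EA" using S_step[of "Suc (Suc (Suc l))"] i l m3 n by simp
  have s2: "S (Suc (Suc l)) = BH" using S_AD[of "Suc (Suc l)"] i l m3 n by simp
  have s3: "S (Suc l) = BE" using S_step[of "Suc l"] s2 l m3 n by simp
  have s4: "S l = EA" using S_step[of l] s3 l m3 n by simp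
  have "c l \<in> phase2 (S l)"
    using phase1_to_phase2[of "c i" "c (Suc (Suc (Suc l)))" "c (Suc (Suc l))" "c (Suc l)" "c l"]
      c[of "Suc (Suc (Suc l))"] c[of "Suc (Suc l)"] c[of "Suc l"] c[of l] s1 s2 s3 s4 i l m3 n by simp
  then obtain i' where i': "m3 \<le> i'" "S i' = EH" "c i' \<in> phase2 (S i')"
    using descend_until[of "\<lambda>j. c j \<in> phase2 (S j)" l "\<lambda>j. S j = EH" m3]
      phase2_step[OF S_step _ _ c] l m3 n by auto
  define r where "r = i' - 2"
  have r: "i' = Suc (Suc r)" "n \<le> r" using i' m3 unfolding r_def by simp_all
  have r1: "S (Suc r) = AB" using S_step[of "Suc r"] r i' n by simp
  have r2: "S r = BD" using S_step[of r] r r1 n by simp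
  have "c r \<in> {thread1 (S r), thread2 (S r)}"
    using phase2_to_threads[of "c i'" "c (Suc r)" "c r"] c[of "Suc r"] c[of r] r r1 r2 i' n by simp
  then show ?thesis using thread_persists[where m = r, OF c n r(2)] by auto
qed

end

section \<open>The sectors visited by the real tribonacci sequence\<close>

context ay_min
begin

text \<open>Each test places z \<beta>^k in a half-plane bounded by a line through 0, so every
  branch describes an angular sector. Zero counts as nonnegative; from level \<open>K\<close> on it
  does not occur.\<close>

definition sector_at :: "int \<Rightarrow> sector" where
  "sector_at k =
    (if x (k - 1) < 0
     then (if x (k - 2) < 0 then BD
           else if x k < 0 then (if x (k - 4) < 0 then DG else AD)
           else (if x (k - 3) < 0 then EH else BH))
     else (if x (k - 2) < 0 then (if x (k - 3) < 0 then AB else EA) else BE))"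

lemma sector_at_step:
  assumes k: "K + 10 \<le> k"
  shows "sector_at (k - 1) \<in> sector_step (sector_at k)"
    and "sector_at k = AD \<Longrightarrow> sector_at (k - 2) = BH"
proof -
  have n: "x k \<noteq> 0" "x (k-1) \<noteq> 0" "x (k-2) \<noteq> 0" "x (k-3) \<noteq> 0" "x (k-4) \<noteq> 0" "x (k-5) \<noteq> 0"
    using nz k by simp_all
  note T = trib_list[of k]
  show "sector_at (k - 1) \<in> sector_step (sector_at k)"
  proof (cases "x (k-1) < 0")
    case y1: True
    show ?thesis
    proof (cases "x (k-2) < 0")
      case y2: True
      show ?thesis using BD_signs[of k] y1 y2 n unfolding sector_at_def by simp
    next
      case y2: False
      show ?thesis
      proof (cases "x k < 0")
        case True
        then show ?thesis using AD_signs[of k] y1 y2 n T unfolding sector_at_def by simp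
      next
        case y0: False
        show ?thesis
        proof (cases "x (k-3) < 0")
          case True
          then show ?thesis using EH_signs[of k] y1 y2 y0 n unfolding sector_at_def by simp
        next
          case False
          then show ?thesis using y1 y2 y0 n unfolding sector_at_def by simp
        qed
      qed
    qed
  next
    case y1: False
    show ?thesis
    proof (cases "x (k-2) < 0")
      case y2: True
      show ?thesis
      proof (cases "x (k-3) < 0")
        case True
        then show ?thesis using y1 y2 n unfolding sector_at_def by simp
      next
        case False
        then show ?thesis using y1 y2 n unfolding sector_at_def by simp
      qed
    next
      case False
      then show ?thesis using BE_signs[of k] y1 n unfolding sector_at_def by simp
    qed
  qed
  show "sector_at (k - 2) = BH" if "sector_at k = AD"
  proof -
    have y: "x k < 0" "x (k-1) < 0" "x (k-4) > 0"
      using that n unfolding sector_at_def by (auto split: if_splits)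
    show ?thesis using AD_signs[of k] y n unfolding sector_at_def by simp
  qed
qed

text \<open>\<open>AD\<close> lies one level below a turn to negative sign; \<open>EH\<close> lies
  two levels below a turn to positive sign.\<close>

lemma AD_often: "\<exists>k\<ge>j. sector_at k = AD"
proof -
  obtain N where N: "N \<ge> max (K + 10) j + 1" "x (N - 1) < 0" "x (N - 2) < 0" "x (N - 5) > 0"
    using w.turning_level by blast
  then have "sector_at (N - 1) = AD"
    using BD_signs[of N] unfolding sector_at_def by simp
  then show ?thesis using N by (intro exI[of _ "N - 1"]) simp
qed

lemma EH_often: "\<exists>k\<ge>j. sector_at k = EH"
proof -
  obtain N where N: "N \<ge> max (K + 10) j + 2" "x (N - 1) > 0" "x (N - 2) > 0" "x (N - 5) < 0"
    using ay_rotation.turning_level[OF w.neg_rotation] by (auto simp del: max_less_iff_conj)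
  then have "sector_at (N - 2) = EH"
    using BE_signs[of N] unfolding sector_at_def by simp
  then show ?thesis using N by (intro exI[of _ "N - 2"]) simp
qed

lemma sector_chain: "K + 10 \<le> int M \<Longrightarrow> sector_chain (\<lambda>n. sector_at (int n)) M"
proof
  fix n assume "K + 10 \<le> int M" "M \<le> n"
  then have k: "K + 10 \<le> int n" by simp
  show "sector_at (int n) \<in> sector_step (sector_at (int (Suc n)))"
    using sector_at_step(1)[of "int (Suc n)"] k by simp
  show "sector_at (int n) = BH" if "sector_at (int (n + 2)) = AD"
    using sector_at_step(2)[of "int (n + 2)"] k that by simp
next
  fix j :: nat
  obtain k where "k \<ge> int j" "sector_at k = AD" using AD_often by blast
  then show "\<exists>n\<ge>j. sector_at (int n) = AD" by (intro exI[of _ "nat k"]) auto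
  obtain k where "k \<ge> int j" "sector_at k = EH" using EH_often by blast
  then show "\<exists>n\<ge>j. sector_at (int n) = EH" by (intro exI[of _ "nat k"]) auto
qed

lemma eventual_sector_choices:
  obtains M where "K + 60 \<le> M"
    and "\<And>k. M \<le> k \<Longrightarrow> sector_at k \<in> {AB, BD, EA} \<Longrightarrow> d (k-1) < e (k-1) - x (k-2)"
    and "\<And>k. M \<le> k \<Longrightarrow> sector_at k \<notin> {AB, BD, EA} \<Longrightarrow> e (k-1) - x (k-2) < d (k-1)"
    and "\<And>k. M \<le> k \<Longrightarrow> sector_at k = AB \<or> sector_at k = EA \<and> sector_at (k-1) = BH \<Longrightarrow> b (k-1) < e (k-1) - x k"
    and "\<And>k. M \<le> k \<Longrightarrow> sector_at k = AD \<or> sector_at k = EA \<and> sector_at (k-1) \<noteq> BH \<Longrightarrow> e (k-1) - x k < b (k-1)"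
    and "\<And>k. M \<le> k \<Longrightarrow> sector_at k = EA \<Longrightarrow> h (k-1) + x (k-2) < a (k-1)"
    and "\<And>k. M \<le> k \<Longrightarrow> sector_at k = EH \<or> sector_at k = BE \<Longrightarrow> a (k-1) < h (k-1) + x (k-2)"
    and "\<And>k. M \<le> k \<Longrightarrow> sector_at k = AD \<or> sector_at k = DG \<or> sector_at k = BD \<and> sector_at (k-1) = AD \<Longrightarrow> a (k-1) < g (k-1) + x (k-2)"
    and "\<And>k. M \<le> k \<Longrightarrow> sector_at k = BD \<and> sector_at (k-1) \<noteq> AD \<Longrightarrow> g (k-1) + x (k-2) < a (k-1)"
    and "\<And>k. M \<le> k \<Longrightarrow> sector_at k = DG \<Longrightarrow> b (k-1) < h (k-1) - x k"
proof -
  obtain M where M: "K + 60 \<le> M"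
    and m1: "\<And>k. M \<le> k \<Longrightarrow> x (k-1) > 0 \<Longrightarrow> x (k-2) < 0 \<Longrightarrow> x (k-3) < 0 \<Longrightarrow> b (k-1) < e (k-1) - x k"
    and m2: "\<And>k. M \<le> k \<Longrightarrow> x (k-1) > 0 \<Longrightarrow> x (k-2) < 0 \<Longrightarrow> x (k-3) > 0 \<Longrightarrow> x (k-4) > 0 \<Longrightarrow> b (k-1) < e (k-1) - x k"
    and m3: "\<And>k. M \<le> k \<Longrightarrow> x (k-1) > 0 \<Longrightarrow> x (k-2) < 0 \<Longrightarrow> x (k-3) > 0 \<Longrightarrow> x (k-4) < 0 \<Longrightarrow> e (k-1) - x k < b (k-1)"
    and m4: "\<And>k. M \<le> k \<Longrightarrow> x (k-1) > 0 \<Longrightarrow> x (k-2) < 0 \<Longrightarrow> x (k-3) > 0 \<Longrightarrow> h (k-1) + x (k-2) < a (k-1)"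
    and m5: "\<And>k. M \<le> k \<Longrightarrow> x k < 0 \<Longrightarrow> x (k-1) < 0 \<Longrightarrow> x (k-4) > 0 \<Longrightarrow> e (k-1) - x k < b (k-1)"
    and m6: "\<And>k. M \<le> k \<Longrightarrow> x k < 0 \<Longrightarrow> x (k-1) < 0 \<Longrightarrow> a (k-1) < g (k-1) + x (k-2)"
    and m7: "\<And>k. M \<le> k \<Longrightarrow> x k < 0 \<Longrightarrow> x (k-1) < 0 \<Longrightarrow> x (k-4) < 0 \<Longrightarrow> b (k-1) < h (k-1) - x k"
    and m8: "\<And>k. M \<le> k \<Longrightarrow> x (k-1) < 0 \<Longrightarrow> x (k-2) < 0 \<Longrightarrow> x (k-5) > 0 \<Longrightarrow> a (k-1) < g (k-1) + x (k-2)"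
    and m9: "\<And>k. M \<le> k \<Longrightarrow> x (k-1) < 0 \<Longrightarrow> x (k-2) < 0 \<Longrightarrow> x (k-5) < 0 \<Longrightarrow> g (k-1) + x (k-2) < a (k-1)"
    by (rule eventual_choices) blast
  have n: "x (k - j) < 0 \<or> x (k - j) > 0" if "M \<le> k" "j \<le> 10" for k j
    using nz[of "k - j"] M that by force
  have n: "x k < 0 \<or> x k > 0" "x (k-1) < 0 \<or> x (k-1) > 0" "x (k-2) < 0 \<or> x (k-2) > 0"
     "x (k-3) < 0 \<or> x (k-3) > 0" "x (k-4) < 0 \<or> x (k-4) > 0" "x (k-5) < 0 \<or> x (k-5) > 0" if "M \<le> k" for k
    using n[of k 0] n[of k 1] n[of k 2] n[of k 3] n[of k 4] n[of k 5] that by simp_all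
  have nxt: "sector_at (k-1) = (if x (k - 2) < 0
     then (if x (k - 3) < 0 then BD
           else if x (k-1) < 0 then (if x (k - 5) < 0 then DG else AD)
           else (if x (k - 4) < 0 then EH else BH))
     else (if x (k - 3) < 0 then (if x (k - 4) < 0 then AB else EA) else BE))" for k
    unfolding sector_at_def by simp
  show thesis
  proof (rule that[OF M])
    fix k assume k: "M \<le> k"
    note n = n[OF k]
    show "sector_at k \<in> {AB, BD, EA} \<Longrightarrow> d (k-1) < e (k-1) - x (k-2)"
      using b_choice(1)[of k] k M unfolding sector_at_def by (auto split: if_splits)
    show "sector_at k \<notin> {AB, BD, EA} \<Longrightarrow> e (k-1) - x (k-2) < d (k-1)"
      using b_choice(2)[of k] k M n(3) unfolding sector_at_def by (auto split: if_splits)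
    show "sector_at k = AB \<or> sector_at k = EA \<and> sector_at (k-1) = BH \<Longrightarrow> b (k-1) < e (k-1) - x k"
      using m1[OF k] m2[OF k] n unfolding nxt unfolding sector_at_def by (auto split: if_splits)
    show "sector_at k = AD \<or> sector_at k = EA \<and> sector_at (k-1) \<noteq> BH \<Longrightarrow> e (k-1) - x k < b (k-1)"
      using m3[OF k] m5[OF k] n unfolding nxt unfolding sector_at_def by (auto split: if_splits)
    show "sector_at k = EA \<Longrightarrow> h (k-1) + x (k-2) < a (k-1)"
      using m4[OF k] n unfolding sector_at_def by (auto split: if_splits)
    show "sector_at k = EH \<or> sector_at k = BE \<Longrightarrow> a (k-1) < h (k-1) + x (k-2)"
      using e_choice[of k] k M K n unfolding sector_at_def by (auto split: if_splits)
    show "sector_at k = AD \<or> sector_at k = DG \<or> sector_at k = BD \<and> sector_at (k-1) = AD \<Longrightarrow> a (k-1) < g (k-1) + x (k-2)"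
      using m6[OF k] m8[OF k] BD_signs[of k] n unfolding nxt unfolding sector_at_def by (auto split: if_splits)
    show "sector_at k = BD \<and> sector_at (k-1) \<noteq> AD \<Longrightarrow> g (k-1) + x (k-2) < a (k-1)"
      using m9[OF k] BD_signs[of k] n unfolding nxt unfolding sector_at_def by (auto split: if_splits)
    show "sector_at k = DG \<Longrightarrow> b (k-1) < h (k-1) - x k"
      using m7[OF k] n unfolding sector_at_def by (auto split: if_splits)
  qed
qed

end

section \<open>The eigenvalue and the minimal walks\<close>

lemma cubic_root_exists:
  obtains al :: real where "5436/10000 < al" "al < 5437/10000" "al ^ 3 + al\<^sup>2 + al = 1"
proof -
  let ?f = "\<lambda>t::real. t ^ 3 + t\<^sup>2 + t"
  have "\<exists>t\<ge>5436/10000. t \<le> 5437/10000 \<and> ?f t = 1"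
    by (rule IVT') (auto simp: power2_eq_square power3_eq_cube intro!: continuous_intros)
  then obtain t where t: "5436/10000 \<le> t" "t \<le> 5437/10000" "?f t = 1" by blast
  have "?f (5436/10000) \<noteq> 1" "?f (5437/10000) \<noteq> 1" by (simp_all add: power2_eq_square power3_eq_cube)
  then have "t \<noteq> 5436/10000" "t \<noteq> 5437/10000" using t(3) by metis+
  with t show thesis by (intro that[of t]) auto
qed

text \<open>Splitting off the real root leaves a quadratic of discriminant -(3 + 2 al + 3 al^2) < 0.
  Exactly one root then has positive imaginary part, which makes the description of \<beta>
  meaningful.\<close>

lemma \<beta>_quadratic:
  assumes al: "5436/10000 < al" "al < 5437/10000" "al ^ 3 + al\<^sup>2 + al = 1"
  shows "\<beta>\<^sup>2 + of_real (1 + al) * \<beta> + of_real (1 + al + al\<^sup>2) = 0" "Im \<beta> > 0"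
    and "\<beta> ^ 3 + \<beta>\<^sup>2 + \<beta> = 1"
proof -
  define p where "p = 1 + al"
  define q where "q = 1 + al + al\<^sup>2"
  have alq: "al * q = 1" "q - al * p = 1" "p - al = 1"
    using al(3) unfolding p_def q_def by (simp_all add: power2_eq_square power3_eq_cube algebra_simps)
  have fac: "t ^ 3 + t ^ 2 + t - 1 = (t - of_real al) * (t\<^sup>2 + of_real p * t + of_real q)" for t :: complex
  proof -
    have "(t - of_real al) * (t\<^sup>2 + of_real p * t + of_real q)
        = t ^ 3 + of_real (p - al) * t\<^sup>2 + of_real (q - al * p) * t - of_real (al * q)"
      by (simp add: power2_eq_square power3_eq_cube algebra_simps)
    then show ?thesis using alq by simp
  qed
  define D where "D = 4 * q - p\<^sup>2"
  have "D = 3 + 2 * al + 3 * al\<^sup>2" unfolding D_def p_def q_def by (simp add: power2_eq_square algebra_simps)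
  moreover have "al\<^sup>2 \<ge> 0" by simp
  ultimately have D: "D > 0" using al by linarith
  define r where "r = Complex (- p / 2) (sqrt D / 2)"
  have r: "r\<^sup>2 + of_real p * r + of_real q = 0"
    using D unfolding r_def D_def by (simp add: complex_eq_iff power2_eq_square field_simps)
  have Imr: "Im r > 0" using D unfolding r_def by simp
  have uniq: "t = r" if "t ^ 3 + t ^ 2 + t - 1 = 0" "Im t > 0" for t
  proof -
    have "t \<noteq> of_real al" using that by auto
    then have t: "t\<^sup>2 + of_real p * t + of_real q = 0" using fac that by simp
    have "(t - r) * (t + r + of_real p) = (t\<^sup>2 + of_real p * t + of_real q) - (r\<^sup>2 + of_real p * r + of_real q)"
      by (simp add: power2_eq_square algebra_simps)
    then have "t = r \<or> t + r + of_real p = 0" using t r by simp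
    moreover have "Im (t + r + of_real p) > 0" using that D unfolding r_def by (simp add: add_pos_pos)
    ultimately show ?thesis by (metis less_irrefl zero_complex.sel(2))
  qed
  have "\<beta> = r" unfolding \<beta>_def
  proof (rule the_equality)
    show "r ^ 3 + r ^ 2 + r - 1 = 0 \<and> Im r > 0" using fac r D unfolding r_def by simp
  qed (use uniq in blast)
  then show "\<beta>\<^sup>2 + of_real (1 + al) * \<beta> + of_real (1 + al + al\<^sup>2) = 0" "Im \<beta> > 0"
    "\<beta> ^ 3 + \<beta>\<^sup>2 + \<beta> = 1"
    using r Imr fac[of r] unfolding p_def q_def by (simp_all add: algebra_simps)
qed

section \<open>Nonreal powers of \<beta> and recurring sign changes\<close>

lemma cubic_root_irrational:
  assumes al: "0 < al" "al < 1" "al ^ 3 + al\<^sup>2 + al = (1::real)"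
  shows "al \<notin> \<rat>"
proof
  assume "al \<in> \<rat>"
  then obtain m n :: nat where n: "n \<noteq> 0" and mn: "\<bar>al\<bar> = real m / real n" and cop: "coprime m n"
    by (rule Rats_abs_nat_div_natE)
  have al': "al = real m / real n" using mn al by simp
  have "real m ^ 3 + real m ^ 2 * real n + real m * real n ^ 2 = real n ^ 3"
    using al(3) n unfolding al' by (simp add: field_simps power2_eq_square power3_eq_cube)
  then have "real (m ^ 3 + m ^ 2 * n + m * n ^ 2) = real (n ^ 3)" by simp
  then have e: "m ^ 3 + m ^ 2 * n + m * n ^ 2 = n ^ 3" by (simp only: of_nat_eq_iff)
  have "n dvd m ^ 3 + m ^ 2 * n + m * n ^ 2" unfolding e by simp
  moreover have "n dvd m ^ 2 * n + m * n ^ 2" by (simp add: power2_eq_square)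
  ultimately have "n dvd m ^ 3" by (metis add.assoc dvd_add_left_iff)
  moreover have "coprime n (m ^ 3)" using cop by (simp add: coprime_commute)
  ultimately have "n = 1" by (metis coprime_absorb_left nat_dvd_1_iff_1)
  then show False using al al' by auto
qed

text \<open>Modulo the cubic, \<beta>^n and al^n have the same integer coordinates in 1, t, t^2. A
  real \<beta>^n would give q = r (1 + al), hence q = r = 0 by irrationality, and al^n would be an
  integer strictly between 0 and 1.\<close>

lemma \<beta>_power_not_real:
  assumes "0 < n" shows "Im (\<beta> ^ n) \<noteq> 0"
proof
  assume im: "Im (\<beta> ^ n) = 0"
  obtain al :: real where al: "5436/10000 < al" "al < 5437/10000" "al ^ 3 + al\<^sup>2 + al = 1"
    by (rule cubic_root_exists)
  note b = \<beta>_quadratic[OF al]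
  have "\<exists>a b c :: int. \<beta> ^ k = of_int a + of_int b * \<beta> + of_int c * \<beta>\<^sup>2
      \<and> al ^ k = of_int a + of_int b * al + of_int c * al\<^sup>2" for k
  proof (induction k)
    case 0
    show ?case by (intro exI[of _ 1] exI[of _ 0]) simp
  next
    case (Suc k)
    then obtain p q r :: int where pqr: "\<beta> ^ k = of_int p + of_int q * \<beta> + of_int r * \<beta>\<^sup>2"
      "al ^ k = of_int p + of_int q * al + of_int r * al\<^sup>2" by blast
    have c: "\<beta> * \<beta>\<^sup>2 = 1 - \<beta> - \<beta>\<^sup>2" "al * al\<^sup>2 = 1 - al - al\<^sup>2"
      using b(3) al(3) by (simp_all add: power2_eq_square power3_eq_cube algebra_simps)
    have "\<beta> ^ Suc k = of_int p * \<beta> + of_int q * \<beta>\<^sup>2 + of_int r * (\<beta> * \<beta>\<^sup>2)"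
      unfolding power_Suc pqr by (simp add: power2_eq_square algebra_simps)
    moreover have "al ^ Suc k = of_int p * al + of_int q * al\<^sup>2 + of_int r * (al * al\<^sup>2)"
      unfolding power_Suc pqr by (simp add: power2_eq_square algebra_simps)
    ultimately show ?case unfolding c
      by (intro exI[of _ r] exI[of _ "p - r"] exI[of _ "q - r"]) (simp add: algebra_simps)
  qed
  then obtain p q r :: int where pqr: "\<beta> ^ n = of_int p + of_int q * \<beta> + of_int r * \<beta>\<^sup>2"
      "al ^ n = of_int p + of_int q * al + of_int r * al\<^sup>2" by blast
  have "Im (\<beta>\<^sup>2 + of_real (1 + al) * \<beta> + of_real (1 + al + al\<^sup>2)) = 0" by (simp only: b(1) zero_complex.sel)
  then have im2: "Im (\<beta>\<^sup>2) = - (1 + al) * Im \<beta>" by (simp add: algebra_simps)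
  have "Im (\<beta> ^ n) = (of_int q - of_int r * (1 + al)) * Im \<beta>"
  proof -
    have "Im (\<beta> ^ n) = of_int q * Im \<beta> + of_int r * Im (\<beta>\<^sup>2)" unfolding pqr(1) by simp
    then show ?thesis unfolding im2 by (simp add: algebra_simps)
  qed
  then have qr: "of_int q = of_int r * (1 + al)" using im b(2) by simp
  have "r = 0"
  proof (rule ccontr)
    assume "r \<noteq> 0"
    then have "al = of_int q / of_int r - 1" using qr by (simp add: field_simps)
    also have "\<dots> \<in> \<rat>" by simp
    finally show False using cubic_root_irrational[of al] al by simp
  qed
  then have "al ^ n = of_int p" using qr pqr(2) by simp
  moreover have "0 < al ^ n" "al ^ n < 1" using al assms by (simp_all add: power_Suc_less_one power_less_one_iff)
  ultimately show False by simp
qed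

text \<open>The ratios \<open>u (j + 1) / u j\<close> would decrease by a fixed amount at each step.\<close>

lemma not_always_positive:
  fixes u :: "nat \<Rightarrow> real"
  assumes rec: "\<And>j. u (Suc (Suc j)) = P * u (Suc j) - Q * u j" and PQ: "P\<^sup>2 < 4 * Q"
  shows "\<exists>j. u j \<le> 0"
proof (rule ccontr)
  assume "\<not> (\<exists>j. u j \<le> 0)"
  then have pos: "u j > 0" for j by (simp add: not_le)
  define r where "r j = u (Suc j) / u j" for j
  have rpos: "r j > 0" for j unfolding r_def using pos by simp
  \<comment> \<open>By the arithmetic-geometric mean inequality, r + Q / r is at least the square
    root of 4 Q, so each ratio drops by at least \<open>dd\<close>.\<close>
  define dd where "dd = sqrt (4 * Q) - P"
  have Q: "Q > 0" using PQ by (metis zero_le_power2 le_less_trans mult_pos_pos zero_less_mult_pos zero_less_numeral)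
  have dd: "dd > 0" unfolding dd_def using PQ by (simp add: real_less_rsqrt)
  have step: "r (Suc j) \<le> r j - dd" for j
  proof -
    have "r (Suc j) = P - Q / r j"
      unfolding r_def rec using pos[of j] pos[of "Suc j"] by (simp add: field_simps)
    moreover have "sqrt (4 * Q) \<le> r j + Q / r j"
    proof -
      have "0 \<le> (r j - sqrt Q)\<^sup>2" by simp
      then have "2 * r j * sqrt Q \<le> (r j)\<^sup>2 + Q" using Q by (simp add: power2_diff)
      then have "2 * r j * sqrt Q \<le> r j * r j + Q" by (simp add: power2_eq_square)
      then show ?thesis using rpos[of j] by (simp add: field_simps real_sqrt_mult)
    qed
    ultimately show ?thesis unfolding dd_def by linarith
  qed
  have "r j \<le> r 0 - real j * dd" for j
  proof (induction j)
    case (Suc j)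
    then show ?case using step[of j] by (simp add: distrib_right)
  qed simp
  moreover obtain j where "real j * dd > r 0" using reals_Archimedean3[OF dd] by blast
  ultimately show False using rpos[of j] by (smt (verit))
qed

lemma Re_of_real_mult: "Re (of_real c * w) = c * Re w"
  by simp

lemma \<beta>_nonzero: "\<beta> \<noteq> 0"
  using \<beta>_power_not_real[of 1] by auto

text \<open>Along steps of three, the real parts satisfy a recurrence with the nonreal
  characteristic roots w = \<beta>^3 and its conjugate, so neither sign can persist.\<close>

lemma real_part_turns:
  fixes z :: complex
  assumes nz: "\<And>k. K \<le> k \<Longrightarrow> Re (z * \<beta> powi k) \<noteq> 0"
  shows "\<exists>m\<ge>k. Re (z * \<beta> powi m) > 0 \<and> Re (z * \<beta> powi (m + 3)) < 0"
proof -
  define k0 where "k0 = max k K"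
  define u where "u j = Re (z * \<beta> powi (k0 + 3 * int j))" for j :: nat
  have un: "u j \<noteq> 0" for j unfolding u_def using nz[of "k0 + 3 * int j"] unfolding k0_def by simp
  define w where "w = \<beta> ^ 3"
  have wq: "w\<^sup>2 = of_real (2 * Re w) * w - of_real ((cmod w)\<^sup>2)"
    by (simp only: cmod_power2) (simp add: complex_eq_iff power2_eq_square algebra_simps)
  have pw: "\<beta> powi (k0 + 3 * int (Suc j)) = \<beta> powi (k0 + 3 * int j) * w"
    "\<beta> powi (k0 + 3 * int (Suc (Suc j))) = \<beta> powi (k0 + 3 * int j) * w\<^sup>2" for j
  proof -
    have "k0 + 3 * int (Suc j) = (k0 + 3 * int j) + 3" "k0 + 3 * int (Suc (Suc j)) = (k0 + 3 * int j) + 6" by simp_all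
    then show "\<beta> powi (k0 + 3 * int (Suc j)) = \<beta> powi (k0 + 3 * int j) * w"
      "\<beta> powi (k0 + 3 * int (Suc (Suc j))) = \<beta> powi (k0 + 3 * int j) * w\<^sup>2"
      unfolding w_def using \<beta>_nonzero by (simp_all add: power_int_add power_mult[symmetric])
  qed
  have rec: "u (Suc (Suc j)) = (2 * Re w) * u (Suc j) - (cmod w)\<^sup>2 * u j" for j
  proof -
    have "z * (\<beta> powi (k0 + 3 * int j) * w\<^sup>2)
      = of_real (2 * Re w) * (z * (\<beta> powi (k0 + 3 * int j) * w)) - of_real ((cmod w)\<^sup>2) * (z * \<beta> powi (k0 + 3 * int j))"
      unfolding wq by (simp add: algebra_simps)
    then show ?thesis unfolding u_def pw(2) unfolding pw(1) by (simp only: minus_complex.sel Re_of_real_mult)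
  qed
  have "Im w \<noteq> 0" unfolding w_def using \<beta>_power_not_real[of 3] by simp
  then have PQ: "(2 * Re w)\<^sup>2 < 4 * (cmod w)\<^sup>2" by (simp add: cmod_power2 power_mult_distrib)
  have "\<exists>j. - u j \<le> 0" by (rule not_always_positive[of "\<lambda>j. - u j", OF _ PQ]) (simp add: rec)
  then obtain i where i: "u i > 0" using un by (metis le_less neg_le_0_iff_le)
  have "\<exists>j. u (i + j) \<le> 0"
    by (rule not_always_positive[of "\<lambda>j. u (i + j)", OF _ PQ]) (use rec in simp)
  then have ex: "\<exists>j. u (i + j) < 0" using un by (metis le_less)
  \<comment> \<open>The first negative term after a positive one has a positive predecessor, giving
    a sign change between \<open>m\<close> and \<open>m + 3\<close> exactly.\<close>
  define j where "j = (LEAST j. u (i + j) < 0)"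
  have j: "u (i + j) < 0" unfolding j_def using ex by (rule LeastI_ex)
  then obtain j' where j': "j = Suc j'" using i by (cases j) auto
  have "\<not> u (i + j') < 0" using not_less_Least[of j' "\<lambda>j. u (i + j) < 0"] j' j_def by auto
  then have "u (i + j') > 0" using un[of "i + j'"] by linarith
  moreover have "k0 + 3 * int (i + j) = k0 + 3 * int (i + j') + 3" using j' by simp
  then have "Re (z * \<beta> powi (k0 + 3 * int (i + j') + 3)) < 0" using j unfolding u_def by (simp only:)
  moreover have "k \<le> k0 + 3 * int (i + j')" unfolding k0_def by simp
  ultimately show ?thesis unfolding u_def by blast
qed

text \<open>At most one term vanishes: from a purely imaginary nonzero z \<beta>^k, another zero
  would require a real positive power of \<beta>.\<close>

lemma real_part_eventually_nonzero:
  fixes z :: complex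
  assumes "z \<noteq> 0"
  obtains K where "0 \<le> K" "\<And>k. K \<le> k \<Longrightarrow> Re (z * \<beta> powi k) \<noteq> 0"
proof (cases "\<exists>k\<ge>0. Re (z * \<beta> powi k) = 0")
  case False
  then show ?thesis using that[of 0] by auto
next
  case True
  then obtain k0 where k0: "0 \<le> k0" "Re (z * \<beta> powi k0) = 0" by blast
  show ?thesis
  proof (rule that[of "k0 + 1"])
    fix k assume k: "k0 + 1 \<le> k"
    define n where "n = nat (k - k0)"
    have n: "k = k0 + int n" "0 < n" using k unfolding n_def by simp_all
    have "z * \<beta> powi k = (z * \<beta> powi k0) * \<beta> ^ n" unfolding n using \<beta>_nonzero by (simp add: power_int_add)
    then have "Re (z * \<beta> powi k) = - Im (z * \<beta> powi k0) * Im (\<beta> ^ n)"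
      using k0(2) by (simp only: times_complex.sel(1)[of "z * \<beta> powi k0"] mult_zero_left diff_0 mult_minus_left)
    moreover have "Im (z * \<beta> powi k0) \<noteq> 0"
      using k0(2) assms \<beta>_nonzero by (metis complex_eq_iff mult_eq_0_iff power_int_eq_0_iff zero_complex.sel)
    ultimately show "Re (z * \<beta> powi k) \<noteq> 0" using \<beta>_power_not_real[OF n(2)] by simp
  qed (use k0 in simp)
qed

lemma real_part_signs:
  assumes al: "5436/10000 < al" "al < 5437/10000" "al ^ 3 + al\<^sup>2 + al = 1"
  shows "ay_signs al (\<lambda>k. Re (z * \<beta> powi k))"
proof
  fix k :: int
  note b = \<beta>_quadratic[OF al]
  have p: "\<beta> powi (k - 2) = \<beta> powi (k - 3) * \<beta>" "\<beta> powi (k - 1) = \<beta> powi (k - 3) * \<beta>\<^sup>2"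
    "\<beta> powi k = \<beta> powi (k - 3) * \<beta> ^ 3"
    using power_int_add[of \<beta> "k - 3" 1] power_int_add[of \<beta> "k - 3" 2] power_int_add[of \<beta> "k - 3" 3] \<beta>_nonzero
    by simp_all
  have "z * \<beta> powi (k - 3) = z * \<beta> powi (k - 3) * (\<beta> ^ 3 + \<beta>\<^sup>2 + \<beta>)" using b(3) by simp
  also have "\<dots> = z * \<beta> powi (k - 2) + z * \<beta> powi (k - 1) + z * \<beta> powi k"
    unfolding p by (simp add: algebra_simps)
  finally show "Re (z * \<beta> powi (k - 3)) = Re (z * \<beta> powi (k - 2)) + Re (z * \<beta> powi (k - 1)) + Re (z * \<beta> powi k)"
    by (simp only: plus_complex.sel)
  have p: "\<beta> powi (k - 1) = \<beta> powi (k - 2) * \<beta>" "\<beta> powi k = \<beta> powi (k - 2) * \<beta>\<^sup>2"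
    using power_int_add[of \<beta> "k - 2" 1] power_int_add[of \<beta> "k - 2" 2] \<beta>_nonzero by simp_all
  have "al * (1 + al + al\<^sup>2) = 1" using al(3) by (simp add: power2_eq_square power3_eq_cube algebra_simps)
  then have q: "of_real al * of_real (1 + al + al\<^sup>2) = (1 :: complex)" by (metis of_real_1 of_real_mult)
  have "of_real al * \<beta>\<^sup>2 + of_real (al + al\<^sup>2) * \<beta> + 1
      = of_real al * (\<beta>\<^sup>2 + of_real (1 + al) * \<beta> + of_real (1 + al + al\<^sup>2))"
    unfolding distrib_left q by (simp add: power2_eq_square algebra_simps)
  then have "of_real al * \<beta>\<^sup>2 + of_real (al + al\<^sup>2) * \<beta> + 1 = 0" using b(1) by simp
  then have "z * \<beta> powi (k - 2) * (of_real al * \<beta>\<^sup>2 + of_real (al + al\<^sup>2) * \<beta> + 1) = 0" by simp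
  then have "z * \<beta> powi (k - 2) + of_real (al + al\<^sup>2) * (z * \<beta> powi (k - 1)) + of_real al * (z * \<beta> powi k) = 0"
    unfolding p by (simp add: algebra_simps)
  then have "Re (z * \<beta> powi (k - 2)) + (al + al\<^sup>2) * Re (z * \<beta> powi (k - 1)) + al * Re (z * \<beta> powi k) = 0"
    by (metis plus_complex.sel(1) Re_of_real_mult zero_complex.sel(1))
  then show "Re (z * \<beta> powi (k - 2)) = - ((al + al\<^sup>2) * Re (z * \<beta> powi (k - 1))) - al * Re (z * \<beta> powi k)"
    by linarith
qed (use al in auto)

section \<open>Labels, the eigenvector and minima of finite walks\<close>

lemma labels_eq:
  "labels L1 = {([], L3, [L5]), ([L3], L5, [])}"
  "labels L2 = {([], L4, [L5]), ([L4], L5, [])}"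
  "labels L3 = {([], L4, [L6]), ([L4], L6, [])}"
  "labels L4 = {([], L1, [L7]), ([L1], L7, [])}"
  "labels L5 = {([], L1, [L8]), ([L1], L8, [])}"
  "labels L6 = {([], L1, [L9]), ([L1], L9, [])}"
  "labels L7 = {([], L2, [L9]), ([L2], L9, [])}"
  "labels L8 = {([], L2, [])}"
  "labels L9 = {([], L3, [])}"
  unfolding labels_def by (auto simp: Cons_eq_append_conv)

lemma finite_labels [simp]: "finite (labels a)" and labels_nonempty [simp]: "labels a \<noteq> {}"
  by (cases a; simp add: labels_eq)+

lemma word_sum_simps [simp]:
  "word_sum \<gamma> [] = 0" "word_sum \<gamma> (a # w) = \<gamma> $ a + word_sum \<gamma> w" "word_sum \<gamma> (w @ w') = word_sum \<gamma> w + word_sum \<gamma> w'"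
  unfolding word_sum_def by simp_all

lemma \<Gamma>_values: "\<Gamma> $ L1 = inverse \<beta>" "\<Gamma> $ L2 = - \<beta>" "\<Gamma> $ L3 = - \<beta>" "\<Gamma> $ L4 = - inverse \<beta>"
  "\<Gamma> $ L5 = \<beta> + 1" "\<Gamma> $ L6 = \<beta> + 1" "\<Gamma> $ L7 = - inverse \<beta> - 1" "\<Gamma> $ L8 = - 1" "\<Gamma> $ L9 = - 1"
proof -
  obtain al :: real where al: "5436/10000 < al" "al < 5437/10000" "al ^ 3 + al\<^sup>2 + al = 1"
    by (rule cubic_root_exists)
  have "\<beta> * (\<beta>\<^sup>2 + \<beta> + 1) = 1"
    using \<beta>_quadratic(3)[OF al] by (simp add: power2_eq_square power3_eq_cube algebra_simps)
  then have "inverse \<beta> = \<beta>\<^sup>2 + \<beta> + 1" by (rule inverse_unique)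
  then show "\<Gamma> $ L1 = inverse \<beta>" "\<Gamma> $ L2 = - \<beta>" "\<Gamma> $ L3 = - \<beta>" "\<Gamma> $ L4 = - inverse \<beta>"
    "\<Gamma> $ L5 = \<beta> + 1" "\<Gamma> $ L6 = \<beta> + 1" "\<Gamma> $ L7 = - inverse \<beta> - 1" "\<Gamma> $ L8 = - 1" "\<Gamma> $ L9 = - 1"
    unfolding \<Gamma>_def by simp_all
qed

lemma word_sum_\<sigma>: "word_sum \<Gamma> (\<sigma> a) = \<beta> * \<Gamma> $ a"
proof -
  obtain al :: real where al: "5436/10000 < al" "al < 5437/10000" "al ^ 3 + al\<^sup>2 + al = 1"
    by (rule cubic_root_exists)
  have "inverse \<beta> = \<beta>\<^sup>2 + \<beta> + 1"
    by (rule inverse_unique) (use \<beta>_quadratic(3)[OF al] in \<open>simp add: power2_eq_square power3_eq_cube algebra_simps\<close>)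
  moreover have "\<beta> + (\<beta> * \<beta> + \<beta> * (\<beta> * \<beta>)) = 1"
    using \<beta>_quadratic(3)[OF al] by (simp add: power2_eq_square power3_eq_cube algebra_simps)
  ultimately show ?thesis using \<beta>_nonzero
    by (cases a) (simp_all add: \<Gamma>_values algebra_simps power2_eq_square)
qed

definition cost :: "complex \<Rightarrow> nat \<Rightarrow> word \<Rightarrow> real" where
  "cost z n p = Re (z * \<beta> ^ n * word_sum \<Gamma> p)"

text \<open>The minimum of Re (z \<Gamma>(u)) over the proper prefixes u of the n-fold image of
  \<open>a\<close>. Such a prefix at level \<open>Suc n\<close> consists of the n-fold image of
  \<open>p\<close>, with sum \<beta>^n \<Gamma>(p), followed by a proper prefix of the n-fold image
  of \<open>c\<close>. A single letter has only the empty one.\<close>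

primrec minwalk :: "complex \<Rightarrow> nat \<Rightarrow> letter \<Rightarrow> real" where
  "minwalk z 0 a = 0"
| "minwalk z (Suc n) a = (MIN (p, c, s) \<in> labels a. cost z n p + minwalk z n c)"

lemma minwalk_le: "(p, c, s) \<in> labels a \<Longrightarrow> minwalk z (Suc n) a \<le> cost z n p + minwalk z n c"
  by (auto intro!: Min_le intro: rev_image_eqI)

lemma minwalk_attained: "\<exists>(p, c, s) \<in> labels a. minwalk z (Suc n) a = cost z n p + minwalk z n c"
proof -
  have "minwalk z (Suc n) a \<in> (\<lambda>(p, c, s). cost z n p + minwalk z n c) ` labels a"
    unfolding minwalk.simps by (rule Min_in) simp_all
  then show ?thesis by force
qed

lemma cost_Nil [simp]: "cost z n [] = 0"
  by (simp add: cost_def)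

text \<open>The pairs 2 and 3, 5 and 6, 8 and 9 have equal values in \<Gamma>, and \<sigma> respects
  these identifications; nine letters reduce to six classes.\<close>

lemma minwalk_same: "minwalk z n L3 = minwalk z n L2 \<and> minwalk z n L6 = minwalk z n L5 \<and> minwalk z n L9 = minwalk z n L8"
  by (induction n) (simp_all add: labels_eq)

lemma eventual_letter_choices:
  assumes "z \<noteq> 0"
  obtains S M where "sector_chain S M"
    and "\<And>n a p c s. M \<le> n \<Longrightarrow> (p, c, s) \<in> labels a \<Longrightarrow> minwalk z (Suc n) a = cost z n p + minwalk z n c
       \<Longrightarrow> c \<in> choices (S (Suc n)) (S n) a"
proof -
  obtain al :: real where al: "5436/10000 < al" "al < 5437/10000" "al ^ 3 + al\<^sup>2 + al = 1"
    by (rule cubic_root_exists)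
  define x where "x k = Re (z * \<beta> powi k)" for k :: int
  obtain K where K: "0 \<le> K" "\<And>k. K \<le> k \<Longrightarrow> x k \<noteq> 0"
    unfolding x_def by (rule real_part_eventually_nonzero[OF assms]) blast
  define h where "h a k = minwalk z (nat k) a" for a and k :: int
  \<comment> \<open>At \<open>k = 1\<close> the term \<open>x (k - 2)\<close> involves the inverse
    of \<beta>, hence the integer exponents.\<close>
  have pw: "\<beta> powi k = \<beta> ^ nat (k - 1) * \<beta>" "\<beta> powi (k - 2) = \<beta> ^ nat (k - 1) * inverse \<beta>" if "1 \<le> k" for k
  proof -
    define m where "m = nat (k - 1)"
    have m: "k = int m + 1" "k - 2 = int m + (- 1)" using that unfolding m_def by simp_all
    have "\<beta> powi (int m + 1) = \<beta> ^ m * \<beta>" "\<beta> powi (int m + (- 1)) = \<beta> ^ m * inverse \<beta>"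
      using \<beta>_nonzero by (simp_all add: power_int_add power_int_minus del: add_uminus_conv_diff)
    then show "\<beta> powi k = \<beta> ^ nat (k - 1) * \<beta>" "\<beta> powi (k - 2) = \<beta> ^ nat (k - 1) * inverse \<beta>"
      unfolding m_def[symmetric] m(2) by (simp_all only: m(1))
  qed
  have cst: "cost z (nat (k - 1)) [L3] = - x k" "cost z (nat (k - 1)) [L2] = - x k"
    "cost z (nat (k - 1)) [L4] = - x (k - 2)" "cost z (nat (k - 1)) [L1] = x (k - 2)" if "1 \<le> k" for k
    unfolding cost_def x_def pw[OF that] by (simp_all only: word_sum_simps \<Gamma>_values) (simp_all add: algebra_simps)
  have same: "h L3 k = h L2 k" "h L6 k = h L5 k" "h L9 k = h L8 k" for k
    unfolding h_def using minwalk_same by blast+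
  have nS: "nat k = Suc (nat (k - 1))" if "1 \<le> k" for k :: int using that by simp
  interpret A: ay_min al x "h L1" "h L2" "h L4" "h L5" "h L7" "h L8" K
  proof -
    interpret ay_signs al x unfolding x_def by (rule real_part_signs[OF al])
    show "ay_min al x (h L1) (h L2) (h L4) (h L5) (h L7) (h L8) K"
    proof
      show "0 \<le> K" by (rule K)
      show "\<And>k. K \<le> k \<Longrightarrow> x k \<noteq> 0" by (rule K)
      fix k :: int
      show "\<exists>m\<ge>k. x m > 0 \<and> x (m + 3) < 0"
        using real_part_turns[of K z k] K(2) unfolding x_def by blast
      have "\<exists>m\<ge>k. Re (- z * \<beta> powi m) > 0 \<and> Re (- z * \<beta> powi (m + 3)) < 0"
      proof (rule real_part_turns[of K])
        fix j assume "K \<le> j"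
        then have "x j \<noteq> 0" by (rule K(2))
        then show "Re (- z * \<beta> powi j) \<noteq> 0" unfolding x_def by simp
      qed
      then show "\<exists>m\<ge>k. x m < 0 \<and> x (m + 3) > 0" unfolding x_def by simp
      assume k: "1 \<le> k"
      have m: "h a k = (MIN (p, c, s) \<in> labels a. cost z (nat (k - 1)) p + h c (k - 1))" for a
        unfolding h_def nS[OF k] minwalk.simps ..
      show "h L1 k = min (h L2 (k - 1)) (h L5 (k - 1) - x k)" "h L2 k = min (h L4 (k - 1)) (h L5 (k - 1) - x (k - 2))"
        "h L4 k = min (h L1 (k - 1)) (h L7 (k - 1) + x (k - 2))" "h L5 k = min (h L1 (k - 1)) (h L8 (k - 1) + x (k - 2))"
        "h L7 k = min (h L2 (k - 1)) (h L8 (k - 1) - x k)" "h L8 k = h L2 (k - 1)"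
        unfolding m labels_eq by (simp_all add: cst[OF k] same)
    qed
  qed
  obtain M where M: "K + 60 \<le> M"
    and d1: "\<And>k. M \<le> k \<Longrightarrow> A.sector_at k \<in> {AB, BD, EA} \<Longrightarrow> h L4 (k-1) < h L5 (k-1) - x (k-2)"
    and d2: "\<And>k. M \<le> k \<Longrightarrow> A.sector_at k \<notin> {AB, BD, EA} \<Longrightarrow> h L5 (k-1) - x (k-2) < h L4 (k-1)"
    and d3: "\<And>k. M \<le> k \<Longrightarrow> A.sector_at k = AB \<or> A.sector_at k = EA \<and> A.sector_at (k-1) = BH \<Longrightarrow> h L2 (k-1) < h L5 (k-1) - x k"
    and d4: "\<And>k. M \<le> k \<Longrightarrow> A.sector_at k = AD \<or> A.sector_at k = EA \<and> A.sector_at (k-1) \<noteq> BH \<Longrightarrow> h L5 (k-1) - x k < h L2 (k-1)"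
    and d5: "\<And>k. M \<le> k \<Longrightarrow> A.sector_at k = EA \<Longrightarrow> h L8 (k-1) + x (k-2) < h L1 (k-1)"
    and d6: "\<And>k. M \<le> k \<Longrightarrow> A.sector_at k = EH \<or> A.sector_at k = BE \<Longrightarrow> h L1 (k-1) < h L8 (k-1) + x (k-2)"
    and d7: "\<And>k. M \<le> k \<Longrightarrow> A.sector_at k = AD \<or> A.sector_at k = DG \<or> A.sector_at k = BD \<and> A.sector_at (k-1) = AD \<Longrightarrow> h L1 (k-1) < h L7 (k-1) + x (k-2)"
    and d8: "\<And>k. M \<le> k \<Longrightarrow> A.sector_at k = BD \<and> A.sector_at (k-1) \<noteq> AD \<Longrightarrow> h L7 (k-1) + x (k-2) < h L1 (k-1)"
    and d9: "\<And>k. M \<le> k \<Longrightarrow> A.sector_at k = DG \<Longrightarrow> h L2 (k-1) < h L8 (k-1) - x k"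
    by (rule A.eventual_sector_choices) blast
  have M0: "1 \<le> M" using M K by simp
  show thesis
  proof (rule that[of "\<lambda>n. A.sector_at (int n)" "nat M"])
    show "sector_chain (\<lambda>n. A.sector_at (int n)) (nat M)"
      by (rule A.sector_chain) (use M K in simp)
    fix n a p c s
    assume n: "nat M \<le> n" and l: "(p, c, s) \<in> labels a" and opt: "minwalk z (Suc n) a = cost z n p + minwalk z n c"
    define k where "k = int (Suc n)"
    have k: "M \<le> k" "1 \<le> k" "k - 1 = int n" "nat (k - 1) = n" using n M0 unfolding k_def by simp_all
    have opt': "h c (k - 1) + cost z n p \<le> h c' (k - 1) + cost z n p'" if "(p', c', s') \<in> labels a" for p' c' s'
      using opt minwalk_le[OF that, of z n] unfolding h_def k(4) by simp
    note cs = cst[OF k(2), unfolded k(4)]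
    have "c \<in> choices (A.sector_at k) (A.sector_at (k - 1)) a"
    proof (cases a)
      case L1
      show ?thesis using l opt'[of "[]" L3 "[L5]"] opt'[of "[L3]" L5 "[]"] d3[OF k(1)] d4[OF k(1)]
        unfolding L1 labels_eq by (auto simp: cs same split: sector.splits)
    next
      case L2
      show ?thesis using l opt'[of "[]" L4 "[L5]"] opt'[of "[L4]" L5 "[]"] d1[OF k(1)] d2[OF k(1)]
        unfolding L2 labels_eq by (auto simp: cs same split: sector.splits)
    next
      case L3
      show ?thesis using l opt'[of "[]" L4 "[L6]"] opt'[of "[L4]" L6 "[]"] d1[OF k(1)] d2[OF k(1)]
        unfolding L3 labels_eq by (auto simp: cs same split: sector.splits)
    next
      case L4
      show ?thesis using l opt'[of "[]" L1 "[L7]"] opt'[of "[L1]" L7 "[]"] d7[OF k(1)] d8[OF k(1)]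
        unfolding L4 labels_eq by (auto simp: cs same split: sector.splits)
    next
      case L5
      show ?thesis using l opt'[of "[]" L1 "[L8]"] opt'[of "[L1]" L8 "[]"] d5[OF k(1)] d6[OF k(1)]
        unfolding L5 labels_eq by (auto simp: cs same split: sector.splits)
    next
      case L6
      show ?thesis using l opt'[of "[]" L1 "[L9]"] opt'[of "[L1]" L9 "[]"] d5[OF k(1)] d6[OF k(1)]
        unfolding L6 labels_eq by (auto simp: cs same split: sector.splits)
    next
      case L7
      show ?thesis using l opt'[of "[]" L2 "[L9]"] opt'[of "[L2]" L9 "[]"] d9[OF k(1)]
        unfolding L7 labels_eq by (auto simp: cs same split: sector.splits)
    next
      case L8
      show ?thesis using l unfolding L8 labels_eq by auto
    next
      case L9
      show ?thesis using l unfolding L9 labels_eq by auto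
    qed
    then show "c \<in> choices (A.sector_at (int (Suc n))) (A.sector_at (int n)) a"
      unfolding k(3) unfolding k_def .
  qed
qed

section \<open>Recognisability\<close>

definition starts :: "letter \<Rightarrow> bool" where
  "starts a \<longleftrightarrow> a \<in> {L1, L2, L3, L4}"

lemma \<sigma>_cases:
  obtains b where "\<sigma> a = [b]" "starts b" | b c where "\<sigma> a = [b, c]" "starts b" "\<not> starts c"
  by (cases a) (simp_all add: starts_def)

lemma length_\<sigma>_pos: "0 < length (\<sigma> a)"
  by (cases a) simp_all

lemma \<sigma>_inj: "\<sigma> a = \<sigma> b \<Longrightarrow> a = b"
  by (cases a; cases b) simp_all

lemma \<sigma>_word_simps [simp]:
  "\<sigma>_word [] = []" "\<sigma>_word (a # w) = \<sigma> a @ \<sigma>_word w" "\<sigma>_word (w @ w') = \<sigma>_word w @ \<sigma>_word w'"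
  by (simp_all add: \<sigma>_word_def)

lemma \<sigma>_word_head: "\<sigma>_word w = [] \<or> starts (hd (\<sigma>_word w))"
proof (cases w)
  case (Cons a vs)
  then show ?thesis by (cases rule: \<sigma>_cases[of a]) simp_all
qed simp

text \<open>A cut before a starting letter cannot fall inside a block, since the second letter of a
  block never starts one.\<close>

lemma \<sigma>_word_cut:
  "\<sigma>_word vs = A @ U \<Longrightarrow> U = [] \<or> starts (hd U)
    \<Longrightarrow> \<exists>v1 v2. vs = v1 @ v2 \<and> A = \<sigma>_word v1 \<and> U = \<sigma>_word v2"
proof (induction vs arbitrary: A)
  case Nil
  then show ?case by simp
next
  case (Cons a vs)
  show ?case
  proof (cases "A = []")
    case True
    then show ?thesis using Cons.prems by (intro exI[of _ "[]"] exI[of _ "a # vs"]) simp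
  next
    case False
    then obtain x A' where A: "A = x # A'" by (cases A) auto
    have "\<exists>A''. A = \<sigma> a @ A''"
    proof (cases rule: \<sigma>_cases[of a])
      case (1 b)
      then show ?thesis using Cons.prems A by auto
    next
      case (2 b c)
      then show ?thesis using Cons.prems A by (cases A') auto
    qed
    then obtain A'' where A'': "A = \<sigma> a @ A''" by blast
    then have "\<sigma>_word vs = A'' @ U" using Cons.prems by simp
    from Cons.IH[OF this Cons.prems(2)] obtain v1 v2 where "vs = v1 @ v2" "A'' = \<sigma>_word v1" "U = \<sigma>_word v2"
      by blast
    then show ?thesis using A'' by (intro exI[of _ "a # v1"] exI[of _ v2]) simp
  qed
qed

lemma \<sigma>_word_inj: "\<sigma>_word vs = \<sigma>_word w \<Longrightarrow> vs = w"
proof (induction vs arbitrary: w)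
  case Nil
  then show ?case using length_\<sigma>_pos by (cases w) auto
next
  case (Cons a vs)
  then obtain b w' where w: "w = b # w'" using length_\<sigma>_pos[of a] by (cases w) auto
  have e: "\<sigma> a @ \<sigma>_word vs = \<sigma> b @ \<sigma>_word w'" using Cons.prems w by simp
  have "\<sigma> a = \<sigma> b"
  proof (cases rule: \<sigma>_cases[of a])
    case a1: (1 x)
    show ?thesis
    proof (cases rule: \<sigma>_cases[of b])
      case (1 y)
      then show ?thesis using e a1 by simp
    next
      case (2 y c)
      then show ?thesis using e a1 \<sigma>_word_head[of vs] by auto
    qed
  next
    case a2: (2 x c)
    show ?thesis
    proof (cases rule: \<sigma>_cases[of b])
      case (1 y)
      then show ?thesis using e a2 \<sigma>_word_head[of w'] by (cases "\<sigma>_word w'") auto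
    next
      case (2 y c)
      then show ?thesis using e a2 by auto
    qed
  qed
  then show ?case using e Cons.IH[of w'] w \<sigma>_inj by simp
qed

text \<open>The extra starting letter certifies that the last block is complete: the image of 8,
  namely 2, is also the beginning of the image of 7.\<close>

lemma sublist_\<sigma>_word_cut:
  assumes "sublist (\<sigma>_word w @ [x]) (\<sigma>_word vs)" "starts x"
  shows "sublist w vs"
proof -
  obtain A B where AB: "\<sigma>_word vs = A @ (\<sigma>_word w @ [x]) @ B" using assms(1) by (auto simp: sublist_def)
  have "hd (\<sigma>_word w @ [x] @ B) = (if \<sigma>_word w = [] then x else hd (\<sigma>_word w))" by simp
  then have "starts (hd (\<sigma>_word w @ [x] @ B))" using \<sigma>_word_head[of w] assms(2) by auto
  then obtain v1 v2 where vs: "vs = v1 @ v2" "\<sigma>_word w @ [x] @ B = \<sigma>_word v2"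
    using \<sigma>_word_cut[of vs A "\<sigma>_word w @ [x] @ B"] AB by auto
  then obtain v3 v4 where "v2 = v3 @ v4" "\<sigma>_word w = \<sigma>_word v3"
    using \<sigma>_word_cut[of v2 "\<sigma>_word w" "[x] @ B"] assms(2) by auto
  then have "vs = v1 @ w @ v4" using vs \<sigma>_word_inj by simp
  then show ?thesis by (auto simp: sublist_def)
qed

lemma sublist_pair_\<sigma>_word:
  assumes "sublist [x, y] (\<sigma>_word vs)"
  shows "\<not> starts y \<Longrightarrow> starts x \<and> (\<exists>a. \<sigma> a = [x, y])"
    and "starts x \<Longrightarrow> starts y \<Longrightarrow> \<exists>a. \<sigma> a = [x]"
proof -
  have "(\<not> starts y \<longrightarrow> starts x \<and> (\<exists>a. \<sigma> a = [x, y])) \<and> (starts x \<longrightarrow> starts y \<longrightarrow> (\<exists>a. \<sigma> a = [x]))"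
    using assms
  proof (induction vs)
    case Nil
    then show ?case by simp
  next
    case (Cons a vs)
    obtain A B where AB: "\<sigma> a @ \<sigma>_word vs = A @ x # y # B" using Cons.prems by (auto simp: sublist_def)
    show ?case
    proof (cases "A = []")
      case True
      show ?thesis
      proof (cases rule: \<sigma>_cases[of a])
        case (1 b)
        then show ?thesis using AB True \<sigma>_word_head[of vs] by auto
      next
        case (2 b c)
        then show ?thesis using AB True by auto
      qed
    next
      case False
      then obtain z A' where A: "A = z # A'" by (cases A) auto
      show ?thesis
      proof (cases "\<sigma>_word vs = A' @ x # y # B")
        case True
        then show ?thesis using Cons.IH by (auto simp: sublist_def)
      next
        case f: False
        show ?thesis
        proof (cases rule: \<sigma>_cases[of a])
          case (1 b)
          then show ?thesis using AB A f by auto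
        next
          case (2 b c)
          show ?thesis
          proof (cases A')
            case Nil
            then show ?thesis using AB A 2 \<sigma>_word_head[of vs] by auto
          next
            case (Cons u A'')
            then have "\<sigma>_word vs = A'' @ x # y # B" using AB A 2 by simp
            then show ?thesis using Cons.IH by (auto simp: sublist_def)
          qed
        qed
      qed
    qed
  qed
  then show "\<not> starts y \<Longrightarrow> starts x \<and> (\<exists>a. \<sigma> a = [x, y])" "starts x \<Longrightarrow> starts y \<Longrightarrow> \<exists>a. \<sigma> a = [x]"
    by auto
qed

text \<open>\<open>pos j\<close> is the position in \<open>\<omega>\<close> at which the block \<open>\<sigma> (\<omega>' j)\<close> starts.\<close>

definition derives :: "(int \<Rightarrow> letter) \<Rightarrow> (int \<Rightarrow> letter) \<Rightarrow> (int \<Rightarrow> int) \<Rightarrow> bool" where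
  "derives \<omega>' \<omega> pos \<longleftrightarrow> (\<forall>j. pos (j + 1) = pos j + int (length (\<sigma> (\<omega>' j)))
     \<and> (\<forall>r < length (\<sigma> (\<omega>' j)). \<omega> (pos j + int r) = \<sigma> (\<omega>' j) ! r))"

lemma derivesD:
  assumes "derives \<omega>' \<omega> pos"
  shows "pos (j + 1) = pos j + int (length (\<sigma> (\<omega>' j)))"
    and "r < length (\<sigma> (\<omega>' j)) \<Longrightarrow> \<omega> (pos j + int r) = \<sigma> (\<omega>' j) ! r"
  using assms unfolding derives_def by blast+

lemma derives_block:
  assumes "derives \<omega>' \<omega> pos"
  shows "\<sigma> (\<omega>' j) = [\<omega> (pos j)] \<and> pos (j + 1) = pos j + 1 \<and> starts (\<omega> (pos j))
    \<or> \<sigma> (\<omega>' j) = [\<omega> (pos j), \<omega> (pos j + 1)] \<and> pos (j + 1) = pos j + 2 \<and> starts (\<omega> (pos j)) \<and> \<not> starts (\<omega> (pos j + 1))"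
proof (cases rule: \<sigma>_cases[of "\<omega>' j"])
  case (1 b)
  then show ?thesis using derivesD(1)[OF assms, of j] derivesD(2)[OF assms, of 0 j] by simp
next
  case (2 b c)
  then show ?thesis
    using derivesD(1)[OF assms, of j] derivesD(2)[OF assms, of 0 j] derivesD(2)[OF assms, of 1 j] by simp
qed

lemma derives_pos_diff:
  assumes "derives \<omega>' \<omega> pos" "i \<le> j"
  shows "j - i \<le> pos j - pos i"
  using assms(2)
proof (induction rule: int_ge_induct)
  case (step j)
  then show ?case using derives_block[OF assms(1), of j] by auto
qed simp

lemma derives_pos_mono: "derives \<omega>' \<omega> pos \<Longrightarrow> i \<le> j \<Longrightarrow> pos i \<le> pos j"
  using derives_pos_diff by fastforce

lemma derives_unique:
  assumes d: "derives \<omega>1 \<omega> pos1" "derives \<omega>2 \<omega> pos2" and "pos1 0 = pos2 0"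
  shows "\<omega>1 = \<omega>2" "pos1 = pos2"
proof -
  have pos: "pos1 j = pos2 j" for j
  proof (induction j rule: int_induct[where k = 0])
    case base
    then show ?case by fact
  next
    case (step1 i)
    then show ?case using derives_block[OF d(1), of i] derives_block[OF d(1), of "i + 1"]
      derives_block[OF d(2), of i] derives_block[OF d(2), of "i + 1"] by auto
  next
    case (step2 i)
    have "pos1 (i - 1) + 1 = pos2 (i - 1) \<or> pos1 (i - 1) = pos2 (i - 1) \<or> pos1 (i - 1) = pos2 (i - 1) + 1"
      using step2 derives_block[OF d(1), of "i - 1"] derives_block[OF d(2), of "i - 1"] by auto
    then show ?case using step2 derives_block[OF d(1), of "i - 1"] derives_block[OF d(2), of "i - 1"]
      by (elim disjE) auto
  qed
  then show "pos1 = pos2" by blast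
  have "\<sigma> (\<omega>1 j) = \<sigma> (\<omega>2 j)" for j
    using derives_block[OF d(1), of j] derives_block[OF d(2), of j] pos[of j] pos[of "j + 1"] by auto
  then show "\<omega>1 = \<omega>2" using \<sigma>_inj by blast
qed

lemma derives_shift:
  assumes "derives \<omega>' \<omega> pos"
  shows "derives (\<lambda>i. \<omega>' (i + j)) (\<lambda>i. \<omega> (i + k)) (\<lambda>i. pos (i + j) - k)"
  unfolding derives_def
proof (intro allI conjI impI)
  fix i
  show "pos (i + 1 + j) - k = pos (i + j) - k + int (length (\<sigma> (\<omega>' (i + j))))"
    using derivesD(1)[OF assms, of "i + j"] by (simp add: algebra_simps)
  fix r assume "r < length (\<sigma> (\<omega>' (i + j)))"
  then show "\<omega> (pos (i + j) - k + int r + k) = \<sigma> (\<omega>' (i + j)) ! r"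
    using derivesD(2)[OF assms, of r "i + j"] by (simp add: algebra_simps)
qed

text \<open>Putting the origin inside block 0 removes the freedom to shift the desubstituted
  sequence and makes it unique.\<close>

definition centred :: "(int \<Rightarrow> letter) \<Rightarrow> (int \<Rightarrow> letter) \<Rightarrow> (int \<Rightarrow> int) \<Rightarrow> bool" where
  "centred \<omega>' \<omega> pos \<longleftrightarrow> derives \<omega>' \<omega> pos \<and> pos 0 \<le> 0 \<and> 0 < pos 1"

lemma centred_pos_0: "centred \<omega>' \<omega> pos \<Longrightarrow> pos 0 = (if starts (\<omega> 0) then 0 else - 1)"
proof -
  assume c: "centred \<omega>' \<omega> pos"
  then have b: "\<sigma> (\<omega>' 0) = [\<omega> (pos 0)] \<and> pos 1 = pos 0 + 1 \<and> starts (\<omega> (pos 0))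
    \<or> \<sigma> (\<omega>' 0) = [\<omega> (pos 0), \<omega> (pos 0 + 1)] \<and> pos 1 = pos 0 + 2 \<and> starts (\<omega> (pos 0)) \<and> \<not> starts (\<omega> (pos 0 + 1))"
    using derives_block[of \<omega>' \<omega> pos 0] unfolding centred_def by simp
  then have "pos 0 = 0 \<or> pos 0 = - 1" using c unfolding centred_def by auto
  then show ?thesis using b c unfolding centred_def by auto
qed

lemma centred_unique:
  assumes "centred \<omega>1 \<omega> pos1" "centred \<omega>2 \<omega> pos2"
  shows "\<omega>1 = \<omega>2" "pos1 = pos2"
  using derives_unique[of \<omega>1 \<omega> pos1 \<omega>2 pos2] centred_pos_0[OF assms(1)] centred_pos_0[OF assms(2)] assms
  unfolding centred_def by auto

lemma derives_block_exists:
  assumes "derives \<omega>' \<omega> pos"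
  shows "\<exists>j. pos j \<le> k \<and> k < pos (j + 1)"
proof -
  define i where "i = - \<bar>k - pos 0\<bar> - 1"
  have "0 - i \<le> pos 0 - pos i" by (rule derives_pos_diff[OF assms]) (simp add: i_def)
  then have i: "pos i \<le> k" unfolding i_def by linarith
  define m where "m = nat (k + 1 - pos i)"
  have "i + int m - i \<le> pos (i + int m) - pos i" by (rule derives_pos_diff[OF assms]) simp
  then have m: "pos (i + int m) > k" using i unfolding m_def by simp
  define l where "l = (LEAST m. pos (i + int m) > k)"
  have l: "pos (i + int l) > k" unfolding l_def by (rule LeastI[of _ m]) fact
  then obtain l' where l': "l = Suc l'" using i by (cases l) auto
  have "\<not> pos (i + int l') > k" using not_less_Least[of l' "\<lambda>m. pos (i + int m) > k"] l' l_def by auto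
  then show ?thesis using l l' by (intro exI[of _ "i + int l'"]) (auto simp: algebra_simps)
qed

lemma derives_block_unique:
  assumes "derives \<omega>' \<omega> pos" "pos i \<le> k" "k < pos (i + 1)" "pos j \<le> k" "k < pos (j + 1)"
  shows "i = j"
proof (rule ccontr)
  assume "i \<noteq> j"
  then have "i + 1 \<le> j \<or> j + 1 \<le> i" by linarith
  then show False using derives_pos_mono[OF assms(1), of "i + 1" j] derives_pos_mono[OF assms(1), of "j + 1" i] assms
    by linarith
qed

lemma derives_window:
  assumes "derives \<omega>' \<omega> pos" "i \<le> j"
  shows "map \<omega> [pos i..pos (j + 1) - 1] = \<sigma>_word (map \<omega>' [i..j])"
  using assms(2)
proof (induction rule: int_ge_induct)
  case base
  have "[pos i..pos (i + 1) - 1] = (if pos (i + 1) = pos i + 1 then [pos i] else [pos i, pos i + 1])"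
    using derives_block[OF assms(1), of i] by (auto simp: upto_rec1)
  then show ?case using derives_block[OF assms(1), of i] by auto
next
  case (step j)
  have 1: "pos i \<le> pos (j + 1)" "pos (j + 1) \<le> pos (j + 1 + 1) - 1"
    using derives_pos_diff[OF assms(1), of i "j + 1"] derives_pos_diff[OF assms(1), of "j + 1" "j + 1 + 1"] step by simp_all
  have 2: "[pos i..pos (j + 1 + 1) - 1] = [pos i..pos (j + 1) - 1] @ [pos (j + 1)..pos (j + 1 + 1) - 1]"
    using upto_split1[OF 1] .
  have 3: "[pos (j + 1)..pos (j + 1 + 1) - 1]
      = (if pos (j + 1 + 1) = pos (j + 1) + 1 then [pos (j + 1)] else [pos (j + 1), pos (j + 1) + 1])"
    using derives_block[OF assms(1), of "j + 1"] by (auto simp: upto_rec1)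
  have 4: "[i..j + 1] = [i..j] @ [j + 1]" using upto_rec2[of i "j + 1"] step by simp
  show ?case unfolding 2 4 map_append step.IH \<sigma>_word_simps(3) 3
    using derives_block[OF assms(1), of "j + 1"] by auto
qed

lemma \<Omega>_pair:
  assumes "\<omega> \<in> \<Omega>"
  shows "\<not> starts (\<omega> (k + 1)) \<Longrightarrow> starts (\<omega> k) \<and> (\<exists>a. \<sigma> a = [\<omega> k, \<omega> (k + 1)])"
    and "starts (\<omega> k) \<Longrightarrow> starts (\<omega> (k + 1)) \<Longrightarrow> \<exists>a. \<sigma> a = [\<omega> k]"
proof -
  obtain n a where na: "sublist (map \<omega> [k..k + 1]) ((\<sigma>_word ^^ n) [a])"
    using assms unfolding \<Omega>_def by blast
  have "[k..k + 1] = [k, k + 1]" by (simp add: upto_rec1)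
  then have s: "sublist [\<omega> k, \<omega> (k + 1)] ((\<sigma>_word ^^ n) [a])" using na by simp
  have "n \<noteq> 0"
  proof
    assume "n = 0"
    then show False using sublist_length_le[OF s] by simp
  qed
  then obtain m where "n = Suc m" by (cases n) auto
  then have s: "sublist [\<omega> k, \<omega> (k + 1)] (\<sigma>_word ((\<sigma>_word ^^ m) [a]))" using s by simp
  show "\<not> starts (\<omega> (k + 1)) \<Longrightarrow> starts (\<omega> k) \<and> (\<exists>a. \<sigma> a = [\<omega> k, \<omega> (k + 1)])"
    "starts (\<omega> k) \<Longrightarrow> starts (\<omega> (k + 1)) \<Longrightarrow> \<exists>a. \<sigma> a = [\<omega> k]"
    using sublist_pair_\<sigma>_word[OF s] by blast+
qed

lemma \<Omega>_centred:
  assumes "\<omega> \<in> \<Omega>"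
  obtains \<omega>' pos where "\<omega>' \<in> \<Omega>" "centred \<omega>' \<omega> pos"
proof -
  \<comment> \<open>Blocks have length one or two, so the next and the previous block start are at
    distance one or two.\<close>
  define nx where "nx k = (if starts (\<omega> (k + 1)) then k + 1 else k + 2)" for k
  define pv where "pv k = (if starts (\<omega> (k - 1)) then k - 1 else k - 2)" for k
  define p0 :: int where "p0 = (if starts (\<omega> 0) then 0 else - 1)"
  define pos where "pos j = (if 0 \<le> j then (nx ^^ nat j) p0 else (pv ^^ nat (- j)) p0)" for j
  note P = \<Omega>_pair(1)[OF assms]
  have snx: "starts (\<omega> (nx k))" for k
    using P[of "k + 1"] unfolding nx_def by (auto simp: add.assoc)
  have spv: "starts (\<omega> (pv k))" for k
    using P[of "k - 2"] unfolding pv_def by auto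
  have sp0: "starts (\<omega> p0)" using P[of "- 1"] unfolding p0_def by auto
  have nxpv: "nx (pv k) = k" if "starts (\<omega> k)" for k
    using that unfolding nx_def pv_def by auto
  have spos: "starts (\<omega> (pos j))" for j
  proof (cases "0 \<le> j")
    case True
    then show ?thesis unfolding pos_def using sp0 snx by (cases "nat j") auto
  next
    case False
    then show ?thesis unfolding pos_def using spv by (cases "nat (- j)") auto
  qed
  have pos1: "pos (j + 1) = nx (pos j)" for j
  proof (cases "0 \<le> j")
    case True
    then have "nat (j + 1) = Suc (nat j)" by simp
    then show ?thesis unfolding pos_def using True by simp
  next
    case False
    then have n: "nat (- j) = Suc (nat (- (j + 1)))" by simp
    have "pos j = pv ((pv ^^ nat (- (j + 1))) p0)" unfolding pos_def using False n by simp
    moreover have "(pv ^^ nat (- (j + 1))) p0 = pos (j + 1)"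
      using False unfolding pos_def by (cases "j + 1 = 0") auto
    ultimately show ?thesis using nxpv[OF spos[of "j + 1"]] by simp
  qed
  define block where "block j = (if starts (\<omega> (pos j + 1)) then [\<omega> (pos j)] else [\<omega> (pos j), \<omega> (pos j + 1)])" for j
  define \<omega>' where "\<omega>' j = (SOME a. \<sigma> a = block j)" for j
  have bl: "\<sigma> (\<omega>' j) = block j" for j
    unfolding \<omega>'_def by (rule someI_ex) (use \<Omega>_pair[OF assms, of "pos j"] spos[of j] in \<open>auto simp: block_def\<close>)
  have d: "derives \<omega>' \<omega> pos"
    unfolding derives_def bl pos1 by (auto simp: block_def nx_def less_Suc_eq)
  have c: "centred \<omega>' \<omega> pos"
    unfolding centred_def using d pos1[of 0] sp0 unfolding pos_def p0_def nx_def by auto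
  have "\<exists>n a. sublist (map \<omega>' [i..j]) ((\<sigma>_word ^^ n) [a])" for i j
  proof (cases "i \<le> j")
    case False
    then show ?thesis by simp
  next
    case True
    \<comment> \<open>The window reaches one letter beyond the last block, providing the guard for
      \<open>sublist_\<sigma>_word_cut\<close>. Having at least two letters, it also forces
      \<open>n\<close> to be positive, so one substitution can be removed.\<close>
    obtain n a where na: "sublist (map \<omega> [pos i..pos (j + 1)]) ((\<sigma>_word ^^ n) [a])"
      using assms unfolding \<Omega>_def by blast
    have "pos i < pos (j + 1)" using derives_pos_diff[OF d, of i "j + 1"] True by simp
    then have "[pos i..pos (j + 1)] = [pos i..pos (j + 1) - 1] @ [pos (j + 1)]"
      using upto_rec2[of "pos i" "pos (j + 1)"] by simp
    then have s: "sublist (\<sigma>_word (map \<omega>' [i..j]) @ [\<omega> (pos (j + 1))]) ((\<sigma>_word ^^ n) [a])"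
      using na derives_window[OF d True] by simp
    have "[i..j] \<noteq> []" using True by simp
    then obtain u us where us: "map \<omega>' [i..j] = u # us" by (cases "map \<omega>' [i..j]") auto
    have "length (\<sigma>_word (map \<omega>' [i..j])) > 0" unfolding us using length_\<sigma>_pos[of u] by simp
    then have "length ((\<sigma>_word ^^ n) [a]) > 1" using sublist_length_le[OF s]
      by (simp only: length_append list.size)
    then have "n \<noteq> 0" by (cases n) auto
    then obtain m where m: "n = Suc m" by (cases n) auto
    have "sublist (map \<omega>' [i..j]) ((\<sigma>_word ^^ m) [a])"
      by (rule sublist_\<sigma>_word_cut[OF _ spos]) (use s m in simp)
    then show ?thesis by blast
  qed
  then have "\<omega>' \<in> \<Omega>" unfolding \<Omega>_def by blast
  then show thesis using that c by blast
qed

section \<open>Desubstitution chains\<close>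

lemma seq_sum_0 [simp]: "seq_sum \<gamma> \<omega> 0 = 0"
  by (simp add: seq_sum_def)

lemma seq_sum_Suc: "seq_sum \<gamma> \<omega> (k + 1) = seq_sum \<gamma> \<omega> k + \<gamma> $ \<omega> k"
proof -
  consider "0 \<le> k" | "k = - 1" | "k < - 1" by linarith
  then show ?thesis
  proof cases
    case 1
    then show ?thesis using upto_rec2[of 0 k] by (simp add: seq_sum_def)
  next
    case 2
    then show ?thesis by (simp add: seq_sum_def upto_rec1)
  next
    case 3
    then show ?thesis using upto_rec1[of k "- 1"] by (simp add: seq_sum_def)
  qed
qed

lemma seq_sum_block:
  assumes "derives \<omega>' \<omega> pos" "r \<le> length (\<sigma> (\<omega>' j))"
  shows "seq_sum \<gamma> \<omega> (pos j + int r) = seq_sum \<gamma> \<omega> (pos j) + word_sum \<gamma> (take r (\<sigma> (\<omega>' j)))"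
  using assms(2)
proof (induction r)
  case (Suc r)
  have "seq_sum \<gamma> \<omega> (pos j + int (Suc r)) = seq_sum \<gamma> \<omega> (pos j + int r) + \<gamma> $ \<omega> (pos j + int r)"
    using seq_sum_Suc[of \<gamma> \<omega> "pos j + int r"] by (simp add: algebra_simps)
  then show ?case using Suc derivesD(2)[OF assms(1), of r j] by (simp add: take_Suc_conv_app_nth)
qed simp

lemma seq_sum_derives:
  assumes "derives \<omega>' \<omega> pos"
  shows "seq_sum \<Gamma> \<omega> (pos j) = \<beta> * seq_sum \<Gamma> \<omega>' j + seq_sum \<Gamma> \<omega> (pos 0)"
proof -
  have step: "seq_sum \<Gamma> \<omega> (pos (i + 1)) = seq_sum \<Gamma> \<omega> (pos i) + \<beta> * \<Gamma> $ \<omega>' i" for i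
    using seq_sum_block[OF assms order_refl, of \<Gamma> i] derivesD(1)[OF assms, of i] word_sum_\<sigma>[of "\<omega>' i"] by simp
  show ?thesis
  proof (induction j rule: int_induct[where k = 0])
    case base
    show ?case by simp
  next
    case (step1 i)
    then show ?case using step[of i] seq_sum_Suc[of \<Gamma> \<omega>' i] by (simp add: algebra_simps)
  next
    case (step2 i)
    then show ?case using step[of "i - 1"] seq_sum_Suc[of \<Gamma> \<omega>' "i - 1"] by (simp add: algebra_simps)
  qed
qed

locale desubstitution_chain =
  fixes W :: "nat \<Rightarrow> int \<Rightarrow> letter" and pos :: "nat \<Rightarrow> int \<Rightarrow> int"
  assumes centred: "centred (W (Suc n)) (W n) (pos n)"
begin

lemma derives: "derives (W (Suc n)) (W n) (pos n)"
  and pos_0: "pos n 0 \<le> 0" and pos_1: "0 < pos n 1"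
  using centred unfolding centred_def by blast+

lemma pos_0_eq: "pos n 0 = (if starts (W n 0) then 0 else - 1)"
  by (rule centred_pos_0[OF centred])

lemma shifted_chain: "desubstitution_chain (\<lambda>n. W (n + m)) (\<lambda>n. pos (n + m))"
  by unfold_locales (use centred in simp)

definition block :: "nat \<Rightarrow> int \<Rightarrow> int" where
  "block n k = (THE j. pos n j \<le> k \<and> k < pos n (j + 1))"

lemma block_unique: "pos n j \<le> k \<Longrightarrow> k < pos n (j + 1) \<Longrightarrow> block n k = j"
  unfolding block_def using derives_block_unique[OF derives] by blast

lemma block: "pos n (block n k) \<le> k" "0 < pos n (block n k + 1) - k"
proof -
  obtain j where j: "pos n j \<le> k" "k < pos n (j + 1)" using derives_block_exists[OF derives] by blast
  show "pos n (block n k) \<le> k" "0 < pos n (block n k + 1) - k" using j block_unique[OF j] by simp_all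
qed

lemma block_0: "block n 0 = 0"
  by (rule block_unique) (use pos_0 pos_1 in simp_all)

text \<open>Passing to blocks never moves away from 0, and moves strictly closer if the block at the
  origin extends to the right; \<open>block_neg\<close> is the left-hand counterpart.\<close>

lemma block_nonneg:
  assumes "0 \<le> k" shows "0 \<le> block n k" "block n k \<le> k" "0 < k \<Longrightarrow> 1 < pos n 1 \<Longrightarrow> block n k < k"
proof -
  show nn: "0 \<le> block n k"
  proof (rule ccontr)
    assume "\<not> 0 \<le> block n k"
    then have "pos n (block n k + 1) \<le> pos n 0" by (intro derives_pos_mono[OF derives]) simp
    then show False using block(2)[of n k] pos_0[of n] assms by linarith
  qed
  have "block n k = 0 \<or> block n k - 1 \<le> pos n (block n k) - pos n 1"
    using derives_pos_diff[OF derives, of 1 "block n k" n] nn by linarith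
  then show "block n k \<le> k" "0 < k \<Longrightarrow> 1 < pos n 1 \<Longrightarrow> block n k < k"
    using block(1)[of n k] pos_1[of n] assms by linarith+
qed

lemma block_neg:
  assumes "k < 0" shows "block n k \<le> 0" "k \<le> block n k" "pos n 0 < 0 \<Longrightarrow> k < block n k"
proof -
  show nn: "block n k \<le> 0"
  proof (rule ccontr)
    assume "\<not> block n k \<le> 0"
    then have "pos n 1 \<le> pos n (block n k)" by (intro derives_pos_mono[OF derives]) simp
    then show False using block(1)[of n k] pos_1[of n] assms by linarith
  qed
  have "block n k = 0 \<or> 0 - (block n k + 1) \<le> pos n 0 - pos n (block n k + 1)"
    using derives_pos_diff[OF derives, of "block n k + 1" 0 n] nn by linarith
  then show "k \<le> block n k" "pos n 0 < 0 \<Longrightarrow> k < block n k"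
    using block(2)[of n k] pos_0[of n] assms by linarith+
qed

text \<open>The index in \<open>W n\<close> of the letter whose n-fold image covers position
  \<open>k\<close> of \<open>W 0\<close>.\<close>

primrec ancestor :: "int \<Rightarrow> nat \<Rightarrow> int" where
  "ancestor k 0 = k"
| "ancestor k (Suc n) = block n (ancestor k n)"

lemma ancestor_stays: "ancestor k n = 0 \<Longrightarrow> n \<le> m \<Longrightarrow> ancestor k m = 0"
  by (induction m) (auto simp: le_Suc_eq block_0)

definition prefix_at :: "nat \<Rightarrow> int \<Rightarrow> word" where
  "prefix_at n k = take (nat (k - pos n (block n k))) (\<sigma> (W (Suc n) (block n k)))"

lemma prefix_label:
  "(prefix_at n k, W n k, drop (Suc (nat (k - pos n (block n k)))) (\<sigma> (W (Suc n) (block n k)))) \<in> labels (W (Suc n) (block n k))"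
proof -
  define r where "r = nat (k - pos n (block n k))"
  have r: "k = pos n (block n k) + int r" using block(1)[of n k] unfolding r_def by simp
  have l: "r < length (\<sigma> (W (Suc n) (block n k)))"
    using block[of n k] derivesD(1)[OF derives[of n], of "block n k"] unfolding r_def by simp
  have "W n k = \<sigma> (W (Suc n) (block n k)) ! r" using derivesD(2)[OF derives[of n] l] r by simp
  then show ?thesis unfolding prefix_at_def r_def[symmetric] labels_def using id_take_nth_drop[OF l] by simp
qed

text \<open>Sums start at the origin rather than at its block start, hence the subtraction of the
  origin's own prefix.\<close>

lemma seq_sum_parent:
  "seq_sum \<Gamma> (W n) k = \<beta> * seq_sum \<Gamma> (W (Suc n)) (block n k) + word_sum \<Gamma> (prefix_at n k) - word_sum \<Gamma> (prefix_at n 0)"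
proof -
  have s: "seq_sum \<Gamma> (W n) k = seq_sum \<Gamma> (W n) (pos n (block n k)) + word_sum \<Gamma> (prefix_at n k)" for k
  proof -
    define r where "r = nat (k - pos n (block n k))"
    have r: "k = pos n (block n k) + int r" using block(1)[of n k] unfolding r_def by simp
    have l: "r \<le> length (\<sigma> (W (Suc n) (block n k)))"
      using block[of n k] derivesD(1)[OF derives[of n], of "block n k"] unfolding r_def by simp
    show ?thesis using seq_sum_block[OF derives[of n] l, of \<Gamma>] r unfolding prefix_at_def r_def[symmetric] by simp
  qed
  show ?thesis using s[of k] s[of 0] seq_sum_derives[OF derives[of n], of "block n k"] unfolding block_0 by (simp add: eq_neg_iff_add_eq_0)
qed

lemma position_of_label:
  assumes "(p, c, s) \<in> labels (W (Suc n) j)"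
  obtains k where "block n k = j" "W n k = c" "prefix_at n k = p"
proof -
  have e: "\<sigma> (W (Suc n) j) = p @ c # s" using assms unfolding labels_def by simp
  define k where "k = pos n j + int (length p)"
  have b: "block n k = j"
    by (rule block_unique) (use derivesD(1)[OF derives[of n], of j] e in \<open>auto simp: k_def\<close>)
  show thesis
  proof (rule that[OF b])
    show "W n k = c" using derivesD(2)[OF derives[of n], of "length p" j] e unfolding k_def by simp
    show "prefix_at n k = p" unfolding prefix_at_def b using e by (simp add: k_def)
  qed
qed

text \<open>\<open>T n\<close> is the walk from the start of the n-fold image at the origin to the
  origin itself. Each minimum is attained at an actual position of \<open>W 0\<close>, so minimality
  gives \<open>T n \<le> minwalk z n (W n 0)\<close>; the recursion gives the reverse inequality.
  Equality at consecutive levels is the claim.\<close>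

lemma optimal_if_minimal:
  assumes "\<And>k. 0 \<le> Re (z * seq_sum \<Gamma> (W 0) k)"
  shows "minwalk z (Suc n) (W (Suc n) 0) = cost z n (prefix_at n 0) + minwalk z n (W n 0)"
proof -
  define T where "T n = (\<Sum>m<n. cost z m (prefix_at m 0))" for n
  have ex: "\<exists>k. Re (z * seq_sum \<Gamma> (W 0) k) = Re (z * \<beta> ^ n * seq_sum \<Gamma> (W n) j) + minwalk z n (W n j) - T n" for n j
  proof (induction n arbitrary: j)
    case 0
    then show ?case by (intro exI[of _ j]) (simp add: T_def)
  next
    case (Suc n)
    obtain p c s where l: "(p, c, s) \<in> labels (W (Suc n) j)" "minwalk z (Suc n) (W (Suc n) j) = cost z n p + minwalk z n c"
      using minwalk_attained[of "W (Suc n) j" z n] by blast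
    obtain i where i: "block n i = j" "W n i = c" "prefix_at n i = p" by (rule position_of_label[OF l(1)])
    obtain k where "Re (z * seq_sum \<Gamma> (W 0) k) = Re (z * \<beta> ^ n * seq_sum \<Gamma> (W n) i) + minwalk z n (W n i) - T n"
      using Suc.IH by blast
    moreover have "Re (z * \<beta> ^ n * seq_sum \<Gamma> (W n) i)
        = Re (z * \<beta> ^ Suc n * seq_sum \<Gamma> (W (Suc n)) j) + cost z n p - cost z n (prefix_at n 0)"
    proof -
      have "z * \<beta> ^ n * seq_sum \<Gamma> (W n) i = z * \<beta> ^ Suc n * seq_sum \<Gamma> (W (Suc n)) j
          + z * \<beta> ^ n * word_sum \<Gamma> p - z * \<beta> ^ n * word_sum \<Gamma> (prefix_at n 0)"
        unfolding seq_sum_parent[of n i] i by (simp add: algebra_simps)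
      then show ?thesis unfolding cost_def by (simp only: plus_complex.sel minus_complex.sel)
    qed
    ultimately show ?case using l(2) i(2) by (intro exI[of _ k]) (simp add: T_def)
  qed
  have ge: "T n \<le> minwalk z n (W n 0)" for n
  proof -
    obtain k where "Re (z * seq_sum \<Gamma> (W 0) k) = Re (z * \<beta> ^ n * seq_sum \<Gamma> (W n) 0) + minwalk z n (W n 0) - T n"
      using ex by blast
    then show ?thesis using assms[of k] by simp
  qed
  have le: "minwalk z (Suc n) (W (Suc n) 0) \<le> cost z n (prefix_at n 0) + minwalk z n (W n 0)" for n
    using minwalk_le[OF prefix_label[of n 0]] unfolding block_0 .
  have "minwalk z n (W n 0) = T n" for n
  proof (induction n)
    case 0
    show ?case by (simp add: T_def)
  next
    case (Suc n)
    then show ?case using ge[of "Suc n"] le[of n] by (simp add: T_def del: minwalk.simps)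
  qed
  then show ?thesis by (simp add: T_def del: minwalk.simps)
qed

text \<open>Substitution carries a shift to a shift. A disagreement about the labels below level
  \<open>m\<close> only moves the origin.\<close>

lemma same_orbit_from_level:
  assumes "desubstitution_chain W' pos'" and "W' m = (\<lambda>i. W m (i + j))"
  shows "\<exists>k. W' 0 = (\<lambda>i. W 0 (i + k))"
  using assms(2)
proof (induction m arbitrary: j)
  case 0
  then show ?case by blast
next
  case (Suc m)
  interpret W': desubstitution_chain W' pos' by fact
  have a: "derives (W' (Suc m)) (W m) (\<lambda>i. pos m (i + j))"
    using derives_shift[OF derives[of m], of j 0] Suc.prems by simp
  have b: "derives (W' (Suc m)) (W' m) (pos' m)" by (rule W'.derives)
  define k where "k = pos m j - pos' m 0"
  have "derives (W' (Suc m)) (\<lambda>i. W m (i + k)) (\<lambda>i. pos m (i + j) - k)"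
    using derives_shift[OF a, of 0 k] by simp
  then have c: "derives (W' (Suc m)) (\<lambda>i. W m (i + k)) (\<lambda>i. pos m (i + j) - k)" .
  have p: "pos m (i + j) - k = pos' m i" for i
  proof (induction i rule: int_induct[where k = 0])
    case base
    show ?case by (simp add: k_def)
  next
    case (step1 i)
    then show ?case using derivesD(1)[OF c, of i] derivesD(1)[OF b, of i] by simp
  next
    case (step2 i)
    then show ?case using derivesD(1)[OF c, of "i - 1"] derivesD(1)[OF b, of "i - 1"] by simp
  qed
  have "W' m i = W m (i + k)" for i
  proof -
    obtain l where l: "pos' m l \<le> i" "i < pos' m (l + 1)" using derives_block_exists[OF b] by blast
    define r where "r = nat (i - pos' m l)"
    have r: "i = pos' m l + int r" "r < length (\<sigma> (W' (Suc m) l))"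
      using l derivesD(1)[OF b, of l] unfolding r_def by simp_all
    show ?thesis using derivesD(2)[OF b r(2)] derivesD(2)[OF c r(2)] r(1) p[of l] by simp
  qed
  then show ?case using Suc.IH[of k] by blast
qed

lemma shift_ancestor:
  assumes "desubstitution_chain W' pos'" and "W' 0 = (\<lambda>i. W 0 (i + k))"
  shows "W' n = (\<lambda>i. W n (i + ancestor k n))"
proof (induction n)
  case 0
  then show ?case using assms(2) by simp
next
  case (Suc n)
  interpret W': desubstitution_chain W' pos' by fact
  have "derives (\<lambda>i. W (Suc n) (i + ancestor k (Suc n))) (W' n) (\<lambda>i. pos n (i + ancestor k (Suc n)) - ancestor k n)"
    unfolding Suc by (rule derives_shift[OF derives])
  moreover have "pos n (0 + ancestor k (Suc n)) - ancestor k n \<le> 0" "0 < pos n (1 + ancestor k (Suc n)) - ancestor k n"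
    using block[of n "ancestor k n"] by (simp_all add: add.commute)
  ultimately have "centred (\<lambda>i. W (Suc n) (i + ancestor k (Suc n))) (W' n) (\<lambda>i. pos n (i + ancestor k (Suc n)) - ancestor k n)"
    unfolding centred_def by blast
  then show ?case using centred_unique(1)[OF W'.centred] by blast
qed

end

text \<open>The two conditions prevent the growing images of the origin letters from covering only a
  half-line; every position is then reached.\<close>

locale full_chain = desubstitution_chain +
  assumes left: "\<exists>m\<ge>n. pos m 0 < 0" and right: "\<exists>m\<ge>n. 1 < pos m 1"
begin

lemma shifted_full: "full_chain (\<lambda>n. W (n + m)) (\<lambda>n. pos (n + m))"
proof -
  interpret s: desubstitution_chain "\<lambda>n. W (n + m)" "\<lambda>n. pos (n + m)" by (rule shifted_chain)
  show ?thesis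
  proof
    fix n
    obtain i where "i \<ge> n + m" "pos i 0 < 0" using left by blast
    then show "\<exists>i\<ge>n. pos (i + m) 0 < 0" by (intro exI[of _ "i - m"]) simp
    obtain i where "i \<ge> n + m" "1 < pos i 1" using right by blast
    then show "\<exists>i\<ge>n. 1 < pos (i + m) 1" by (intro exI[of _ "i - m"]) simp
  qed
qed

lemma ancestor_reaches_0: "\<exists>n. ancestor k n = 0"
proof -
  have "\<exists>m. ancestor k m = 0" if "nat \<bar>ancestor k n\<bar> = d" for n d
    using that
  proof (induction d arbitrary: n rule: less_induct)
    case (less d)
    consider "ancestor k n = 0" | "0 < ancestor k n" | "ancestor k n < 0" by linarith
    then show ?case
    proof cases
      case 1
      then show ?thesis by blast
    next
      case 2
      obtain m where m: "m \<ge> n" "1 < pos m 1" using right by blast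
      have nn: "0 \<le> ancestor k j \<and> ancestor k j \<le> ancestor k n" if "n \<le> j" for j
        using that
      proof (induction j rule: dec_induct)
        case (step j)
        then show ?case using block_nonneg(1,2)[of "ancestor k j" j] by simp
      qed (use 2 in simp)
      show ?thesis
      proof (cases "ancestor k m = 0")
        case False
        then have "0 < ancestor k m" using nn[OF m(1)] by simp
        then have "0 \<le> ancestor k (Suc m) \<and> ancestor k (Suc m) < ancestor k n"
          using block_nonneg(1,3)[of "ancestor k m" m] m(2) nn[OF m(1)] by simp
        then show ?thesis using less.IH[of "nat \<bar>ancestor k (Suc m)\<bar>" "Suc m"] less.prems by auto
      qed blast
    next
      case 3
      obtain m where m: "m \<ge> n" "pos m 0 < 0" using left by blast
      have nn: "ancestor k j \<le> 0 \<and> ancestor k n \<le> ancestor k j" if "n \<le> j" for j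
        using that
      proof (induction j rule: dec_induct)
        case (step j)
        then show ?case using block_neg(1,2)[of "ancestor k j" j] block_0[of j]
          by (cases "ancestor k j = 0") auto
      qed (use 3 in simp)
      show ?thesis
      proof (cases "ancestor k m = 0")
        case False
        then have "ancestor k m < 0" using nn[OF m(1)] by simp
        then have "ancestor k (Suc m) \<le> 0 \<and> ancestor k n < ancestor k (Suc m)"
          using block_neg(1,3)[of "ancestor k m" m] m(2) nn[OF m(1)] by simp
        then show ?thesis using less.IH[of "nat \<bar>ancestor k (Suc m)\<bar>" "Suc m"] less.prems by auto
      qed blast
    qed
  qed
  then show ?thesis by blast
qed

text \<open>\<open>f n\<close> compares the best values in the n-fold images containing
  \<open>k\<close> and the origin. Optimality at the origin makes \<open>f\<close> nonincreasing; it
  starts at the real part in question and vanishes once the two images coincide.\<close>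

lemma minimal_if_optimal:
  assumes opt: "\<And>n. minwalk z (Suc n) (W (Suc n) 0) = cost z n (prefix_at n 0) + minwalk z n (W n 0)"
  shows "0 \<le> Re (z * seq_sum \<Gamma> (W 0) k)"
proof -
  define f where "f n = Re (z * \<beta> ^ n * seq_sum \<Gamma> (W n) (ancestor k n)) + minwalk z n (W n (ancestor k n)) - minwalk z n (W n 0)" for n
  have "f (Suc n) \<le> f n" for n
  proof -
    have "minwalk z (Suc n) (W (Suc n) (block n (ancestor k n)))
        \<le> cost z n (prefix_at n (ancestor k n)) + minwalk z n (W n (ancestor k n))"
      by (rule minwalk_le[OF prefix_label])
    moreover have "z * \<beta> ^ n * seq_sum \<Gamma> (W n) (ancestor k n) = z * \<beta> ^ Suc n * seq_sum \<Gamma> (W (Suc n)) (ancestor k (Suc n))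
          + z * \<beta> ^ n * word_sum \<Gamma> (prefix_at n (ancestor k n)) - z * \<beta> ^ n * word_sum \<Gamma> (prefix_at n 0)"
      unfolding seq_sum_parent[of n "ancestor k n"] by (simp add: algebra_simps)
    then have "Re (z * \<beta> ^ n * seq_sum \<Gamma> (W n) (ancestor k n)) = Re (z * \<beta> ^ Suc n * seq_sum \<Gamma> (W (Suc n)) (ancestor k (Suc n)))
          + cost z n (prefix_at n (ancestor k n)) - cost z n (prefix_at n 0)"
      unfolding cost_def by (simp only: plus_complex.sel minus_complex.sel)
    ultimately show ?thesis unfolding f_def using opt[of n] by (simp del: minwalk.simps)
  qed
  then have "f n \<le> f 0" for n by (rule lift_Suc_antimono_le) simp
  moreover obtain n where "ancestor k n = 0" using ancestor_reaches_0 by blast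
  then have "f n = 0" unfolding f_def by simp
  ultimately show ?thesis unfolding f_def by (metis ancestor.simps(1) add_0_right diff_zero minwalk.simps(1) mult_1_right power_0)
qed

text \<open>Starting from a level where \<open>k\<close> has ancestor 0, agreement on a window
  containing both the origin and the ancestor passes down to the union of the corresponding
  blocks.\<close>

lemma determined_by_letters:
  assumes "desubstitution_chain W' pos'" and eq: "\<And>n. W' n 0 = W n 0"
  shows "W' 0 = W 0"
proof
  fix k
  interpret W': desubstitution_chain W' pos' by fact
  obtain N where N: "ancestor k N = 0" using ancestor_reaches_0 by blast
  have "\<exists>a b. a \<le> 0 \<and> 0 \<le> b \<and> a \<le> ancestor k n \<and> ancestor k n \<le> b \<and> (\<forall>i. a \<le> i \<and> i \<le> b \<longrightarrow> W' n i = W n i)"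
    if "n \<le> N" for n
    using that
  proof (induction rule: inc_induct)
    case base
    show ?case using N eq by (intro exI[of _ 0]) auto
  next
    case (step n)
    then obtain a b where ab: "a \<le> 0" "0 \<le> b" "a \<le> ancestor k (Suc n)" "ancestor k (Suc n) \<le> b"
      and W: "\<And>i. a \<le> i \<Longrightarrow> i \<le> b \<Longrightarrow> W' (Suc n) i = W (Suc n) i" by blast
    have p0: "pos' n 0 = pos n 0" using pos_0_eq W'.pos_0_eq eq by simp
    have up: "pos' n i = pos n i" if "0 \<le> i" "i \<le> b + 1" for i
      using that
    proof (induction i rule: int_ge_induct)
      case (step i)
      then show ?case using derivesD(1)[OF derives[of n], of i] derivesD(1)[OF W'.derives[of n], of i] W[of i] ab by simp
    qed (use p0 in simp)
    have "i \<le> 0 \<Longrightarrow> a \<le> i \<longrightarrow> pos' n i = pos n i" for i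
    proof (induction i rule: int_le_induct)
      case (step i)
      then show ?case using derivesD(1)[OF derives[of n], of "i - 1"] derivesD(1)[OF W'.derives[of n], of "i - 1"] W[of "i - 1"] ab
        by auto
    qed (use p0 in simp)
    then have down: "pos' n i = pos n i" if "a \<le> i" "i \<le> 0" for i using that by blast
    have pp: "pos' n i = pos n i" if "a \<le> i" "i \<le> b + 1" for i
      using up[of i] down[of i] that by linarith
    have "pos n a \<le> pos n 0" "pos n 1 \<le> pos n (b + 1)" "pos n a \<le> pos n (ancestor k (Suc n))"
      "pos n (ancestor k (Suc n) + 1) \<le> pos n (b + 1)"
      using derives_pos_mono[OF derives[of n]] ab by simp_all
    moreover have "W' n i = W n i" if i: "pos n a \<le> i" "i \<le> pos n (b + 1) - 1" for i
    proof -
      have j: "a \<le> block n i" "block n i \<le> b"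
      proof -
        show "a \<le> block n i"
        proof (rule ccontr)
          assume "\<not> a \<le> block n i"
          then have "pos n (block n i + 1) \<le> pos n a" by (intro derives_pos_mono[OF derives]) simp
          then show False using block(2)[of n i] i by linarith
        qed
        show "block n i \<le> b"
        proof (rule ccontr)
          assume "\<not> block n i \<le> b"
          then have "pos n (b + 1) \<le> pos n (block n i)" by (intro derives_pos_mono[OF derives]) simp
          then show False using block(1)[of n i] i by linarith
        qed
      qed
      define r where "r = nat (i - pos n (block n i))"
      have r: "i = pos n (block n i) + int r" "r < length (\<sigma> (W (Suc n) (block n i)))"
        using block[of n i] derivesD(1)[OF derives[of n], of "block n i"] unfolding r_def by simp_all
      show ?thesis
        using derivesD(2)[OF derives[of n] r(2)] derivesD(2)[OF W'.derives[of n], of r "block n i"] r W[OF j] pp[of "block n i"] j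
        by simp
    qed
    ultimately show ?case
      using pos_0[of n] pos_1[of n] block[of n "ancestor k n"]
      by (intro exI[of _ "pos n a"] exI[of _ "pos n (b + 1) - 1"]) auto
  qed
  from this[of 0] show "W' 0 k = W 0 k" by auto
qed

lemma windows_occur:
  "i \<le> j \<Longrightarrow> \<exists>a b. map (W 0) [a..b] = (\<sigma>_word ^^ n) (map (W n) [i..j])
     \<and> (\<forall>k. i \<le> ancestor k n \<and> ancestor k n \<le> j \<longrightarrow> a \<le> k \<and> k \<le> b)"
proof (induction n arbitrary: i j)
  case 0
  then show ?case by (intro exI[of _ i] exI[of _ j]) simp
next
  case (Suc n)
  have "pos n i < pos n (j + 1)" using derives_pos_diff[OF derives[of n], of i "j + 1"] Suc.prems by simp
  then obtain a b where ab: "map (W 0) [a..b] = (\<sigma>_word ^^ n) (map (W n) [pos n i..pos n (j + 1) - 1])"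
    "\<forall>k. pos n i \<le> ancestor k n \<and> ancestor k n \<le> pos n (j + 1) - 1 \<longrightarrow> a \<le> k \<and> k \<le> b"
    using Suc.IH[of "pos n i" "pos n (j + 1) - 1"] by auto
  show ?case
  proof (intro exI conjI allI impI)
    show "map (W 0) [a..b] = (\<sigma>_word ^^ Suc n) (map (W (Suc n)) [i..j])"
      using ab(1) derives_window[OF derives[of n] Suc.prems] by (simp add: funpow_swap1)
    fix k assume k: "i \<le> ancestor k (Suc n) \<and> ancestor k (Suc n) \<le> j"
    have "pos n i \<le> pos n (ancestor k (Suc n))" "pos n (ancestor k (Suc n) + 1) \<le> pos n (j + 1)"
      using k derives_pos_mono[OF derives[of n]] by simp_all
    then have "pos n i \<le> ancestor k n \<and> ancestor k n \<le> pos n (j + 1) - 1"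
      using block[of n "ancestor k n"] by simp
    then show "a \<le> k" "k \<le> b" using ab(2) by blast+
  qed
qed

text \<open>The two ends of a window have ancestor 0 at a common level, so the window lies inside an
  iterated image of one letter.\<close>

lemma in_\<Omega>: "W 0 \<in> \<Omega>"
proof -
  have "\<exists>n a. sublist (map (W 0) [i..j]) ((\<sigma>_word ^^ n) [a])" for i j
  proof (cases "i \<le> j")
    case True
    obtain n1 n2 where "ancestor i n1 = 0" "ancestor j n2 = 0" using ancestor_reaches_0 by blast
    then have n: "ancestor i (max n1 n2) = 0" "ancestor j (max n1 n2) = 0"
      using ancestor_stays by (meson max.cobounded1 max.cobounded2)+
    obtain a b where "map (W 0) [a..b] = (\<sigma>_word ^^ max n1 n2) (map (W (max n1 n2)) [0..0])"
      "\<forall>k. 0 \<le> ancestor k (max n1 n2) \<and> ancestor k (max n1 n2) \<le> 0 \<longrightarrow> a \<le> k \<and> k \<le> b"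
      using windows_occur[of 0 0 "max n1 n2"] by auto
    then have ab: "map (W 0) [a..b] = (\<sigma>_word ^^ max n1 n2) [W (max n1 n2) 0]" "a \<le> i" "j \<le> b"
      using n by auto
    have "[a..b] = [a..i - 1] @ [i..j] @ [j + 1..b]"
      using upto_split1[of a i b] upto_split2[of i j b] ab True by simp
    then have "sublist (map (W 0) [i..j]) (map (W 0) [a..b])" by (auto simp: sublist_def)
    then show ?thesis using ab(1) by metis
  qed simp
  then show ?thesis unfolding \<Omega>_def by blast
qed

end

lemma \<Omega>_chain:
  assumes "\<omega> \<in> \<Omega>"
  obtains W pos where "desubstitution_chain W pos" "W 0 = \<omega>"
proof -
  have ex: "\<exists>\<omega>'. \<omega>' \<in> \<Omega> \<and> (\<exists>pos. centred \<omega>' \<omega> pos)" if "\<omega> \<in> \<Omega>" for \<omega>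
    by (rule \<Omega>_centred[OF that]) blast
  have "\<exists>f. \<forall>n. (f n :: (int \<Rightarrow> letter)) \<in> \<Omega> \<and> (n = 0 \<longrightarrow> f n = \<omega>) \<and> (\<exists>pos. centred (f (Suc n)) (f n) pos)"
  proof -
    have "\<exists>f. \<forall>n. (f n \<in> \<Omega> \<and> (n = 0 \<longrightarrow> f n = \<omega>)) \<and> (\<exists>pos. centred (f (Suc n)) (f n) pos)"
      by (rule dependent_nat_choice) (use assms ex in auto)
    then show ?thesis by blast
  qed
  then obtain f where f: "f 0 = \<omega>" "\<And>n. \<exists>pos. centred (f (Suc n)) (f n) pos" by blast
  then obtain pos where "\<And>n. centred (f (Suc n)) (f n) (pos n)" by metis
  then show thesis using that[of f pos] f(1) unfolding desubstitution_chain_def by blast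
qed

section \<open>Sequences with a prescribed chain of letters\<close>

definition isum :: "(int \<Rightarrow> int) \<Rightarrow> int \<Rightarrow> int" where
  "isum f j = (if 0 \<le> j then (\<Sum>i\<in>{0..<j}. f i) else - (\<Sum>i\<in>{j..<0}. f i))"

lemma isum_Suc: "isum f (j + 1) = isum f j + f j"
proof -
  consider "0 \<le> j" | "j = - 1" | "j < - 1" by linarith
  then show ?thesis
  proof cases
    case 1
    then have "{0..<j + 1} = insert j {0..<j}" by auto
    then show ?thesis using 1 by (simp add: isum_def)
  next
    case 2
    have "{- 1..<0} = {- 1 :: int}" by auto
    then show ?thesis using 2 by (simp add: isum_def)
  next
    case 3
    then have "{j..<0} = insert j {j + 1..<0}" by auto
    then show ?thesis using 3 by (simp add: isum_def)
  qed
qed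

lemma isum_cong:
  assumes "\<And>i. - \<bar>j\<bar> \<le> i \<Longrightarrow> i \<le> \<bar>j\<bar> \<Longrightarrow> f i = g i"
  shows "isum f j = isum g j"
  unfolding isum_def using assms by (auto intro!: sum.cong)

definition block_start :: "(int \<Rightarrow> letter) \<Rightarrow> int \<Rightarrow> int \<Rightarrow> int" where
  "block_start \<omega> off j = off + isum (\<lambda>i. int (length (\<sigma> (\<omega> i)))) j"

lemma block_start_Suc: "block_start \<omega> off (j + 1) = block_start \<omega> off j + int (length (\<sigma> (\<omega> j)))"
  by (simp add: block_start_def isum_Suc)

lemma block_start_0: "block_start \<omega> off 0 = off"
  by (simp add: block_start_def isum_def)

definition substituted :: "(int \<Rightarrow> letter) \<Rightarrow> int \<Rightarrow> int \<Rightarrow> letter" where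
  "substituted \<omega> off k =
    (let j = (THE j. block_start \<omega> off j \<le> k \<and> k < block_start \<omega> off (j + 1))
     in \<sigma> (\<omega> j) ! nat (k - block_start \<omega> off j))"

lemma derives_substituted: "derives \<omega> (substituted \<omega> off) (block_start \<omega> off)"
  unfolding derives_def
proof (intro allI conjI impI)
  fix j
  show "block_start \<omega> off (j + 1) = block_start \<omega> off j + int (length (\<sigma> (\<omega> j)))"
    by (rule block_start_Suc)
  have mono: "a \<le> b \<Longrightarrow> block_start \<omega> off a \<le> block_start \<omega> off b" for a b
  proof (induction b rule: int_ge_induct)
    case (step b)
    then show ?case using block_start_Suc[of \<omega> off b] by simp
  qed simp
  fix r assume r: "r < length (\<sigma> (\<omega> j))"
  have "(THE i. block_start \<omega> off i \<le> block_start \<omega> off j + int r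
      \<and> block_start \<omega> off j + int r < block_start \<omega> off (i + 1)) = j"
  proof (rule the_equality)
    show "block_start \<omega> off j \<le> block_start \<omega> off j + int r
      \<and> block_start \<omega> off j + int r < block_start \<omega> off (j + 1)"
      using r block_start_Suc[of \<omega> off j] by simp
    fix i assume i: "block_start \<omega> off i \<le> block_start \<omega> off j + int r
      \<and> block_start \<omega> off j + int r < block_start \<omega> off (i + 1)"
    show "i = j"
    proof (rule ccontr)
      assume "i \<noteq> j"
      then have "i + 1 \<le> j \<or> j + 1 \<le> i" by linarith
      then show False using mono[of "i + 1" j] mono[of "j + 1" i] i r block_start_Suc[of \<omega> off j] by auto
    qed
  qed
  then show "substituted \<omega> off (block_start \<omega> off j + int r) = \<sigma> (\<omega> j) ! r"
    unfolding substituted_def Let_def by simp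
qed

text \<open>Letters suffice as data because no letter occurs twice in one block, so they determine
  the labels. \<open>c_left\<close> and \<open>c_right\<close> are the conditions of a full
  chain.\<close>

locale letter_chain =
  fixes c :: "nat \<Rightarrow> letter"
  assumes c_in: "c n \<in> set (\<sigma> (c (Suc n)))"
    and c_left: "\<exists>m\<ge>n. \<not> starts (c m)"
    and c_right: "\<exists>m\<ge>n. starts (c m) \<and> length (\<sigma> (c (Suc m))) = 2"
begin

definition off :: "nat \<Rightarrow> int" where
  "off n = (if starts (c n) then 0 else - 1)"

text \<open>The last position of the origin's block; \<open>off\<close> is the first one.\<close>

definition wid :: "nat \<Rightarrow> int" where
  "wid n = off n + int (length (\<sigma> (c (Suc n)))) - 1"

lemma off_le: "off n \<le> 0" and wid_ge: "0 \<le> wid n"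
  and c_nth: "\<sigma> (c (Suc n)) ! nat (- off n) = c n" and off_lt: "nat (- off n) < length (\<sigma> (c (Suc n)))"
  using c_in[of n] unfolding off_def wid_def by (cases rule: \<sigma>_cases[of "c (Suc n)"]; auto)+

text \<open>The constant sequence at level \<open>N\<close> is a placeholder: only its letter at the
  origin is meaningful, and the images of that letter grow in both directions.\<close>

primrec approx :: "nat \<Rightarrow> nat \<Rightarrow> int \<Rightarrow> letter" where
  "approx N 0 = (\<lambda>_. c N)"
| "approx N (Suc d) = substituted (approx N d) (off (N - Suc d))"

definition V :: "nat \<Rightarrow> nat \<Rightarrow> int \<Rightarrow> letter" where
  "V N n = approx N (N - n)"

lemma V_derives:
  assumes "n < N"
  shows "derives (V N (Suc n)) (V N n) (block_start (V N (Suc n)) (off n))"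
proof -
  have "N - n = Suc (N - Suc n)" "N - Suc (N - Suc n) = n" using assms by simp_all
  then have "V N n = substituted (V N (Suc n)) (off n)" unfolding V_def by simp
  then show ?thesis using derives_substituted by simp
qed

lemma V_0: "n \<le> N \<Longrightarrow> V N n 0 = c n"
proof (induction rule: inc_induct)
  case base
  show ?case by (simp add: V_def)
next
  case (step n)
  have "V N n (block_start (V N (Suc n)) (off n) 0 + int (nat (- off n))) = \<sigma> (V N (Suc n) 0) ! nat (- off n)"
    by (rule derivesD(2)[OF V_derives]) (use step off_lt in simp_all)
  then show ?case using step c_nth off_le[of n] by (simp add: block_start_0)
qed

text \<open>A crude inner estimate of the reliable window, counting one letter for each block other
  than the one at the origin; it is still unbounded on both sides.\<close>

definition lo :: "nat \<Rightarrow> nat \<Rightarrow> int" where "lo n N = (\<Sum>m\<in>{n..<N}. off m)"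
definition hi :: "nat \<Rightarrow> nat \<Rightarrow> int" where "hi n N = (\<Sum>m\<in>{n..<N}. wid m)"

lemma lo_le: "lo n N \<le> 0" and hi_ge: "0 \<le> hi n N"
  unfolding lo_def hi_def using off_le wid_ge by (auto intro: sum_nonpos sum_nonneg)

lemma window_mono:
  assumes "N \<le> N'" shows "lo n N' \<le> lo n N" "hi n N \<le> hi n N'"
proof -
  have "{n..<N'} = {n..<N} \<union> {max n N..<N'}" using assms by auto
  moreover have "{n..<N} \<inter> {max n N..<N'} = {}" by auto
  ultimately have "lo n N' = lo n N + (\<Sum>m\<in>{max n N..<N'}. off m)" "hi n N' = hi n N + (\<Sum>m\<in>{max n N..<N'}. wid m)"
    unfolding lo_def hi_def by (simp_all add: sum.union_disjoint)
  then show "lo n N' \<le> lo n N" "hi n N \<le> hi n N'"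
    using off_le wid_ge by (auto intro: sum_nonpos sum_nonneg)
qed

lemma lo_unbounded: "\<exists>N\<ge>n. lo n N \<le> - int B"
proof (induction B)
  case 0
  show ?case using lo_le by auto
next
  case (Suc B)
  then obtain N where N: "N \<ge> n" "lo n N \<le> - int B" by blast
  obtain m where m: "m \<ge> N" "\<not> starts (c m)" using c_left by blast
  have "lo n (Suc m) = lo n m + off m" unfolding lo_def using m N by simp
  then have "lo n (Suc m) \<le> - int (Suc B)" using window_mono(1)[OF m(1), of n] N m by (simp add: off_def)
  then show ?case using m N by (intro exI[of _ "Suc m"]) simp
qed

lemma hi_unbounded: "\<exists>N\<ge>n. int B \<le> hi n N"
proof (induction B)
  case 0
  show ?case using hi_ge by auto
next
  case (Suc B)
  then obtain N where N: "N \<ge> n" "int B \<le> hi n N" by blast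
  obtain m where m: "m \<ge> N" "starts (c m)" "length (\<sigma> (c (Suc m))) = 2" using c_right by blast
  have "hi n (Suc m) = hi n m + wid m" unfolding hi_def using m N by simp
  then have "int (Suc B) \<le> hi n (Suc m)" using window_mono(2)[OF m(1), of n] N m by (simp add: wid_def off_def)
  then show ?case using m N by (intro exI[of _ "Suc m"]) simp
qed

lemma window_covers: "\<exists>N\<ge>n. \<forall>k. \<bar>k\<bar> \<le> B \<longrightarrow> lo n N \<le> k \<and> k \<le> hi n N"
proof -
  obtain N1 where N1: "N1 \<ge> n" "lo n N1 \<le> - int (nat B)" using lo_unbounded by blast
  obtain N2 where N2: "N2 \<ge> n" "int (nat B) \<le> hi n N2" using hi_unbounded by blast
  have "lo n (max N1 N2) \<le> lo n N1" "hi n N2 \<le> hi n (max N1 N2)" by (intro window_mono; simp)+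
  then show ?thesis using N1 N2 by (intro exI[of _ "max N1 N2"]) (auto split: if_splits)
qed

lemma V_agree:
  assumes "N \<le> N'"
  shows "n \<le> N \<Longrightarrow> lo n N \<le> k \<Longrightarrow> k \<le> hi n N \<Longrightarrow> V N' n k = V N n k"
proof (induction arbitrary: k rule: inc_induct)
  case base
  then show ?case using V_0[of N N] V_0[of N N'] assms by (simp add: lo_def hi_def)
next
  case (step n)
  let ?p = "block_start (V N (Suc n)) (off n)" and ?p' = "block_start (V N' (Suc n)) (off n)"
  note d = V_derives[OF step(2)] and d' = V_derives[OF less_le_trans[OF step(2) assms]]
  have split: "lo n N = off n + lo (Suc n) N" "hi n N = wid n + hi (Suc n) N"
    unfolding lo_def hi_def using step(2) by (simp_all add: sum.atLeast_Suc_lessThan)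
  have p1: "?p 1 = wid n + 1"
    using block_start_Suc[of "V N (Suc n)" "off n" 0] step(2) V_0[of "Suc n" N] by (simp add: block_start_0 wid_def)
  obtain j where j: "?p j \<le> k" "k < ?p (j + 1)" using derives_block_exists[OF d] by blast
  have "lo (Suc n) N \<le> j"
  proof (rule ccontr)
    assume a: "\<not> lo (Suc n) N \<le> j"
    then have "?p (j + 1) \<le> ?p (lo (Suc n) N)" by (intro derives_pos_mono[OF d]) simp
    moreover have "0 - lo (Suc n) N \<le> ?p 0 - ?p (lo (Suc n) N)" by (rule derives_pos_diff[OF d lo_le])
    ultimately show False using j step.prems split by (simp add: block_start_0)
  qed
  moreover have "j \<le> hi (Suc n) N"
  proof (rule ccontr)
    assume a: "\<not> j \<le> hi (Suc n) N"
    then have "?p (hi (Suc n) N + 1) \<le> ?p j" by (intro derives_pos_mono[OF d]) simp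
    moreover have "hi (Suc n) N + 1 - 1 \<le> ?p (hi (Suc n) N + 1) - ?p 1"
      by (rule derives_pos_diff[OF d]) (use hi_ge in simp)
    ultimately show False using j step.prems split p1 by simp
  qed
  ultimately have jj: "V N' (Suc n) j = V N (Suc n) j" by (rule step.IH)
  have up: "?p' i = ?p i" if "0 \<le> i" "i \<le> hi (Suc n) N + 1" for i
    using that
  proof (induction i rule: int_ge_induct)
    case base then show ?case by (simp add: block_start_0)
  next
    case (step i)
    moreover have "V N' (Suc n) i = V N (Suc n) i"
      using step \<open>\<And>k. lo (Suc n) N \<le> k \<Longrightarrow> k \<le> hi (Suc n) N \<Longrightarrow> V N' (Suc n) k = V N (Suc n) k\<close>[of i] lo_le[of "Suc n" N] by simp
    ultimately show ?case by (simp add: block_start_Suc)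
  qed
  have down: "i \<le> 0 \<Longrightarrow> lo (Suc n) N \<le> i \<longrightarrow> ?p' i = ?p i" for i
  proof (induction i rule: int_le_induct)
    case base then show ?case by (simp add: block_start_0)
  next
    case (step i)
    show ?case
    proof
      assume l: "lo (Suc n) N \<le> i - 1"
      have "V N' (Suc n) (i - 1) = V N (Suc n) (i - 1)"
        using step l \<open>\<And>k. lo (Suc n) N \<le> k \<Longrightarrow> k \<le> hi (Suc n) N \<Longrightarrow> V N' (Suc n) k = V N (Suc n) k\<close>[of "i - 1"] hi_ge[of "Suc n" N] by simp
      then show "?p' (i - 1) = ?p (i - 1)"
        using step l block_start_Suc[of "V N (Suc n)" "off n" "i - 1"] block_start_Suc[of "V N' (Suc n)" "off n" "i - 1"] by simp
    qed
  qed
  have pj: "?p' j = ?p j" using up[of j] down[of j] \<open>lo (Suc n) N \<le> j\<close> \<open>j \<le> hi (Suc n) N\<close> by (cases "0 \<le> j") auto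
  define r where "r = nat (k - ?p j)"
  have r: "k = ?p j + int r" "r < length (\<sigma> (V N (Suc n) j))"
    using j block_start_Suc[of "V N (Suc n)" "off n" j] unfolding r_def by simp_all
  show ?case using derivesD(2)[OF d r(2)] derivesD(2)[OF d', of r j] r jj pj by simp
qed

definition limit :: "nat \<Rightarrow> int \<Rightarrow> letter" where
  "limit n k = V (LEAST N. n \<le> N \<and> lo n N \<le> k \<and> k \<le> hi n N) n k"

lemma limit_eq:
  assumes "n \<le> N" "lo n N \<le> k" "k \<le> hi n N"
  shows "limit n k = V N n k"
proof -
  let ?P = "\<lambda>N. n \<le> N \<and> lo n N \<le> k \<and> k \<le> hi n N"
  have "?P (LEAST N. ?P N)" by (rule LeastI[of ?P N]) (use assms in blast)
  moreover have "(LEAST N. ?P N) \<le> N" by (rule Least_le) (use assms in blast)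
  ultimately show ?thesis unfolding limit_def using V_agree by simp
qed

lemma limit_0: "limit n 0 = c n"
  using limit_eq[of n n 0] V_0[of n n] by (simp add: lo_def hi_def)

lemma limit_derives: "derives (limit (Suc n)) (limit n) (block_start (limit (Suc n)) (off n))"
  unfolding derives_def
proof (intro allI conjI impI)
  fix j
  show "block_start (limit (Suc n)) (off n) (j + 1) = block_start (limit (Suc n)) (off n) j + int (length (\<sigma> (limit (Suc n) j)))"
    by (rule block_start_Suc)
  fix r assume r: "r < length (\<sigma> (limit (Suc n) j))"
  define k where "k = block_start (limit (Suc n)) (off n) j + int r"
  \<comment> \<open>One window must contain every index summed in the block start of
    \<open>j\<close>, the other the position \<open>k\<close>; a common larger \<open>N\<close>
    serves both.\<close>
  obtain N1 where N1: "N1 \<ge> Suc n" "\<And>i. \<bar>i\<bar> \<le> \<bar>j\<bar> \<Longrightarrow> lo (Suc n) N1 \<le> i \<and> i \<le> hi (Suc n) N1"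
    using window_covers[of "Suc n" "\<bar>j\<bar>"] by blast
  obtain N2 where N2: "N2 \<ge> n" "lo n N2 \<le> k \<and> k \<le> hi n N2"
    using window_covers[of n "\<bar>k\<bar>"] by blast
  define N where "N = max N1 N2"
  have N: "Suc n \<le> N" "N1 \<le> N" "N2 \<le> N" using N1 unfolding N_def by auto
  have a: "limit (Suc n) i = V N (Suc n) i" if "\<bar>i\<bar> \<le> \<bar>j\<bar>" for i
    using limit_eq[of "Suc n" N i] N1(2)[OF that] window_mono[OF N(2), of "Suc n"] N by simp
  have b: "limit n k = V N n k"
    using limit_eq[of n N k] N2(2) window_mono[OF N(3), of n] N by simp
  have "block_start (limit (Suc n)) (off n) j = block_start (V N (Suc n)) (off n) j"
    unfolding block_start_def using isum_cong[of j "\<lambda>i. int (length (\<sigma> (limit (Suc n) i)))" "\<lambda>i. int (length (\<sigma> (V N (Suc n) i)))"] a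
    by auto
  then have "V N n k = \<sigma> (limit (Suc n) j) ! r"
    using derivesD(2)[OF V_derives[of n N], of r j] N r a[of j] unfolding k_def by simp
  then show "limit n (block_start (limit (Suc n)) (off n) j + int r) = \<sigma> (limit (Suc n) j) ! r"
    using b unfolding k_def by simp
qed

lemma limit_full_chain: "full_chain limit (\<lambda>n. block_start (limit (Suc n)) (off n))"
proof
  fix n
  have 1: "block_start (limit (Suc m)) (off m) 1 = wid m + 1" for m
    using block_start_Suc[of "limit (Suc m)" "off m" 0] by (simp add: block_start_0 limit_0 wid_def)
  show "centred (limit (Suc n)) (limit n) (block_start (limit (Suc n)) (off n))"
    unfolding centred_def using limit_derives 1 wid_ge[of n] off_le by (simp add: block_start_0)
  show "\<exists>m\<ge>n. block_start (limit (Suc m)) (off m) 0 < 0"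
    using c_left[of n] by (auto simp: block_start_0 off_def)
  show "\<exists>m\<ge>n. 1 < block_start (limit (Suc m)) (off m) 1"
    using c_right[of n] unfolding 1 by (auto simp: wid_def off_def)
qed

end

section \<open>The two orbits\<close>

lemma shift_orbit_self: "\<omega> \<in> shift_orbit \<omega>"
proof -
  have "\<omega> = (\<lambda>i. \<omega> (i + 0))" by simp
  then show ?thesis unfolding shift_orbit_def by blast
qed

lemma shift_orbit_eq: "\<omega>' = (\<lambda>i. \<omega> (i + k)) \<Longrightarrow> shift_orbit \<omega>' = shift_orbit \<omega>"
proof -
  assume e: "\<omega>' = (\<lambda>i. \<omega> (i + k))"
  have "(\<lambda>i. \<omega>' (i + j)) = (\<lambda>i. \<omega> (i + (j + k)))" for j unfolding e by (simp add: add.assoc)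
  moreover have "(\<lambda>i. \<omega> (i + j)) = (\<lambda>i. \<omega>' (i + (j - k)))" for j unfolding e by simp
  ultimately show ?thesis unfolding shift_orbit_def by blast
qed

lemma labels_determined: "(p, c, s) \<in> labels a \<Longrightarrow> (p', c, s') \<in> labels a \<Longrightarrow> p = p'"
  by (cases a) (auto simp: labels_eq)

lemma labels_in_\<sigma>: "(p, c, s) \<in> labels a \<Longrightarrow> c \<in> set (\<sigma> a)"
  by (auto simp: labels_def)

lemma minimal_sequence_scaled:
  assumes "\<gamma> = z *s \<Gamma>"
  shows "minimal_sequence \<gamma> \<omega> \<longleftrightarrow> \<omega> \<in> \<Omega> \<and> (\<forall>k. 0 \<le> Re (z * seq_sum \<Gamma> \<omega> k))"
proof -
  have w: "word_sum \<gamma> w = z * word_sum \<Gamma> w" for w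
    by (induction w) (simp_all add: assms algebra_simps)
  have "seq_sum \<gamma> \<omega> k = z * seq_sum \<Gamma> \<omega> k" for k
    by (simp add: seq_sum_def w)
  then show ?thesis by (simp add: minimal_sequence_def)
qed

context sector_chain
begin

text \<open>Below \<open>AD\<close>, the first thread has letter 6 in \<open>BE\<close> and the
  second has letter 5 in \<open>EA\<close>; neither starts a block. Below \<open>EH\<close>, both
  pass through \<open>AB\<close> to a starting letter in \<open>BD\<close>, inside a block of length
  two.\<close>

lemma thread_turns:
  assumes "(\<forall>n\<ge>M. c n = thread1 (S n)) \<or> (\<forall>n\<ge>M. c n = thread2 (S n))"
  shows "\<exists>m\<ge>n. \<not> starts (c m)" "\<exists>m\<ge>n. starts (c m) \<and> length (\<sigma> (c (Suc m))) = 2"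
proof -
  obtain i where i: "i \<ge> max n M + 3" "S i = AD" using AD_often by blast
  define m where "m = i - 3"
  have m: "i = m + 3" "n \<le> m" "M \<le> m" using i unfolding m_def by auto
  have s: "S (m + 1) = BH" using S_AD[of "m + 1"] i m by (simp add: numeral_3_eq_3)
  have "S (m + 2) = EA" "S m = BE"
    using S_step[of "m + 2"] S_step[of m] s i m by (simp_all add: numeral_3_eq_3)
  then have "\<not> starts (c m) \<or> \<not> starts (c (m + 2))" using assms m by (auto simp: starts_def)
  then show "\<exists>m\<ge>n. \<not> starts (c m)" using m(2) by (metis trans_le_add1)
  obtain i where i: "i \<ge> max n M + 2" "S i = EH" using EH_often by blast
  define m where "m = i - 2"
  have m: "i = Suc (Suc m)" "n \<le> m" "M \<le> m" using i unfolding m_def by auto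
  have a: "S (Suc m) = AB" using S_step[of "Suc m"] i m by simp
  then have b: "S m = BD" using S_step[of m] m by simp
  have "starts (c m) \<and> length (\<sigma> (c (Suc m))) = 2" using assms a b m by (auto simp: starts_def)
  then show "\<exists>m\<ge>n. starts (c m) \<and> length (\<sigma> (c (Suc m))) = 2" using m by blast
qed

end

section \<open>From threads to orbits\<close>

locale minimal_chains = sector_chain +
  fixes z :: complex
  assumes letter_choice: "\<And>n a p c s. M \<le> n \<Longrightarrow> (p, c, s) \<in> labels a
    \<Longrightarrow> minwalk z (Suc n) a = cost z n p + minwalk z n c \<Longrightarrow> c \<in> choices (S (Suc n)) (S n) a"
begin

definition minimal_for :: "(int \<Rightarrow> letter) \<Rightarrow> bool" where
  "minimal_for \<omega> \<longleftrightarrow> \<omega> \<in> \<Omega> \<and> (\<forall>k. 0 \<le> Re (z * seq_sum \<Gamma> \<omega> k))"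

definition follows :: "(sector \<Rightarrow> letter) \<Rightarrow> (int \<Rightarrow> letter) \<Rightarrow> bool" where
  "follows th \<omega> \<longleftrightarrow> (\<exists>W pos. full_chain W pos \<and> W 0 = \<omega> \<and> (\<forall>n\<ge>M. W n 0 = th (S n)))"

lemma minimal_follows:
  assumes "minimal_for \<omega>"
  shows "follows thread1 \<omega> \<or> follows thread2 \<omega>"
proof -
  obtain W pos where W: "desubstitution_chain W pos" "W 0 = \<omega>"
    using \<Omega>_chain[of \<omega>] assms unfolding minimal_for_def by blast
  interpret desubstitution_chain W pos by (rule W)
  have c: "W n 0 \<in> choices (S (Suc n)) (S n) (W (Suc n) 0)" if "M \<le> n" for n
  proof (rule letter_choice[OF that])
    show "(prefix_at n 0, W n 0, drop (Suc (nat (0 - pos n (block n 0)))) (\<sigma> (W (Suc n) (block n 0)))) \<in> labels (W (Suc n) 0)"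
      using prefix_label[of n 0] unfolding block_0 .
    show "minwalk z (Suc n) (W (Suc n) 0) = cost z n (prefix_at n 0) + minwalk z n (W n 0)"
      by (rule optimal_if_minimal) (use assms W in \<open>simp add: minimal_for_def\<close>)
  qed
  \<comment> \<open>Switching threads is impossible: each thread persists down to level
    \<open>M\<close>, where the two letters differ.\<close>
  have th: "(\<forall>n\<ge>M. W n 0 = thread1 (S n)) \<or> (\<forall>n\<ge>M. W n 0 = thread2 (S n))"
  proof -
    have i: "W n 0 = thread1 (S n) \<or> W n 0 = thread2 (S n)" if "M \<le> n" for n
      using chain_in_threads[of "\<lambda>n. W n 0", OF c that] by simp
    have p: "W n 0 = thread1 (S n) \<Longrightarrow> W M 0 = thread1 (S M)" "W n 0 = thread2 (S n) \<Longrightarrow> W M 0 = thread2 (S M)"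
      if "M \<le> n" for n
      using thread_persists[of "\<lambda>n. W n 0", OF c order_refl that] by simp_all
    show ?thesis using i p thread_distinct[of "S M"] by metis
  qed
  have "full_chain W pos"
  proof
    fix n
    show "\<exists>m\<ge>n. pos m 0 < 0" using thread_turns(1)[OF th, of n] pos_0_eq by auto
    obtain m where m: "m \<ge> n" "starts (W m 0)" "length (\<sigma> (W (Suc m) 0)) = 2"
      using thread_turns(2)[OF th, of n] by blast
    then have "pos m 1 = 2" using pos_0_eq[of m] derivesD(1)[OF derives[of m], of 0] by simp
    then show "\<exists>m\<ge>n. 1 < pos m 1" using m by (intro exI[of _ m]) simp
  qed
  then show ?thesis unfolding follows_def using W th by blast
qed

text \<open>From level \<open>M\<close> on the letters agree, so the sequences at that level
  coincide; different choices below it amount to a shift.\<close>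

lemma follows_same_orbit:
  assumes "follows th \<omega>" "follows th \<omega>'"
  shows "shift_orbit \<omega>' = shift_orbit \<omega>"
proof -
  obtain W pos W' pos' where W: "full_chain W pos" "W 0 = \<omega>" "\<forall>n\<ge>M. W n 0 = th (S n)"
    and W': "full_chain W' pos'" "W' 0 = \<omega>'" "\<forall>n\<ge>M. W' n 0 = th (S n)"
    using assms unfolding follows_def by blast
  interpret W: full_chain W pos by (rule W)
  interpret W': full_chain W' pos' by (rule W')
  interpret Ws: full_chain "\<lambda>n. W (n + M)" "\<lambda>n. pos (n + M)" by (rule W.shifted_full)
  have "W' (0 + M) = W (0 + M)"
    by (rule Ws.determined_by_letters[OF W'.shifted_chain]) (use W W' in simp)
  then have "\<exists>k. W' 0 = (\<lambda>i. W 0 (i + k))"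
    using W.same_orbit_from_level[OF W'.desubstitution_chain_axioms, of M 0] by simp
  then show ?thesis using W(2) W'(2) shift_orbit_eq by blast
qed

text \<open>A shift disappears at the level where its ancestor is 0, so shifted sequences eventually
  have equal origin letters, unlike the two threads.\<close>

lemma follows_distinct_orbits:
  assumes "follows thread1 \<omega>" "follows thread2 \<omega>'"
  shows "shift_orbit \<omega>' \<noteq> shift_orbit \<omega>"
proof
  assume "shift_orbit \<omega>' = shift_orbit \<omega>"
  then obtain k where k: "\<omega>' = (\<lambda>i. \<omega> (i + k))"
    using shift_orbit_self[of \<omega>'] unfolding shift_orbit_def by auto
  obtain W pos W' pos' where W: "full_chain W pos" "W 0 = \<omega>" "\<forall>n\<ge>M. W n 0 = thread1 (S n)"
    and W': "full_chain W' pos'" "W' 0 = \<omega>'" "\<forall>n\<ge>M. W' n 0 = thread2 (S n)"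
    using assms unfolding follows_def by blast
  interpret W: full_chain W pos by (rule W)
  interpret W': full_chain W' pos' by (rule W')
  obtain n where "W.ancestor k n = 0" using W.ancestor_reaches_0 by blast
  then have n: "W.ancestor k (max n M) = 0" by (rule W.ancestor_stays) simp
  have "W' (max n M) 0 = W (max n M) 0"
    using W.shift_ancestor[OF W'.desubstitution_chain_axioms, of k "max n M"] n k W W' by simp
  then show False using W(3) W'(3) thread_distinct[of "S (max n M)"] by simp
qed

lemma thread_realised:
  assumes th: "th = thread1 \<or> th = thread2"
  obtains \<omega> where "minimal_for \<omega>" "follows th \<omega>"
proof -
  define R where "R n a b \<longleftrightarrow> (\<exists>p s. (p, b, s) \<in> labels a \<and> minwalk z (Suc n) a = cost z n p + minwalk z n b)" for n a b
  have R_ex: "\<exists>b. R n a b" for n a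
    using minwalk_attained[of a z n] unfolding R_def by blast
  \<comment> \<open>The thread is prolonged below level \<open>M\<close> by arbitrary minimising
    labels, with \<open>d\<close> counting downwards.\<close>
  define cc where "cc = rec_nat (th (S M)) (\<lambda>d a. SOME b. R (M - Suc d) a b)"
  have cc: "cc 0 = th (S M)" "R (M - Suc d) (cc d) (cc (Suc d))" for d
    unfolding cc_def using someI_ex[OF R_ex] by simp_all
  define c where "c n = (if M \<le> n then th (S n) else cc (M - n))" for n
  have Rc: "R n (c (Suc n)) (c n)" for n
  proof (cases "M \<le> n")
    case True
    obtain b where b: "R n (c (Suc n)) b" using R_ex by blast
    \<comment> \<open>Some label is always minimising, and on a thread the table admits a single
      letter; hence the thread itself is optimal.\<close>
    then have "b \<in> choices (S (Suc n)) (S n) (c (Suc n))" unfolding R_def using letter_choice[OF True] by blast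
    moreover have "choices (S (Suc n)) (S n) (th (S (Suc n))) = {th (S n)}"
      using thread_step[OF S_step[OF True]] th by auto
    ultimately have "b = c n" unfolding c_def using True by simp
    then show ?thesis using b by simp
  next
    case False
    then have n: "M - n = Suc (M - Suc n)" "M - Suc (M - Suc n) = n" by simp_all
    have "c (Suc n) = cc (M - Suc n)" unfolding c_def using False cc(1) by (auto simp: not_le le_Suc_eq)
    then show ?thesis using cc(2)[of "M - Suc n"] n False unfolding c_def by simp
  qed
  have follow: "\<forall>n\<ge>M. c n = th (S n)" unfolding c_def by simp
  then have follow': "(\<forall>n\<ge>M. c n = thread1 (S n)) \<or> (\<forall>n\<ge>M. c n = thread2 (S n))" using th by blast
  interpret letter_chain c
  proof
    fix n
    show "c n \<in> set (\<sigma> (c (Suc n)))" using Rc[of n] labels_in_\<sigma> unfolding R_def by blast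
    show "\<exists>m\<ge>n. \<not> starts (c m)" "\<exists>m\<ge>n. starts (c m) \<and> length (\<sigma> (c (Suc m))) = 2"
      by (rule thread_turns[OF follow'])+
  qed
  interpret full_chain limit "\<lambda>n. block_start (limit (Suc n)) (off n)" by (rule limit_full_chain)
  have "minwalk z (Suc n) (limit (Suc n) 0) = cost z n (prefix_at n 0) + minwalk z n (limit n 0)" for n
  proof -
    obtain p s where p: "(p, c n, s) \<in> labels (c (Suc n))" "minwalk z (Suc n) (c (Suc n)) = cost z n p + minwalk z n (c n)"
      using Rc[of n] unfolding R_def by blast
    have "prefix_at n 0 = p"
      using labels_determined[OF prefix_label[of n 0, unfolded block_0 limit_0] p(1)] .
    then show ?thesis using p(2) unfolding limit_0 by simp
  qed
  then have "minimal_for (limit 0)" unfolding minimal_for_def using minimal_if_optimal in_\<Omega> by blast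
  moreover have "follows th (limit 0)"
    unfolding follows_def using limit_full_chain follow
    by (intro exI[of _ limit] exI[of _ "\<lambda>n. block_start (limit (Suc n)) (off n)"]) (simp add: limit_0)
  ultimately show thesis by (rule that)
qed

lemma two_orbits: "card {X \<in> shift_orbit ` \<Omega>. \<exists>\<omega>\<in>X. minimal_for \<omega>} = 2"
proof -
  obtain \<omega>1 where w1: "minimal_for \<omega>1" "follows thread1 \<omega>1" using thread_realised by blast
  obtain \<omega>2 where w2: "minimal_for \<omega>2" "follows thread2 \<omega>2" using thread_realised by blast
  have "{X \<in> shift_orbit ` \<Omega>. \<exists>\<omega>\<in>X. minimal_for \<omega>} = {shift_orbit \<omega>1, shift_orbit \<omega>2}"
  proof (intro equalityI subsetI)
    fix X assume "X \<in> {X \<in> shift_orbit ` \<Omega>. \<exists>\<omega>\<in>X. minimal_for \<omega>}"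
    then obtain \<omega>0 \<omega> where X: "X = shift_orbit \<omega>0" "\<omega> \<in> shift_orbit \<omega>0" "minimal_for \<omega>" by blast
    from X(2) obtain k where "\<omega> = (\<lambda>i. \<omega>0 (i + k))" unfolding shift_orbit_def by blast
    then have "X = shift_orbit \<omega>" using shift_orbit_eq X(1) by simp
    moreover from minimal_follows[OF X(3)]
    have "shift_orbit \<omega> = shift_orbit \<omega>1 \<or> shift_orbit \<omega> = shift_orbit \<omega>2"
      using follows_same_orbit[OF w1(2)] follows_same_orbit[OF w2(2)] by blast
    ultimately show "X \<in> {shift_orbit \<omega>1, shift_orbit \<omega>2}" by simp
  next
    fix X assume "X \<in> {shift_orbit \<omega>1, shift_orbit \<omega>2}"
    then obtain \<omega> where X: "X = shift_orbit \<omega>" "minimal_for \<omega>" using w1(1) w2(1) by blast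
    then have "\<omega> \<in> \<Omega>" by (simp add: minimal_for_def)
    then show "X \<in> {X \<in> shift_orbit ` \<Omega>. \<exists>\<omega>\<in>X. minimal_for \<omega>}"
      using X shift_orbit_self by blast
  qed
  moreover have "shift_orbit \<omega>2 \<noteq> shift_orbit \<omega>1" by (rule follows_distinct_orbits) fact+
  ultimately show ?thesis by auto
qed

end

theorem theorem3p8:
  fixes \<gamma> :: "complex ^ letter"
  assumes "good_eigenvector \<gamma>"
  shows "card {X \<in> shift_orbit ` \<Omega>. \<exists>\<omega>\<in>X. minimal_sequence \<gamma> \<omega>} = 2"
proof -
  obtain z where z: "z \<noteq> 0" "\<gamma> = z *s \<Gamma>" using assms unfolding good_eigenvector_def by blast
  obtain S M where S: "sector_chain S M"
    and choice: "\<And>n a p c s. M \<le> n \<Longrightarrow> (p, c, s) \<in> labels a \<Longrightarrow> minwalk z (Suc n) a = cost z n p + minwalk z n c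
       \<Longrightarrow> c \<in> choices (S (Suc n)) (S n) a"
    by (rule eventual_letter_choices[OF z(1)]) blast
  interpret sector_chain S M by (rule S)
  interpret minimal_chains S M z by unfold_locales (rule choice)
  show ?thesis using two_orbits unfolding minimal_for_def minimal_sequence_scaled[OF z(2)] .
qed

end
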